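(* Let $\phi:=\tfrac12(2Z+n-2)$, where $Z=\sum_{\alpha>0}c_\alpha s_\alpha$. The element $\mathfrak{D}_0=(\mathcal{D}-\phi)\in\mathsf{A}\otimes\mathcal{C}$ is a square root of a Casimir element of $\mathfrak{sl}(2)$.
   Context: Setting. $(E,B)$ is a Euclidean space of dimension $n$ affording the reflection representation of a finite (real) reflection group $W\subset\mathsf{O}(E,B)$. $R\subset E^*$ is the root system, $R^\vee\subset E$ the dual root system with $\langle\alpha,\alpha^\vee\rangle=2$, where $\langle-,-\rangle\colon E^*\times E\to\mathbb{R}$ is the natural pairing; $s_\alpha\in W$ is the reflection $s_\alpha(y)=y-\langle\alpha,y\rangle\alpha^\vee$. A positive system $R_+$ is fixed (sums over $\alpha>0$ are over $R_+$), and $c\colon R_+\to\mathbb{C}$, $\alpha\mapsto c_\alpha$, is a $W$-invariant parameter function. Put $\mathfrak{h}=E_{\mathbb{C}}$, $\mathfrak{h}^*=E^*_{\mathbb{C}}$. Fix an orthonormal basis $y_1,\dots,y_n$ of $E$ and let $x_1,\dots,x_n$ be the dual basis of $E^*$. Rational Cherednik algebra $\mathsf{H}$: the quotient of the smash product $T(\mathfrak{h}^*\oplus\mathfrak{h})\#W$ by $[x,x']=0=[y,y']$ and $[y,x]=\langle x,y\rangle+\sum_{\alpha>0}c_\alpha\langle\alpha,y\rangle\langle x,\alpha^\vee\rangle s_\alpha$ for $x,x'\in\mathfrak{h}^*$, $y,y'\in\mathfrak{h}$. Dunkl angular momentum algebra $\mathsf{A}$: the associative subalgebra of $\mathsf{H}$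 generated by $W$ and the elements $M_{ij}=x_iy_j-x_jy_i$, $1\le i<j\le n$. The copy of $\mathfrak{sl}(2)$ in question is the one spanned in $\mathsf{H}$ by $H=\tfrac12\sum_i(x_iy_i+y_ix_i)$, $X=-\tfrac12\sum_ix_i^2$, $Y=\tfrac12\sum_iy_i^2$; its quadratic Casimir element is $\Omega_{\mathfrak{sl}(2)}=H^2+2(XY+YX)$. $\mathcal{C}$ is the complex Clifford algebra with generators $c_1,\dots,c_n$ and relations $c_ic_j+c_jc_i=2\delta_{ij}$. The Dirac element of the angular momentum algebra is $\mathcal{D}=\sum_{i<j}M_{ij}\otimes c_ic_j\in\mathsf{A}\otimes\mathcal{C}$. Elements $a$ of $\mathsf{A}$ are identified with $a\otimes1\in\mathsf{A}\otimes\mathcal{C}$. *)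

theory Defs
  imports
    "HOL-Analysis.Analysis"
    "HOL-Library.Poly_Mapping"
    "HOL-Algebra.QuotRing"
    "HOL-Algebra.Subrings"
    "HOL-Algebra.Module"
begin

section \<open>Root systems of finite real reflection groups\<close>

text \<open>
  The space \<open>E\<close> is a type of class \<^class>\<open>euclidean_space\<close>, with \<open>B\<close> its inner product.  All linear
  functionals on it are bounded, so the dual space is the type of bounded linear functionals and
  the natural pairing is function application.
\<close>

type_synonym 'e dual = "'e \<Rightarrow>\<^sub>L real"

text \<open>
  The coroot is the vector for which \<open>y - \<langle>\<alpha>, y\<rangle> \<alpha>\<^sup>\<or>\<close> is the orthogonal reflection in the
  hyperplane \<open>ker \<alpha>\<close>; in particular \<open>\<langle>\<alpha>, \<alpha>\<^sup>\<or>\<rangle> = 2\<close>.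
\<close>

definition riesz :: "'e::euclidean_space dual \<Rightarrow> 'e" where
  "riesz \<alpha> = (\<Sum>b\<in>Basis. blinfun_apply \<alpha> b *\<^sub>R b)"

definition coroot :: "'e::euclidean_space dual \<Rightarrow> 'e" where
  "coroot \<alpha> = (2 / (riesz \<alpha> \<bullet> riesz \<alpha>)) *\<^sub>R riesz \<alpha>"

definition reflection :: "'e::euclidean_space dual \<Rightarrow> 'e \<Rightarrow> 'e" where
  "reflection \<alpha> y = y - blinfun_apply \<alpha> y *\<^sub>R coroot \<alpha>"

definition act_dual :: "('e::euclidean_space \<Rightarrow> 'e) \<Rightarrow> 'e dual \<Rightarrow> 'e dual" where
  "act_dual w f = Blinfun (\<lambda>y. blinfun_apply f (inv_into UNIV w y))"

text \<open>
  Reduced root systems, neither assumed crystallographic nor assumed to span the dual space.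
\<close>

definition root_system :: "'e::euclidean_space dual set \<Rightarrow> bool" where
  "root_system R \<longleftrightarrow>
     finite R \<and> 0 \<notin> R \<and>
     (\<forall>\<alpha>\<in>R. \<forall>t::real. t *\<^sub>R \<alpha> \<in> R \<longleftrightarrow> t = 1 \<or> t = -1) \<and>
     (\<forall>\<alpha>\<in>R. act_dual (reflection \<alpha>) ` R = R)"

definition positive_system :: "'e::euclidean_space dual set \<Rightarrow> 'e dual set \<Rightarrow> bool" where
  "positive_system R Rp \<longleftrightarrow>
     (\<exists>\<rho>. (\<forall>\<alpha>\<in>R. blinfun_apply \<alpha> \<rho> \<noteq> 0) \<and> Rp = {\<alpha>\<in>R. blinfun_apply \<alpha> \<rho> > 0})"

text \<open>Reflections are involutions, so the monoid they generate is a group.\<close>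

inductive_set reflection_group :: "'e::euclidean_space dual set \<Rightarrow> ('e \<Rightarrow> 'e) set"
  for R where
  id: "id \<in> reflection_group R"
| step: "\<alpha> \<in> R \<Longrightarrow> w \<in> reflection_group R \<Longrightarrow> reflection \<alpha> \<circ> w \<in> reflection_group R"

text \<open>
  \<open>W\<close>-invariance of a function given on positive roots only, i.e. constancy on the sets
  \<open>W\<alpha> \<inter> R\<^sub>+\<close>.  (As \<open>-\<alpha> = s\<^sub>\<alpha> \<alpha>\<close>, no separate clause for signs is needed.)
\<close>

definition invariant_parameter ::
    "'e::euclidean_space dual set \<Rightarrow> 'e dual set \<Rightarrow> ('e dual \<Rightarrow> complex) \<Rightarrow> bool" where
  "invariant_parameter R Rp c \<longleftrightarrow>
     (\<forall>\<alpha>\<in>Rp. \<forall>w\<in>reflection_group R. act_dual w \<alpha> \<in> Rp \<longrightarrow> c (act_dual w \<alpha>) = c \<alpha>)"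

definition orthonormal_basis :: "(nat \<Rightarrow> 'e::euclidean_space) \<Rightarrow> bool" where
  "orthonormal_basis y \<longleftrightarrow>
     (\<forall>i\<in>{1..DIM('e)}. \<forall>j\<in>{1..DIM('e)}. y i \<bullet> y j = (if i = j then 1 else 0))"

definition dual_basis :: "(nat \<Rightarrow> 'e::euclidean_space) \<Rightarrow> (nat \<Rightarrow> 'e dual) \<Rightarrow> bool" where
  "dual_basis y x \<longleftrightarrow>
     (\<forall>i\<in>{1..DIM('e)}. \<forall>j\<in>{1..DIM('e)}. blinfun_apply (x i) (y j) = (if i = j then 1 else 0))"


section \<open>Associative complex algebras\<close>

text \<open>
  A complex algebra is represented by the record \<open>module\<close> of HOL-Algebra: a ring record together
  with a scalar multiplication by \<^typ>\<open>complex\<close>.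
\<close>

type_synonym 'a complex_alg = "(complex, 'a) module"

definition monoid_alg :: "('g, 'm) monoid_scheme \<Rightarrow> ('g \<Rightarrow>\<^sub>0 complex) complex_alg" where
  "monoid_alg G =
     \<lparr> carrier = {f. Poly_Mapping.keys f \<subseteq> carrier G},
       mult = (\<lambda>f h. \<Sum>a\<in>Poly_Mapping.keys f. \<Sum>b\<in>Poly_Mapping.keys h.
                 Poly_Mapping.single (a \<otimes>\<^bsub>G\<^esub> b) (Poly_Mapping.lookup f a * Poly_Mapping.lookup h b)),
       one = Poly_Mapping.single \<one>\<^bsub>G\<^esub> 1,
       zero = 0,
       add = (+),
       smult = (\<lambda>z. Poly_Mapping.map ((*) z)) \<rparr>"

definition quot_alg :: "(complex, 'a, 'm) module_scheme \<Rightarrow> 'a set \<Rightarrow> 'a set complex_alg" where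
  "quot_alg A I =
     \<lparr> carrier = carrier (A Quot I),
       mult = mult (A Quot I),
       one = one (A Quot I),
       zero = zero (A Quot I),
       add = add (A Quot I),
       smult = (\<lambda>z S. \<Union>a\<in>S. I +>\<^bsub>A\<^esub> (z \<odot>\<^bsub>A\<^esub> a)) \<rparr>"

definition presented_alg ::
    "('g, 'm) monoid_scheme \<Rightarrow> ('g \<Rightarrow>\<^sub>0 complex) set \<Rightarrow> ('g \<Rightarrow>\<^sub>0 complex) set complex_alg" where
  "presented_alg G S = quot_alg (monoid_alg G) (Idl\<^bsub>monoid_alg G\<^esub> S)"

definition presented_cls ::
    "('g, 'm) monoid_scheme \<Rightarrow> ('g \<Rightarrow>\<^sub>0 complex) set \<Rightarrow> 'g \<Rightarrow> ('g \<Rightarrow>\<^sub>0 complex) set" where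
  "presented_cls G S g =
     (Idl\<^bsub>monoid_alg G\<^esub> S) +>\<^bsub>monoid_alg G\<^esub> (Poly_Mapping.single g 1)"

definition generated_subalg ::
    "(complex, 'a, 'm) module_scheme \<Rightarrow> 'a set \<Rightarrow> (complex, 'a, 'm) module_scheme" where
  "generated_subalg A S = A\<lparr>carrier :=
     \<Inter>{B. subring B A \<and> (\<forall>z. \<forall>b\<in>B. z \<odot>\<^bsub>A\<^esub> b \<in> B) \<and> S \<subseteq> B}\<rparr>"

text \<open>
  The tensor product over \<open>\<complex>\<close> is the free vector space on pairs modulo the bilinearity relations.
  Here the free vector space is the monoid algebra of the product of the two multiplicative
  monoids, so that \<open>(a \<otimes> b)(a' \<otimes> b') = aa' \<otimes> bb'\<close>.
\<close>

definition tensor_rels ::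
    "(complex, 'a, 'm) module_scheme \<Rightarrow> (complex, 'b, 'k) module_scheme \<Rightarrow>
     ('a \<times> 'b \<Rightarrow>\<^sub>0 complex) set" where
  "tensor_rels A B =
     {Poly_Mapping.single (a \<oplus>\<^bsub>A\<^esub> a', b) 1 - Poly_Mapping.single (a, b) 1
        - Poly_Mapping.single (a', b) 1 | a a' b.
        a \<in> carrier A \<and> a' \<in> carrier A \<and> b \<in> carrier B} \<union>
     {Poly_Mapping.single (a, b \<oplus>\<^bsub>B\<^esub> b') 1 - Poly_Mapping.single (a, b) 1
        - Poly_Mapping.single (a, b') 1 | a b b'.
        a \<in> carrier A \<and> b \<in> carrier B \<and> b' \<in> carrier B} \<union>
     {Poly_Mapping.single (z \<odot>\<^bsub>A\<^esub> a, b) 1 - Poly_Mapping.single (a, b) z | z a b.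
        a \<in> carrier A \<and> b \<in> carrier B} \<union>
     {Poly_Mapping.single (a, z \<odot>\<^bsub>B\<^esub> b) 1 - Poly_Mapping.single (a, b) z | z a b.
        a \<in> carrier A \<and> b \<in> carrier B}"

definition tensor_alg ::
    "(complex, 'a, 'm) module_scheme \<Rightarrow> (complex, 'b, 'k) module_scheme \<Rightarrow>
     ('a \<times> 'b \<Rightarrow>\<^sub>0 complex) set complex_alg" where
  "tensor_alg A B = presented_alg (A \<times>\<times> B) (tensor_rels A B)"

definition tensor_elt ::
    "(complex, 'a, 'm) module_scheme \<Rightarrow> (complex, 'b, 'k) module_scheme \<Rightarrow>
     'a \<Rightarrow> 'b \<Rightarrow> ('a \<times> 'b \<Rightarrow>\<^sub>0 complex) set" where
  "tensor_elt A B a b = presented_cls (A \<times>\<times> B) (tensor_rels A B) (a, b)"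


section \<open>The Clifford algebra\<close>

definition words :: "'a set \<Rightarrow> 'a list monoid" where
  "words X = \<lparr> carrier = lists X, mult = (@), one = [] \<rparr>"

definition clifford_rels :: "nat \<Rightarrow> (nat list \<Rightarrow>\<^sub>0 complex) set" where
  "clifford_rels n =
     {Poly_Mapping.single [i, j] 1 + Poly_Mapping.single [j, i] 1
        - Poly_Mapping.single [] (if i = j then 2 else 0) | i j. i \<in> {1..n} \<and> j \<in> {1..n}}"

definition clifford :: "nat \<Rightarrow> (nat list \<Rightarrow>\<^sub>0 complex) set complex_alg" where
  "clifford n = presented_alg (words {1..n}) (clifford_rels n)"

definition clifford_gen :: "nat \<Rightarrow> nat \<Rightarrow> (nat list \<Rightarrow>\<^sub>0 complex) set" where
  "clifford_gen n i = presented_cls (words {1..n}) (clifford_rels n) [i]"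


section \<open>The rational Cherednik algebra\<close>

text \<open>A pair \<open>(u, v)\<close> stands for the element \<open>u + \<i>v\<close> of the complexification.\<close>

type_synonym 'a cplxn = "'a \<times> 'a"

definition cscale :: "complex \<Rightarrow> 'a::real_vector cplxn \<Rightarrow> 'a cplxn" where
  "cscale z p = (Re z *\<^sub>R fst p - Im z *\<^sub>R snd p, Re z *\<^sub>R snd p + Im z *\<^sub>R fst p)"

definition cpair :: "'e::euclidean_space dual cplxn \<Rightarrow> 'e cplxn \<Rightarrow> complex" where
  "cpair x y =
     Complex (blinfun_apply (fst x) (fst y) - blinfun_apply (snd x) (snd y))
             (blinfun_apply (fst x) (snd y) + blinfun_apply (snd x) (fst y))"

type_synonym 'e hh = "'e dual cplxn \<times> 'e cplxn"

definition hh_scale :: "complex \<Rightarrow> 'e::euclidean_space hh \<Rightarrow> 'e hh" where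
  "hh_scale z v = (cscale z (fst v), cscale z (snd v))"

definition hh_act :: "('e::euclidean_space \<Rightarrow> 'e) \<Rightarrow> 'e hh \<Rightarrow> 'e hh" where
  "hh_act w v = (map_prod (act_dual w) (act_dual w) (fst v), map_prod w w (snd v))"

text \<open>
  The tensor algebra \<open>T(V)\<close> of \<open>V = \<hh>\<^sup>* \<oplus> \<hh>\<close> is the algebra of the monoid of words in the elements
  of \<open>V\<close> modulo linearity in each letter.  Accordingly, the smash product \<open>T(V) # W\<close> is the algebra
  of the semidirect product of that monoid with \<open>W\<close>, modulo the same relations.
\<close>

type_synonym 'e word_grp = "'e hh list \<times> ('e \<Rightarrow> 'e)"

definition smash_monoid :: "'e::euclidean_space dual set \<Rightarrow> 'e word_grp monoid" where
  "smash_monoid R =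
     \<lparr> carrier = UNIV \<times> reflection_group R,
       mult = (\<lambda>(u, w) (u', w'). (u @ map (hh_act w) u', w \<circ> w')),
       one = ([], id) \<rparr>"

definition smash_rels :: "('e::euclidean_space word_grp \<Rightarrow>\<^sub>0 complex) set" where
  "smash_rels =
     {Poly_Mapping.single ([v + v'], id) 1 - Poly_Mapping.single ([v], id) 1
        - Poly_Mapping.single ([v'], id) 1 | v v'. True} \<union>
     {Poly_Mapping.single ([hh_scale z v], id) 1 - Poly_Mapping.single ([v], id) z | z v. True}"

definition cherednik_rels ::
    "'e::euclidean_space dual set \<Rightarrow> ('e dual \<Rightarrow> complex) \<Rightarrow> ('e word_grp \<Rightarrow>\<^sub>0 complex) set" where
  "cherednik_rels Rp c =
     {Poly_Mapping.single ([(x, 0), (x', 0)], id) 1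
        - Poly_Mapping.single ([(x', 0), (x, 0)], id) 1 | x x'. True} \<union>
     {Poly_Mapping.single ([(0, y), (0, y')], id) 1
        - Poly_Mapping.single ([(0, y'), (0, y)], id) 1 | y y'. True} \<union>
     {Poly_Mapping.single ([(0, y), (x, 0)], id) 1
        - Poly_Mapping.single ([(x, 0), (0, y)], id) 1
        - (Poly_Mapping.single ([], id) (cpair x y)
           + (\<Sum>\<alpha>\<in>Rp. Poly_Mapping.single ([], reflection \<alpha>)
                (c \<alpha> * cpair (\<alpha>, 0) y * cpair x (coroot \<alpha>, 0)))) | x y. True}"

type_synonym 'e cherednik_elt = "('e word_grp \<Rightarrow>\<^sub>0 complex) set"

definition cherednik ::
    "'e::euclidean_space dual set \<Rightarrow> 'e dual set \<Rightarrow> ('e dual \<Rightarrow> complex) \<Rightarrow>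
     'e cherednik_elt complex_alg" where
  "cherednik R Rp c = presented_alg (smash_monoid R) (smash_rels \<union> cherednik_rels Rp c)"

definition ch_cls ::
    "'e::euclidean_space dual set \<Rightarrow> 'e dual set \<Rightarrow> ('e dual \<Rightarrow> complex) \<Rightarrow>
     'e word_grp \<Rightarrow> 'e cherednik_elt" where
  "ch_cls R Rp c = presented_cls (smash_monoid R) (smash_rels \<union> cherednik_rels Rp c)"

definition ch_x ::
    "'e::euclidean_space dual set \<Rightarrow> 'e dual set \<Rightarrow> ('e dual \<Rightarrow> complex) \<Rightarrow>
     'e dual \<Rightarrow> 'e cherednik_elt" where
  "ch_x R Rp c x = ch_cls R Rp c ([((x, 0), 0)], id)"

definition ch_y ::
    "'e::euclidean_space dual set \<Rightarrow> 'e dual set \<Rightarrow> ('e dual \<Rightarrow> complex) \<Rightarrow>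
     'e \<Rightarrow> 'e cherednik_elt" where
  "ch_y R Rp c y = ch_cls R Rp c ([(0, (y, 0))], id)"

definition ch_w ::
    "'e::euclidean_space dual set \<Rightarrow> 'e dual set \<Rightarrow> ('e dual \<Rightarrow> complex) \<Rightarrow>
     ('e \<Rightarrow> 'e) \<Rightarrow> 'e cherednik_elt" where
  "ch_w R Rp c w = ch_cls R Rp c ([], w)"


section \<open>The copy of \<open>sl(2)\<close> and its Casimir element\<close>

definition sl2_H ::
    "'e::euclidean_space dual set \<Rightarrow> 'e dual set \<Rightarrow> ('e dual \<Rightarrow> complex) \<Rightarrow>
     (nat \<Rightarrow> 'e) \<Rightarrow> (nat \<Rightarrow> 'e dual) \<Rightarrow> 'e cherednik_elt" where
  "sl2_H R Rp c y x = (let \<HH> = cherednik R Rp c; X = \<lambda>i. ch_x R Rp c (x i); Y = \<lambda>i. ch_y R Rp c (y i) in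
     (1/2) \<odot>\<^bsub>\<HH>\<^esub> (\<Oplus>\<^bsub>\<HH>\<^esub>i\<in>{1..DIM('e)}. X i \<otimes>\<^bsub>\<HH>\<^esub> Y i \<oplus>\<^bsub>\<HH>\<^esub> Y i \<otimes>\<^bsub>\<HH>\<^esub> X i))"

definition sl2_X ::
    "'e::euclidean_space dual set \<Rightarrow> 'e dual set \<Rightarrow> ('e dual \<Rightarrow> complex) \<Rightarrow>
     (nat \<Rightarrow> 'e dual) \<Rightarrow> 'e cherednik_elt" where
  "sl2_X R Rp c x = (let \<HH> = cherednik R Rp c; X = \<lambda>i. ch_x R Rp c (x i) in
     (-1/2) \<odot>\<^bsub>\<HH>\<^esub> (\<Oplus>\<^bsub>\<HH>\<^esub>i\<in>{1..DIM('e)}. X i \<otimes>\<^bsub>\<HH>\<^esub> X i))"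

definition sl2_Y ::
    "'e::euclidean_space dual set \<Rightarrow> 'e dual set \<Rightarrow> ('e dual \<Rightarrow> complex) \<Rightarrow>
     (nat \<Rightarrow> 'e) \<Rightarrow> 'e cherednik_elt" where
  "sl2_Y R Rp c y = (let \<HH> = cherednik R Rp c; Y = \<lambda>i. ch_y R Rp c (y i) in
     (1/2) \<odot>\<^bsub>\<HH>\<^esub> (\<Oplus>\<^bsub>\<HH>\<^esub>i\<in>{1..DIM('e)}. Y i \<otimes>\<^bsub>\<HH>\<^esub> Y i))"

definition sl2_casimir ::
    "'e::euclidean_space dual set \<Rightarrow> 'e dual set \<Rightarrow> ('e dual \<Rightarrow> complex) \<Rightarrow>
     (nat \<Rightarrow> 'e) \<Rightarrow> (nat \<Rightarrow> 'e dual) \<Rightarrow> 'e cherednik_elt" where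
  "sl2_casimir R Rp c y x =
     (let \<HH> = cherednik R Rp c; H = sl2_H R Rp c y x; X = sl2_X R Rp c x; Y = sl2_Y R Rp c y in
       H \<otimes>\<^bsub>\<HH>\<^esub> H \<oplus>\<^bsub>\<HH>\<^esub> 2 \<odot>\<^bsub>\<HH>\<^esub> (X \<otimes>\<^bsub>\<HH>\<^esub> Y \<oplus>\<^bsub>\<HH>\<^esub> Y \<otimes>\<^bsub>\<HH>\<^esub> X))"


section \<open>The Dunkl angular momentum algebra and its Dirac element\<close>

definition ang_M ::
    "'e::euclidean_space dual set \<Rightarrow> 'e dual set \<Rightarrow> ('e dual \<Rightarrow> complex) \<Rightarrow>
     (nat \<Rightarrow> 'e) \<Rightarrow> (nat \<Rightarrow> 'e dual) \<Rightarrow> nat \<Rightarrow> nat \<Rightarrow> 'e cherednik_elt" where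
  "ang_M R Rp c y x i j =
     (let \<HH> = cherednik R Rp c; X = \<lambda>i. ch_x R Rp c (x i); Y = \<lambda>i. ch_y R Rp c (y i) in
       X i \<otimes>\<^bsub>\<HH>\<^esub> Y j \<ominus>\<^bsub>\<HH>\<^esub> X j \<otimes>\<^bsub>\<HH>\<^esub> Y i)"

definition ang_alg ::
    "'e::euclidean_space dual set \<Rightarrow> 'e dual set \<Rightarrow> ('e dual \<Rightarrow> complex) \<Rightarrow>
     (nat \<Rightarrow> 'e) \<Rightarrow> (nat \<Rightarrow> 'e dual) \<Rightarrow> 'e cherednik_elt complex_alg" where
  "ang_alg R Rp c y x = generated_subalg (cherednik R Rp c)
     (ch_w R Rp c ` reflection_group R \<union>
      {ang_M R Rp c y x i j | i j. 1 \<le> i \<and> i < j \<and> j \<le> DIM('e)})"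

definition ang_Z ::
    "'e::euclidean_space dual set \<Rightarrow> 'e dual set \<Rightarrow> ('e dual \<Rightarrow> complex) \<Rightarrow> 'e cherednik_elt" where
  "ang_Z R Rp c = (let \<HH> = cherednik R Rp c in
     \<Oplus>\<^bsub>\<HH>\<^esub>\<alpha>\<in>Rp. c \<alpha> \<odot>\<^bsub>\<HH>\<^esub> ch_w R Rp c (reflection \<alpha>))"

definition ang_phi ::
    "'e::euclidean_space dual set \<Rightarrow> 'e dual set \<Rightarrow> ('e dual \<Rightarrow> complex) \<Rightarrow> 'e cherednik_elt" where
  "ang_phi R Rp c = (let \<HH> = cherednik R Rp c in
     (1/2) \<odot>\<^bsub>\<HH>\<^esub> (2 \<odot>\<^bsub>\<HH>\<^esub> ang_Z R Rp c \<oplus>\<^bsub>\<HH>\<^esub> (of_nat DIM('e) - 2) \<odot>\<^bsub>\<HH>\<^esub> \<one>\<^bsub>\<HH>\<^esub>))"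

type_synonym 'e ang_cliff_elt =
  "('e cherednik_elt \<times> (nat list \<Rightarrow>\<^sub>0 complex) set \<Rightarrow>\<^sub>0 complex) set"

definition ang_cliff ::
    "'e::euclidean_space dual set \<Rightarrow> 'e dual set \<Rightarrow> ('e dual \<Rightarrow> complex) \<Rightarrow>
     (nat \<Rightarrow> 'e) \<Rightarrow> (nat \<Rightarrow> 'e dual) \<Rightarrow> 'e ang_cliff_elt complex_alg" where
  "ang_cliff R Rp c y x = tensor_alg (ang_alg R Rp c y x) (clifford DIM('e))"

definition ang_tensor ::
    "'e::euclidean_space dual set \<Rightarrow> 'e dual set \<Rightarrow> ('e dual \<Rightarrow> complex) \<Rightarrow>
     (nat \<Rightarrow> 'e) \<Rightarrow> (nat \<Rightarrow> 'e dual) \<Rightarrow>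
     'e cherednik_elt \<Rightarrow> (nat list \<Rightarrow>\<^sub>0 complex) set \<Rightarrow> 'e ang_cliff_elt" where
  "ang_tensor R Rp c y x = tensor_elt (ang_alg R Rp c y x) (clifford DIM('e))"

definition ang_embed ::
    "'e::euclidean_space dual set \<Rightarrow> 'e dual set \<Rightarrow> ('e dual \<Rightarrow> complex) \<Rightarrow>
     (nat \<Rightarrow> 'e) \<Rightarrow> (nat \<Rightarrow> 'e dual) \<Rightarrow> 'e cherednik_elt \<Rightarrow> 'e ang_cliff_elt" where
  "ang_embed R Rp c y x a = ang_tensor R Rp c y x a \<one>\<^bsub>clifford DIM('e)\<^esub>"

definition dirac ::
    "'e::euclidean_space dual set \<Rightarrow> 'e dual set \<Rightarrow> ('e dual \<Rightarrow> complex) \<Rightarrow>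
     (nat \<Rightarrow> 'e) \<Rightarrow> (nat \<Rightarrow> 'e dual) \<Rightarrow> 'e ang_cliff_elt" where
  "dirac R Rp c y x =
     finsum (ang_cliff R Rp c y x)
       (\<lambda>(i, j). ang_tensor R Rp c y x (ang_M R Rp c y x i j)
          (clifford_gen DIM('e) i \<otimes>\<^bsub>clifford DIM('e)\<^esub> clifford_gen DIM('e) j))
       {(i, j). 1 \<le> i \<and> i < j \<and> j \<le> DIM('e)}"

definition dirac0 ::
    "'e::euclidean_space dual set \<Rightarrow> 'e dual set \<Rightarrow> ('e dual \<Rightarrow> complex) \<Rightarrow>
     (nat \<Rightarrow> 'e) \<Rightarrow> (nat \<Rightarrow> 'e dual) \<Rightarrow> 'e ang_cliff_elt" where
  "dirac0 R Rp c y x =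
     dirac R Rp c y x \<ominus>\<^bsub>ang_cliff R Rp c y x\<^esub> ang_embed R Rp c y x (ang_phi R Rp c)"

end

theory Submission
  imports Defs
begin

text \<open>
  Put \<open>x = \<Sum>\<^sub>i x\<^sub>i c\<^sub>i\<close> and \<open>y = \<Sum>\<^sub>i y\<^sub>i c\<^sub>i\<close> in the tensor product of the whole Cherednik algebra with
  the Clifford algebra.  These odd elements generate \<open>osp(1|2)\<close>: \<open>x\<^sup>2 = -2X\<close>, \<open>y\<^sup>2 = 2Y\<close>,
  \<open>xy + yx = 2H\<close>, \<open>[H, x] = x\<close> and \<open>[H, y] = -y\<close>.  Moreover \<open>xy = \<Sum>\<^sub>i x\<^sub>i y\<^sub>i + \<D>\<close> and
  \<open>H = \<Sum>\<^sub>i x\<^sub>i y\<^sub>i + \<phi> + 1\<close>, so that \<open>\<D> - \<phi> = xy - H + 1\<close>, whose square is computed from these relations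
  to be the Casimir element plus one.  The identity descends to the subalgebra generated
  by the reflection group and the \<open>M\<^sub>i\<^sub>j\<close> because over a field a subspace has a linear retraction, so tensoring
  its inclusion stays injective.  The Casimir element lies in that subalgebra since it
  equals \<open>\<phi>\<^sup>2 - 1 - \<Sum>\<^sub>i\<^sub><\<^sub>j M\<^sub>i\<^sub>j\<^sup>2\<close>.
\<close>

text \<open>Since \<open>2 h\<close> is \<open>x y + y x\<close>, the element
  \<open>D - \<phi>\<close> is half the commutator of \<open>x\<close> and \<open>y\<close>, plus
  one. The constant in the result completes a square: normal ordering turns the Casimir element plus
  one into (H - 1)^2 + 4 X Y, which acts as the square of H - 1 on vectors killed by Y.

  Neither \<open>x\<close> nor \<open>y\<close> lies in the tensor product with the angular momentum
  algebra, so the computation takes place in a larger algebra and has to be brought back. The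
  retraction used for this is linear but in general not multiplicative. Its effect on the two-sided
  ideal of relations is therefore checked on products with arbitrary elements on both sides.

  The algebras are quotients given by records, and a type cannot depend on a record. Hence one type
  holds all rings on a given type as factors. The price is that the unit of each algebra becomes a
  central idempotent, so units are tracked by \<open>unital\<close>.\<close>

section \<open>Dunkl and Clifford relations in a ring\<close>

text \<open>
  The ring need not be unital: \<open>\<kappa> 1\<close> acts as the identity only on the \<open>unital\<close> elements.
\<close>

locale central_scalars =
  fixes \<kappa> :: "complex \<Rightarrow> 't::ring"
  assumes \<kappa>_add: "\<kappa> (z + w) = \<kappa> z + \<kappa> w"
    and \<kappa>_mult: "\<kappa> (z * w) = \<kappa> z * \<kappa> w"
    and \<kappa>_central: "t * \<kappa> z = \<kappa> z * t"
begin

definition unital :: "'t \<Rightarrow> bool" where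
  "unital t \<longleftrightarrow> \<kappa> 1 * t = t"

lemma \<kappa>_0 [simp]: "\<kappa> 0 = 0"
  using \<kappa>_add[of 0 0] by simp

lemma \<kappa>_minus: "\<kappa> (- z) = - \<kappa> z"
  using \<kappa>_add[of z "- z"] by (simp add: add_eq_0_iff)

lemma \<kappa>_diff: "\<kappa> (z - w) = \<kappa> z - \<kappa> w"
  using \<kappa>_add[of z "- w"] by (simp add: \<kappa>_minus)

lemma \<kappa>_sum: "\<kappa> (\<Sum>i\<in>A. f i) = (\<Sum>i\<in>A. \<kappa> (f i))"
  by (induction A rule: infinite_finite_induct) (auto simp: \<kappa>_add)

lemma \<kappa>_left: "\<kappa> z * (\<kappa> w * t) = \<kappa> (z * w) * t"
  by (simp add: \<kappa>_mult mult.assoc)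

lemma \<kappa>_out: "s * (\<kappa> z * t) = \<kappa> z * (s * t)"
  by (metis \<kappa>_central mult.assoc)

lemma unital_mult: "unital s \<Longrightarrow> unital (s * t)"
  by (simp add: unital_def mult.assoc[symmetric])

lemma unital_add: "unital s \<Longrightarrow> unital t \<Longrightarrow> unital (s + t)"
  by (simp add: unital_def distrib_left)

lemma unital_diff: "unital s \<Longrightarrow> unital t \<Longrightarrow> unital (s - t)"
  by (simp add: unital_def right_diff_distrib)

lemma unital_sum: "(\<And>i. i \<in> A \<Longrightarrow> unital (f i)) \<Longrightarrow> unital (\<Sum>i\<in>A. f i)"
  by (simp add: unital_def sum_distrib_left)

lemma unital_\<kappa>: "unital (\<kappa> z)"
  by (simp add: unital_def \<kappa>_mult[symmetric])

lemma unital_0: "unital 0"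
  by (simp add: unital_def)

lemma unital_\<kappa>_mult: "unital (\<kappa> z * t)"
  by (simp add: unital_mult unital_\<kappa>)

lemma \<kappa>_1: "unital t \<Longrightarrow> \<kappa> 1 * t = t"
  by (simp add: unital_def)

lemma double_unital: "unital t \<Longrightarrow> \<kappa> 2 * t = t + t"
  using \<kappa>_add[of 1 1] by (simp add: unital_def distrib_right)

lemma double_cancel:
  assumes "unital s" "unital t" "s + s = t + t"
  shows "s = t"
proof -
  have "\<kappa> (1/2) * (\<kappa> 2 * s) = \<kappa> (1/2) * (\<kappa> 2 * t)"
    using assms by (simp add: double_unital)
  then show ?thesis
    using assms by (simp add: \<kappa>_left unital_def)
qed

end

text \<open>Here \<open>a \<alpha> i\<close> stands for the pairing of \<alpha> with y_i,
  \<open>b \<alpha> i\<close> for that of x_i with the coroot, \<open>d i j\<close> for that of x_i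
  with y_j, and \<open>XA \<alpha>\<close>, \<open>YB \<alpha>\<close> for the root and the coroot
  as elements of the algebra. The number \<open>t \<alpha>\<close> is the ratio of coroot to root
  once E is identified with its dual by the inner product; it makes
  \<open>a \<alpha> i * b \<alpha> j\<close> symmetric in i and j.\<close>

locale dunkl_relations = central_scalars \<kappa> for \<kappa> :: "complex \<Rightarrow> 't::ring" +
  fixes I :: "'i set" and Rp :: "'r set"
    and X Y :: "'i \<Rightarrow> 't" and S XA YB :: "'r \<Rightarrow> 't"
    and c t :: "'r \<Rightarrow> complex" and a b :: "'r \<Rightarrow> 'i \<Rightarrow> complex" and d :: "'i \<Rightarrow> 'i \<Rightarrow> complex"
  assumes fin: "finite I" "finite Rp"
    and unital_XYS: "unital (X i)" "unital (Y i)" "unital (S \<alpha>)"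
    and XX: "X i * X j = X j * X i"
    and YY: "Y i * Y j = Y j * Y i"
    and YX: "Y j * X i = X i * Y j + \<kappa> (d i j) + (\<Sum>\<alpha>\<in>Rp. \<kappa> (c \<alpha> * a \<alpha> j * b \<alpha> i) * S \<alpha>)"
    and SX: "\<alpha> \<in> Rp \<Longrightarrow> S \<alpha> * X i = (X i - \<kappa> (b \<alpha> i) * XA \<alpha>) * S \<alpha>"
    and SY: "\<alpha> \<in> Rp \<Longrightarrow> S \<alpha> * Y i = (Y i - \<kappa> (a \<alpha> i) * YB \<alpha>) * S \<alpha>"
    and d: "i \<in> I \<Longrightarrow> j \<in> I \<Longrightarrow> d i j = (if i = j then 1 else 0)"
    and XA: "\<alpha> \<in> Rp \<Longrightarrow> XA \<alpha> = (\<Sum>i\<in>I. \<kappa> (a \<alpha> i) * X i)"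
    and YB: "\<alpha> \<in> Rp \<Longrightarrow> YB \<alpha> = (\<Sum>i\<in>I. \<kappa> (b \<alpha> i) * Y i)"
    and b: "\<alpha> \<in> Rp \<Longrightarrow> i \<in> I \<Longrightarrow> b \<alpha> i = t \<alpha> * a \<alpha> i"
    and ab: "\<alpha> \<in> Rp \<Longrightarrow> (\<Sum>i\<in>I. a \<alpha> i * b \<alpha> i) = 2"
begin

text \<open>\<open>E\<close> is the Euler element. The sl(2) elements X and Y are
  \<open>-1/2\<close> times \<open>xs\<close> and \<open>1/2\<close> times \<open>ys\<close>, which
  explains the factors in \<open>omega\<close>.\<close>

definition E where "E = (\<Sum>i\<in>I. X i * Y i)"
definition Z where "Z = (\<Sum>\<alpha>\<in>Rp. \<kappa> (c \<alpha>) * S \<alpha>)"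
definition N :: complex where "N = of_nat (card I)"
definition h where "h = \<kappa> (1/2) * (\<Sum>i\<in>I. X i * Y i + Y i * X i)"
definition \<phi> where "\<phi> = \<kappa> (1/2) * (\<kappa> 2 * Z + \<kappa> (N - 2))"
definition xs where "xs = (\<Sum>i\<in>I. X i * X i)"
definition ys where "ys = (\<Sum>i\<in>I. Y i * Y i)"
definition M where "M i j = X i * Y j - X j * Y i"
definition omega where
  "omega = h * h + \<kappa> 2 * ((\<kappa> (-1/2) * xs) * (\<kappa> (1/2) * ys) + (\<kappa> (1/2) * ys) * (\<kappa> (-1/2) * xs))"

lemmas unital_intros = unital_XYS unital_mult unital_add unital_diff unital_sum unital_\<kappa>

lemma unital_E: "unital E" unfolding E_def by (intro unital_intros)
lemma unital_Z: "unital Z" unfolding Z_def by (intro unital_intros)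
lemma unital_xs: "unital xs" unfolding xs_def by (intro unital_intros)
lemma unital_h: "unital h" unfolding h_def by (intro unital_intros)
lemma unital_\<phi>: "unital \<phi>" unfolding \<phi>_def by (intro unital_intros)

lemma \<kappa>_gen:
  "X i * (\<kappa> z * u) = \<kappa> z * (X i * u)" "X i * \<kappa> z = \<kappa> z * X i"
  "Y i * (\<kappa> z * u) = \<kappa> z * (Y i * u)" "Y i * \<kappa> z = \<kappa> z * Y i"
  "S \<alpha> * (\<kappa> z * u) = \<kappa> z * (S \<alpha> * u)" "S \<alpha> * \<kappa> z = \<kappa> z * S \<alpha>"
  "XA \<alpha> * (\<kappa> z * u) = \<kappa> z * (XA \<alpha> * u)" "XA \<alpha> * \<kappa> z = \<kappa> z * XA \<alpha>"
  "YB \<alpha> * (\<kappa> z * u) = \<kappa> z * (YB \<alpha> * u)" "YB \<alpha> * \<kappa> z = \<kappa> z * YB \<alpha>"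
  by (simp_all only: \<kappa>_out \<kappa>_central)

lemma sum_d_left: "j \<in> I \<Longrightarrow> (\<And>i. unital (f i)) \<Longrightarrow> (\<Sum>i\<in>I. \<kappa> (d i j) * f i) = f j"
  and sum_d_right: "j \<in> I \<Longrightarrow> (\<And>i. unital (f i)) \<Longrightarrow> (\<Sum>i\<in>I. \<kappa> (d j i) * f i) = f j"
proof -
  assume j: "j \<in> I" and u: "\<And>i. unital (f i)"
  have "(\<Sum>i\<in>I. \<kappa> (d i j) * f i) = (\<Sum>i\<in>I. if i = j then f i else 0)"
    using j u by (intro sum.cong) (auto simp: d unital_def)
  then show "(\<Sum>i\<in>I. \<kappa> (d i j) * f i) = f j" using j fin by (simp add: sum.delta')
  have "(\<Sum>i\<in>I. \<kappa> (d j i) * f i) = (\<Sum>i\<in>I. if j = i then f i else 0)"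
    using j u by (intro sum.cong) (auto simp: d unital_def)
  then show "(\<Sum>i\<in>I. \<kappa> (d j i) * f i) = f j" using j fin by (simp add: sum.delta)
qed

lemma sum_\<kappa>_mult: "(\<Sum>i\<in>A. \<kappa> (f i) * u) = \<kappa> (\<Sum>i\<in>A. f i) * u"
  by (simp add: \<kappa>_sum sum_distrib_right)

text \<open>A trace of the commutators of y_i and x_i: the pairing contributes the dimension, and
  each reflection the value 2 of the root on its coroot.\<close>

lemma sum_YX: "(\<Sum>i\<in>I. Y i * X i) = E + \<kappa> N + \<kappa> 2 * Z"
proof -
  have "(\<Sum>i\<in>I. \<Sum>\<alpha>\<in>Rp. \<kappa> (c \<alpha> * a \<alpha> i * b \<alpha> i) * S \<alpha>)
      = (\<Sum>\<alpha>\<in>Rp. \<kappa> (\<Sum>i\<in>I. c \<alpha> * (a \<alpha> i * b \<alpha> i)) * S \<alpha>)"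
    by (subst sum.swap) (simp add: sum_\<kappa>_mult mult.assoc)
  also have "\<dots> = \<kappa> 2 * Z"
    unfolding Z_def sum_distrib_left
    by (intro sum.cong) (auto simp: sum_distrib_left[symmetric] ab \<kappa>_left mult.commute)
  finally have *: "(\<Sum>i\<in>I. \<Sum>\<alpha>\<in>Rp. \<kappa> (c \<alpha> * a \<alpha> i * b \<alpha> i) * S \<alpha>) = \<kappa> 2 * Z" .
  have "(\<Sum>i\<in>I. \<kappa> (d i i)) = \<kappa> N"
    by (simp add: \<kappa>_sum[symmetric] d N_def)
  with * show ?thesis
    by (simp add: YX sum.distrib E_def)
qed

lemma h_eq: "h = E + \<kappa> (N/2) + Z"
proof -
  have "h = \<kappa> (1/2) * (\<kappa> 2 * E + \<kappa> N + \<kappa> 2 * Z)"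
    unfolding h_def by (simp add: sum.distrib sum_YX double_unital[OF unital_E] add.assoc flip: E_def)
  then show ?thesis
    by (simp add: distrib_left \<kappa>_left \<kappa>_1 unital_E unital_Z \<kappa>_mult[symmetric])
qed

lemma \<phi>_eq: "\<phi> = Z + \<kappa> (N/2 - 1)"
  by (simp add: \<phi>_def distrib_left \<kappa>_left \<kappa>_1 unital_Z \<kappa>_mult[symmetric] diff_divide_distrib)

lemma h_\<phi>: "h = E + \<phi> + \<kappa> 1"
  by (simp add: h_eq \<phi>_eq \<kappa>_add[symmetric])

lemma ZX: "Z * X k = X k * Z - (\<Sum>\<alpha>\<in>Rp. \<kappa> (c \<alpha> * b \<alpha> k) * (XA \<alpha> * S \<alpha>))"
  unfolding Z_def sum_distrib_right sum_distrib_left sum_subtractf[symmetric]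
  by (intro sum.cong) (auto simp: SX \<kappa>_gen \<kappa>_left mult.assoc left_diff_distrib right_diff_distrib)

lemma ZY: "Z * Y k = Y k * Z - (\<Sum>\<alpha>\<in>Rp. \<kappa> (c \<alpha> * a \<alpha> k) * (YB \<alpha> * S \<alpha>))"
  unfolding Z_def sum_distrib_right sum_distrib_left sum_subtractf[symmetric]
  by (intro sum.cong) (auto simp: SY \<kappa>_gen \<kappa>_left mult.assoc left_diff_distrib right_diff_distrib)

text \<open>A reflection negates its coroot; in coordinates the sign arises as 1 - 2, the 2 being
  \<open>ab\<close>.\<close>

lemma S_YB: assumes "\<alpha> \<in> Rp" shows "S \<alpha> * YB \<alpha> = - YB \<alpha> * S \<alpha>"
proof -
  have "S \<alpha> * YB \<alpha> = (\<Sum>i\<in>I. \<kappa> (b \<alpha> i) * (Y i * S \<alpha>)) - (\<Sum>i\<in>I. \<kappa> (a \<alpha> i * b \<alpha> i) * (YB \<alpha> * S \<alpha>))"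
    unfolding sum_subtractf[symmetric] using assms
    by (subst YB) (auto simp: sum_distrib_left \<kappa>_gen SY left_diff_distrib right_diff_distrib mult.assoc \<kappa>_left mult.commute[of "b \<alpha> _"])
  also have "\<dots> = YB \<alpha> * S \<alpha> - \<kappa> 2 * (YB \<alpha> * S \<alpha>)"
    using assms by (simp add: sum_\<kappa>_mult ab YB[OF assms] sum_distrib_right mult.assoc)
  also have "\<dots> = - YB \<alpha> * S \<alpha>"
  proof -
    have "unital (YB \<alpha> * S \<alpha>)" using assms by (auto simp: YB intro!: unital_intros)
    then show ?thesis by (simp add: double_unital)
  qed
  finally show ?thesis .
qed

text \<open>Moving \<open>X k\<close> to the left through \<open>E\<close> leaves the terms with
  \<open>XA \<alpha> * S \<alpha>\<close>, and these are exactly what \<open>Z\<close> loses in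
  \<open>ZX\<close>. Thus it is the sum of \<open>E\<close> and \<open>Z\<close> that measures the
  degree.\<close>

lemma EZ_X: assumes "k \<in> I" shows "(E + Z) * X k = X k * (E + Z) + X k"
proof -
  have "E * X k = (\<Sum>i\<in>I. X k * (X i * Y i)) + (\<Sum>i\<in>I. \<kappa> (d k i) * X i)
     + (\<Sum>i\<in>I. \<Sum>\<alpha>\<in>Rp. \<kappa> (c \<alpha> * b \<alpha> k) * ((\<kappa> (a \<alpha> i) * X i) * S \<alpha>))"
    unfolding sum.distrib[symmetric] E_def sum_distrib_right
  proof (rule sum.cong[OF refl])
    fix i
    have "X i * X k * Y i = X k * (X i * Y i)" by (simp add: XX[of i k] mult.assoc)
    then show "X i * Y i * X k = X k * (X i * Y i) + \<kappa> (d k i) * X i +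
         (\<Sum>\<alpha>\<in>Rp. \<kappa> (c \<alpha> * b \<alpha> k) * ((\<kappa> (a \<alpha> i) * X i) * S \<alpha>))"
      by (simp add: mult.assoc YX distrib_left sum_distrib_left \<kappa>_gen \<kappa>_left ac_simps)
  qed
  also have "\<dots> = X k * E + X k + (\<Sum>\<alpha>\<in>Rp. \<kappa> (c \<alpha> * b \<alpha> k) * (XA \<alpha> * S \<alpha>))"
    by (subst sum.swap) (simp add: E_def sum_distrib_left[symmetric] sum_distrib_right[symmetric] XA[symmetric]
         sum_d_right[OF assms] unital_XYS)
  finally show ?thesis by (simp add: distrib_left distrib_right ZX)
qed

text \<open>Dual to \<open>EZ_X\<close>, except that the leftover of \<open>E\<close> reads
  \<open>S \<alpha> * YB \<alpha>\<close> and that of \<open>Z\<close> reads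
  \<open>YB \<alpha> * S \<alpha>\<close>; they cancel by the sign in \<open>S_YB\<close>.\<close>

lemma EZ_Y: assumes "k \<in> I" shows "(E + Z) * Y k = Y k * (E + Z) - Y k"
proof -
  have "Y k * E = (\<Sum>i\<in>I. X i * Y i * Y k) + (\<Sum>i\<in>I. \<kappa> (d i k) * Y i)
     + (\<Sum>i\<in>I. \<Sum>\<alpha>\<in>Rp. \<kappa> (c \<alpha> * a \<alpha> k) * (S \<alpha> * (\<kappa> (b \<alpha> i) * Y i)))"
    unfolding sum.distrib[symmetric] E_def sum_distrib_left
  proof (rule sum.cong[OF refl])
    fix i
    have "X i * Y i * Y k = X i * Y k * Y i" by (simp add: YY[of i k] mult.assoc)
    then show "Y k * (X i * Y i) = X i * Y i * Y k + \<kappa> (d i k) * Y i +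
         (\<Sum>\<alpha>\<in>Rp. \<kappa> (c \<alpha> * a \<alpha> k) * (S \<alpha> * (\<kappa> (b \<alpha> i) * Y i)))"
      by (simp add: mult.assoc[symmetric] YX distrib_right sum_distrib_right)
        (simp add: mult.assoc \<kappa>_gen \<kappa>_left ac_simps)
  qed
  also have "\<dots> = E * Y k + Y k + (\<Sum>\<alpha>\<in>Rp. \<kappa> (c \<alpha> * a \<alpha> k) * (S \<alpha> * YB \<alpha>))"
    by (subst sum.swap) (simp add: E_def sum_distrib_left[symmetric] sum_distrib_right[symmetric] YB[symmetric]
         sum_d_left[OF assms] unital_XYS)
  finally show ?thesis by (simp add: distrib_left distrib_right ZY S_YB sum_negf)
qed

text \<open>Conjugation by the reflection alters both factors of each summand. After summation the
  two linear corrections each subtract root times coroot, and the quadratic one adds it back twice,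
  by \<open>ab\<close>.\<close>

lemma SE: assumes "\<alpha> \<in> Rp" shows "S \<alpha> * E = E * S \<alpha>"
proof -
  have u: "unital (XA \<alpha> * YB \<alpha>)" using assms by (auto simp: XA intro!: unital_intros)
  have "S \<alpha> * E = (\<Sum>i\<in>I. X i * Y i - (\<kappa> (a \<alpha> i) * X i) * YB \<alpha> - XA \<alpha> * (\<kappa> (b \<alpha> i) * Y i)
      + \<kappa> (a \<alpha> i * b \<alpha> i) * (XA \<alpha> * YB \<alpha>)) * S \<alpha>"
    unfolding E_def sum_distrib_left sum_distrib_right
  proof (rule sum.cong[OF refl])
    fix i
    have "S \<alpha> * (X i * Y i) = (X i - \<kappa> (b \<alpha> i) * XA \<alpha>) * (S \<alpha> * Y i)"
      using assms by (simp add: mult.assoc[symmetric] SX)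
    also have "\<dots> = ((X i - \<kappa> (b \<alpha> i) * XA \<alpha>) * (Y i - \<kappa> (a \<alpha> i) * YB \<alpha>)) * S \<alpha>"
      using assms by (simp add: SY mult.assoc)
    also have "(X i - \<kappa> (b \<alpha> i) * XA \<alpha>) * (Y i - \<kappa> (a \<alpha> i) * YB \<alpha>)
      = X i * Y i - (\<kappa> (a \<alpha> i) * X i) * YB \<alpha> - XA \<alpha> * (\<kappa> (b \<alpha> i) * Y i)
      + \<kappa> (a \<alpha> i * b \<alpha> i) * (XA \<alpha> * YB \<alpha>)"
      by (simp add: left_diff_distrib right_diff_distrib \<kappa>_gen mult.assoc \<kappa>_left ac_simps)
    finally show "S \<alpha> * (X i * Y i) = \<dots> * S \<alpha>" .
  qed
  also have "\<dots> = (E - XA \<alpha> * YB \<alpha> - XA \<alpha> * YB \<alpha> + \<kappa> 2 * (XA \<alpha> * YB \<alpha>)) * S \<alpha>"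
    using assms by (simp add: sum.distrib sum_subtractf sum_distrib_left[symmetric] sum_distrib_right[symmetric] XA[symmetric] YB[symmetric]
       \<kappa>_sum[symmetric] ab E_def)
  finally show ?thesis by (simp add: double_unital[OF u])
qed

lemma ZE: "Z * E = E * Z"
  unfolding Z_def sum_distrib_left sum_distrib_right
  by (intro sum.cong) (auto simp: mult.assoc SE \<kappa>_out[of E])

lemma h_X: "k \<in> I \<Longrightarrow> h * X k = X k * h + X k"
  and h_Y: "k \<in> I \<Longrightarrow> h * Y k = Y k * h - Y k"
  using EZ_X[of k] EZ_Y[of k]
  by (simp_all add: h_eq distrib_left distrib_right \<kappa>_central[of "X k"] \<kappa>_central[of "Y k"])

lemma XB: "\<alpha> \<in> Rp \<Longrightarrow> (\<Sum>i\<in>I. \<kappa> (b \<alpha> i) * X i) = \<kappa> (t \<alpha>) * XA \<alpha>"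
  and YA: "\<alpha> \<in> Rp \<Longrightarrow> YB \<alpha> = \<kappa> (t \<alpha>) * (\<Sum>i\<in>I. \<kappa> (a \<alpha> i) * Y i)"
  by (simp_all add: XA YB b sum_distrib_left \<kappa>_left)

lemma S_XA: assumes "\<alpha> \<in> Rp" shows "S \<alpha> * XA \<alpha> = - XA \<alpha> * S \<alpha>"
proof -
  have "S \<alpha> * XA \<alpha> = (\<Sum>i\<in>I. \<kappa> (a \<alpha> i) * (X i * S \<alpha>)) - (\<Sum>i\<in>I. \<kappa> (a \<alpha> i * b \<alpha> i) * (XA \<alpha> * S \<alpha>))"
    unfolding sum_subtractf[symmetric] using assms
    by (subst XA) (auto simp: sum_distrib_left \<kappa>_gen SX left_diff_distrib right_diff_distrib mult.assoc \<kappa>_left)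
  also have "\<dots> = XA \<alpha> * S \<alpha> - \<kappa> 2 * (XA \<alpha> * S \<alpha>)"
    using assms by (simp add: sum_\<kappa>_mult ab XA[OF assms] sum_distrib_right mult.assoc)
  also have "\<dots> = - XA \<alpha> * S \<alpha>"
  proof -
    have "unital (XA \<alpha> * S \<alpha>)" using assms by (auto simp: XA intro!: unital_intros)
    then show ?thesis by (simp add: double_unital)
  qed
  finally show ?thesis .
qed

text \<open>The reflection terms picked up on the way through the two factors of a square sum to
  multiples of \<open>XA \<alpha> * S \<alpha> + S \<alpha> * XA \<alpha>\<close>, which vanishes by
  \<open>S_XA\<close>.\<close>

lemma Y_xs: assumes "k \<in> I" shows "Y k * xs = xs * Y k + (X k + X k)"
proof -
  have "Y k * xs = (\<Sum>i\<in>I. X i * X i * Y k) + (\<Sum>i\<in>I. \<kappa> (d i k) * X i) + (\<Sum>i\<in>I. \<kappa> (d i k) * X i)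
     + (\<Sum>i\<in>I. \<Sum>\<alpha>\<in>Rp. \<kappa> (c \<alpha> * a \<alpha> k) * ((\<kappa> (b \<alpha> i) * X i) * S \<alpha> + S \<alpha> * (\<kappa> (b \<alpha> i) * X i)))"
    unfolding sum.distrib[symmetric] xs_def sum_distrib_left
  proof (rule sum.cong[OF refl])
    fix i
    let ?q = "\<Sum>\<alpha>\<in>Rp. \<kappa> (c \<alpha> * a \<alpha> k * b \<alpha> i) * S \<alpha>"
    have "Y k * (X i * X i) = (X i * Y k + \<kappa> (d i k) + ?q) * X i"
      by (simp add: mult.assoc[symmetric] YX)
    also have "\<dots> = X i * (X i * Y k + \<kappa> (d i k) + ?q) + \<kappa> (d i k) * X i + ?q * X i"
      by (simp add: distrib_right mult.assoc YX)
    also have "\<dots> = X i * X i * Y k + \<kappa> (d i k) * X i + \<kappa> (d i k) * X i + (X i * ?q + ?q * X i)"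
      by (simp add: distrib_left mult.assoc \<kappa>_gen)
    also have "X i * ?q + ?q * X i = (\<Sum>\<alpha>\<in>Rp. \<kappa> (c \<alpha> * a \<alpha> k) * ((\<kappa> (b \<alpha> i) * X i) * S \<alpha> + S \<alpha> * (\<kappa> (b \<alpha> i) * X i)))"
      by (simp add: sum_distrib_left sum_distrib_right distrib_left mult.assoc \<kappa>_gen \<kappa>_left sum.distrib)
    finally show "Y k * (X i * X i) = X i * X i * Y k + \<kappa> (d i k) * X i + \<kappa> (d i k) * X i + \<dots>" .
  qed
  also have "(\<Sum>i\<in>I. \<Sum>\<alpha>\<in>Rp. \<kappa> (c \<alpha> * a \<alpha> k) * ((\<kappa> (b \<alpha> i) * X i) * S \<alpha> + S \<alpha> * (\<kappa> (b \<alpha> i) * X i)))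
     = (\<Sum>\<alpha>\<in>Rp. \<kappa> (c \<alpha> * a \<alpha> k) * (\<kappa> (t \<alpha>) * XA \<alpha> * S \<alpha> + S \<alpha> * (\<kappa> (t \<alpha>) * XA \<alpha>)))"
    by (subst sum.swap) (simp add: sum_distrib_left[symmetric] sum.distrib sum_distrib_right[symmetric] XB)
  also have "\<dots> = 0"
    by (intro sum.neutral) (simp add: S_XA \<kappa>_gen mult.assoc)
  finally show ?thesis by (simp add: sum_d_left[OF assms] unital_XYS xs_def sum_distrib_right)
qed

text \<open>Two applications of \<open>Y_xs\<close> produce twice
  \<open>X i * Y i + Y i * X i\<close> for each i, and these sum to \<open>4 h\<close>. This is the
  sl(2) relation between X and Y.\<close>

lemma ys_xs: "ys * xs = xs * ys + \<kappa> 4 * h"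
proof -
  have "ys * xs = (\<Sum>i\<in>I. xs * (Y i * Y i) + (X i * Y i + Y i * X i) + (X i * Y i + Y i * X i))"
    unfolding ys_def sum_distrib_right
  proof (rule sum.cong[OF refl])
    fix i assume "i \<in> I"
    then have "Y i * Y i * xs = Y i * (xs * Y i + (X i + X i))"
      by (simp add: mult.assoc Y_xs)
    also have "\<dots> = (Y i * xs) * Y i + (Y i * X i + Y i * X i)"
      by (simp only: distrib_left mult.assoc)
    also have "\<dots> = xs * (Y i * Y i) + (X i * Y i + Y i * X i) + (X i * Y i + Y i * X i)"
      using \<open>i \<in> I\<close> by (simp add: Y_xs distrib_right) (simp add: mult.assoc ac_simps)
    finally show "Y i * Y i * xs = \<dots>" .
  qed
  also have "\<dots> = xs * ys + \<kappa> 2 * (\<Sum>i\<in>I. X i * Y i + Y i * X i)"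
    by (subst double_unital) (auto simp: sum.distrib sum_distrib_left[symmetric] ys_def add.assoc intro!: unital_intros)
  also have "\<dots> = xs * ys + \<kappa> 4 * h"
    by (simp add: h_def \<kappa>_left)
  finally show ?thesis .
qed

lemma omega_eq: "omega = h * h - xs * ys - \<kappa> 2 * h"
proof -
  have "omega = h * h + \<kappa> 2 * (\<kappa> (-1/4) * (\<kappa> 2 * (xs * ys) + \<kappa> 4 * h))"
    by (simp add: omega_def \<kappa>_out[of xs] \<kappa>_out[of ys] mult.assoc \<kappa>_left ys_xs double_unital unital_mult unital_xs distrib_left)
  then show ?thesis
    by (simp add: distrib_left right_diff_distrib \<kappa>_left \<kappa>_minus \<kappa>_1 unital_mult unital_xs unital_h)
qed

text \<open>The expansion of (h - 1)^2 - xs ys with h - 1 = E + \<phi>. The two summands commute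
  because \<open>E\<close> is invariant under the reflections.\<close>

lemma omega_\<phi>: "omega + \<kappa> 1 = \<phi> * \<phi> + (E * \<phi> + E * \<phi>) + E * E - xs * ys"
proof -
  have "E * \<phi> = \<phi> * E" by (simp add: \<phi>_eq distrib_left distrib_right ZE \<kappa>_central)
  then show ?thesis
    by (simp add: omega_eq h_\<phi> distrib_left distrib_right double_unital unital_E unital_\<phi> unital_\<kappa>
      \<kappa>_central[of E 1] \<kappa>_central[of \<phi> 1] \<kappa>_1 algebra_simps)
qed

text \<open>Every unordered pair is counted twice, hence the factor 2. The squares
  (\<open>P1\<close>) and the mixed products (\<open>P2\<close>) are rewritten separately; both
  contain the same reflection term \<open>Q\<close>, which drops out of their difference.\<close>

lemma sum_MM: "(\<Sum>i\<in>I. \<Sum>j\<in>I. M i j * M i j) = \<kappa> 2 * (\<phi> * \<phi> - (omega + \<kappa> 1))"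
proof -
  define P1 where "P1 = (\<Sum>i\<in>I. \<Sum>j\<in>I. X i * Y j * (X i * Y j))"
  define P2 where "P2 = (\<Sum>i\<in>I. \<Sum>j\<in>I. X i * Y j * (X j * Y i))"
  have u: "unital P1" "unital P2" unfolding P1_def P2_def by (intro unital_intros)+
  have "(\<Sum>i\<in>I. \<Sum>j\<in>I. M i j * M i j) = P1 + (\<Sum>i\<in>I. \<Sum>j\<in>I. X j * Y i * (X j * Y i))
     - (P2 + (\<Sum>i\<in>I. \<Sum>j\<in>I. X j * Y i * (X i * Y j)))"
    unfolding P1_def P2_def M_def
    by (simp add: left_diff_distrib right_diff_distrib sum_subtractf sum.distrib)
  also have "(\<Sum>i\<in>I. \<Sum>j\<in>I. X j * Y i * (X j * Y i)) = P1"
    unfolding P1_def by (rule sum.swap)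
  also have "(\<Sum>i\<in>I. \<Sum>j\<in>I. X j * Y i * (X i * Y j)) = P2"
    unfolding P2_def by (rule sum.swap)
  finally have MM: "(\<Sum>i\<in>I. \<Sum>j\<in>I. M i j * M i j) = \<kappa> 2 * (P1 - P2)"
    using u by (simp add: double_unital unital_diff)
  define Q where "Q = (\<Sum>\<alpha>\<in>Rp. \<kappa> (c \<alpha>) * (XA \<alpha> * (S \<alpha> * YB \<alpha>)))"
  have "P1 = (\<Sum>i\<in>I. X i * X i * ys) + (\<Sum>i\<in>I. \<Sum>j\<in>I. \<kappa> (d i j) * (X i * Y j))
     + (\<Sum>i\<in>I. \<Sum>j\<in>I. \<Sum>\<alpha>\<in>Rp. \<kappa> (c \<alpha>) * (\<kappa> (b \<alpha> i) * X i * (S \<alpha> * (\<kappa> (a \<alpha> j) * Y j))))"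
    unfolding P1_def sum.distrib[symmetric] ys_def sum_distrib_left
  proof (intro sum.cong refl)
    fix i j
    have "X i * Y j * (X i * Y j) = X i * (Y j * X i) * Y j" by (simp add: mult.assoc)
    then show "X i * Y j * (X i * Y j) = X i * X i * (Y j * Y j) + \<kappa> (d i j) * (X i * Y j)
       + (\<Sum>\<alpha>\<in>Rp. \<kappa> (c \<alpha>) * (\<kappa> (b \<alpha> i) * X i * (S \<alpha> * (\<kappa> (a \<alpha> j) * Y j))))"
      by (simp add: YX distrib_left distrib_right sum_distrib_left sum_distrib_right mult.assoc \<kappa>_gen \<kappa>_left ac_simps)
  qed
  also have "(\<Sum>i\<in>I. \<Sum>j\<in>I. \<kappa> (d i j) * (X i * Y j)) = E"
    unfolding E_def by (intro sum.cong refl sum_d_right) (auto intro!: unital_intros)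
  also have "(\<Sum>i\<in>I. \<Sum>j\<in>I. \<Sum>\<alpha>\<in>Rp. \<kappa> (c \<alpha>) * (\<kappa> (b \<alpha> i) * X i * (S \<alpha> * (\<kappa> (a \<alpha> j) * Y j))))
     = (\<Sum>\<alpha>\<in>Rp. \<Sum>i\<in>I. \<Sum>j\<in>I. \<kappa> (c \<alpha>) * (\<kappa> (b \<alpha> i) * X i * (S \<alpha> * (\<kappa> (a \<alpha> j) * Y j))))"
    by (subst sum.swap[of _ Rp I]) (intro sum.cong refl sum.swap)
  also have "\<dots> = Q"
    unfolding Q_def
  proof (intro sum.cong refl)
    fix \<alpha> assume \<alpha>: "\<alpha> \<in> Rp"
    \<comment> \<open>\<open>XB\<close> takes \<open>t \<alpha>\<close> out of the first sum and
      \<open>YA\<close> absorbs it into the second, so that the sums become the root and the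
      coroot.\<close>
    have "(\<Sum>i\<in>I. \<Sum>j\<in>I. \<kappa> (c \<alpha>) * (\<kappa> (b \<alpha> i) * X i * (S \<alpha> * (\<kappa> (a \<alpha> j) * Y j))))
        = \<kappa> (c \<alpha>) * ((\<Sum>i\<in>I. \<kappa> (b \<alpha> i) * X i) * (S \<alpha> * (\<Sum>j\<in>I. \<kappa> (a \<alpha> j) * Y j)))"
      by (simp only: sum_distrib_left[of "S \<alpha>"] sum_distrib_left[of "\<kappa> (c \<alpha>)"] sum_product)
    then show "(\<Sum>i\<in>I. \<Sum>j\<in>I. \<kappa> (c \<alpha>) * (\<kappa> (b \<alpha> i) * X i * (S \<alpha> * (\<kappa> (a \<alpha> j) * Y j))))
        = \<kappa> (c \<alpha>) * (XA \<alpha> * (S \<alpha> * YB \<alpha>))"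
      using \<alpha> by (simp add: XB YA \<kappa>_gen mult.assoc)
  qed
  finally have P1: "P1 = xs * ys + E + Q" by (simp add: xs_def sum_distrib_right)
  have "P2 = (\<Sum>i\<in>I. X i * (\<Sum>j\<in>I. Y j * X j) * Y i)"
    unfolding P2_def by (simp add: sum_distrib_left sum_distrib_right mult.assoc)
  also have "\<dots> = (\<Sum>i\<in>I. (E + Z) * (X i * Y i) - X i * Y i + \<kappa> N * (X i * Y i) + (X i * Y i * Z
      - (\<Sum>\<alpha>\<in>Rp. \<kappa> (c \<alpha>) * (\<kappa> (a \<alpha> i) * X i * (YB \<alpha> * S \<alpha>)))))"
  proof (rule sum.cong[OF refl])
    fix i assume i: "i \<in> I"
    \<comment> \<open>Of the two copies of \<open>Z\<close> in \<open>sum_YX\<close>, one joins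
      \<open>E\<close> and passes to the left of \<open>X i\<close> by \<open>EZ_X\<close>; the
      other passes to the right of \<open>Y i\<close> by \<open>ZY\<close> and leaves the terms that
      give \<open>Q\<close>.\<close>
    have "X i * (\<Sum>j\<in>I. Y j * X j) * Y i = (X i * (E + Z) + \<kappa> N * X i + X i * Z) * Y i"
      by (simp add: sum_YX double_unital unital_Z distrib_left \<kappa>_central[of "X i"] add.assoc add.left_commute)
    also have "X i * (E + Z) = (E + Z) * X i - X i" using EZ_X[OF i] by simp
    finally show "X i * (\<Sum>j\<in>I. Y j * X j) * Y i = (E + Z) * (X i * Y i) - X i * Y i + \<kappa> N * (X i * Y i)
      + (X i * Y i * Z - (\<Sum>\<alpha>\<in>Rp. \<kappa> (c \<alpha>) * (\<kappa> (a \<alpha> i) * X i * (YB \<alpha> * S \<alpha>))))"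
      by (simp add: distrib_right left_diff_distrib right_diff_distrib mult.assoc ZY sum_distrib_left \<kappa>_gen \<kappa>_left)
  qed
  also have "\<dots> = (E + Z) * E - E + \<kappa> N * E + (E * Z - (\<Sum>i\<in>I. \<Sum>\<alpha>\<in>Rp. \<kappa> (c \<alpha>) * (\<kappa> (a \<alpha> i) * X i * (YB \<alpha> * S \<alpha>))))"
    by (simp add: sum.distrib sum_subtractf E_def sum_distrib_left sum_distrib_right)
  also have "(\<Sum>i\<in>I. \<Sum>\<alpha>\<in>Rp. \<kappa> (c \<alpha>) * (\<kappa> (a \<alpha> i) * X i * (YB \<alpha> * S \<alpha>))) = - Q"
    unfolding Q_def
    by (subst sum.swap) (simp add: sum_distrib_left[symmetric] sum_distrib_right[symmetric] XA[symmetric] S_YB sum_negf)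
  finally have P2: "P2 = (E + Z) * E - E + \<kappa> N * E + (E * Z + Q)" by simp
  have "E * \<phi> + E * \<phi> = E * Z + E * Z + \<kappa> N * E - E - E"
  proof -
    have "\<kappa> (N/2 - 1) * E + \<kappa> (N/2 - 1) * E = \<kappa> (N - 2) * E"
      by (simp add: distrib_right[symmetric] \<kappa>_add[symmetric])
    also have "\<dots> = \<kappa> N * E - E - E"
      by (simp add: \<kappa>_diff left_diff_distrib double_unital unital_E)
    finally show ?thesis by (simp add: \<phi>_eq distrib_left \<kappa>_central[of E] algebra_simps)
  qed
  then have "P1 - P2 = \<phi> * \<phi> - (\<phi> * \<phi> + (E * \<phi> + E * \<phi>) + E * E - xs * ys)"
    by (simp add: P1 P2 distrib_right ZE)
  then have "P1 - P2 = \<phi> * \<phi> - (omega + \<kappa> 1)"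
    by (simp only: omega_\<phi>)
  with MM show ?thesis by simp
qed

text \<open>The right-hand side is built from \<open>Z\<close>, scalars and the
  \<open>M i j\<close>, which places the Casimir element in the angular momentum algebra.\<close>

lemma omega_MM: "omega = \<phi> * \<phi> - \<kappa> 1 - \<kappa> (1/2) * (\<Sum>i\<in>I. \<Sum>j\<in>I. M i j * M i j)"
proof -
  have "unital (\<phi> * \<phi> - (omega + \<kappa> 1))"
    by (simp add: omega_eq unital_intros unital_h unital_\<phi> unital_xs)
  then show ?thesis by (simp add: sum_MM \<kappa>_left \<kappa>_1)
qed

end

section \<open>Clifford generators and the odd elements of osp(1|2)\<close>

locale dunkl_clifford = dunkl_relations \<kappa> I Rp X Y S XA YB c t a b d
  for \<kappa> :: "complex \<Rightarrow> 't::ring" and I :: "'i::linorder set" and Rp :: "'r set"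
    and X Y :: "'i \<Rightarrow> 't" and S XA YB :: "'r \<Rightarrow> 't"
    and c t :: "'r \<Rightarrow> complex" and a b :: "'r \<Rightarrow> 'i \<Rightarrow> complex" and d :: "'i \<Rightarrow> 'i \<Rightarrow> complex" +
  fixes C :: "'i \<Rightarrow> 't"
  assumes C_comm: "i \<in> I \<Longrightarrow> C i * X j = X j * C i" "i \<in> I \<Longrightarrow> C i * Y j = Y j * C i" "i \<in> I \<Longrightarrow> C i * S \<alpha> = S \<alpha> * C i"
    and CC: "i \<in> I \<Longrightarrow> j \<in> I \<Longrightarrow> C i * C j + C j * C i = \<kappa> (if i = j then 2 else 0)"
begin

definition x where "x = (\<Sum>i\<in>I. X i * C i)"
definition y where "y = (\<Sum>i\<in>I. Y i * C i)"
definition D where "D = (\<Sum>(i, j)\<in>{(i, j). i \<in> I \<and> j \<in> I \<and> i < j}. M i j * (C i * C j))"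

lemma unital_x: "unital x" unfolding x_def by (intro unital_intros)

lemma C_move:
  assumes "i \<in> I"
  shows "C i * (X j * u) = X j * (C i * u)" "C i * (Y j * u) = Y j * (C i * u)" "C i * (S \<alpha> * u) = S \<alpha> * (C i * u)"
  using C_comm[OF assms] by (metis mult.assoc)+

text \<open>Exchanging the summation indices replaces a product of two Clifford generators by half
  their anticommutator, of which only the diagonal survives. To avoid fractions, the doubles of both
  sides are compared.\<close>

lemma symmetric_C:
  assumes "\<And>i j. G i j = G j i" "\<And>i j. unital (G i j)"
  shows "(\<Sum>i\<in>I. \<Sum>j\<in>I. G i j * (C i * C j)) = (\<Sum>i\<in>I. G i i)"
proof (rule double_cancel)
  have "(\<Sum>i\<in>I. \<Sum>j\<in>I. G i j * (C i * C j)) + (\<Sum>i\<in>I. \<Sum>j\<in>I. G i j * (C i * C j))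
    = (\<Sum>i\<in>I. \<Sum>j\<in>I. G i j * (C i * C j)) + (\<Sum>i\<in>I. \<Sum>j\<in>I. G j i * (C j * C i))"
    by (rule arg_cong2[of _ _ _ _ "(+)"], rule refl, rule sum.swap)
  also have "\<dots> = (\<Sum>i\<in>I. \<Sum>j\<in>I. G i j * (C i * C j + C j * C i))"
    using assms(1) by (simp add: sum.distrib distrib_left)
  also have "\<dots> = (\<Sum>i\<in>I. \<Sum>j\<in>I. if i = j then G i i + G i i else 0)"
    using assms(2) by (intro sum.cong refl) (auto simp: CC \<kappa>_central[of "G _ _"] double_unital)
  also have "\<dots> = (\<Sum>i\<in>I. G i i) + (\<Sum>i\<in>I. G i i)"
    using fin by (simp add: sum.distrib)
  finally show "(\<Sum>i\<in>I. \<Sum>j\<in>I. G i j * (C i * C j)) + (\<Sum>i\<in>I. \<Sum>j\<in>I. G i j * (C i * C j))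
    = (\<Sum>i\<in>I. G i i) + (\<Sum>i\<in>I. G i i)" .
qed (use assms in \<open>auto intro!: unital_intros\<close>)

lemma x_x: "x * x = xs"
proof -
  have "x * x = (\<Sum>i\<in>I. \<Sum>j\<in>I. (X i * X j) * (C i * C j))"
    unfolding x_def sum_product by (intro sum.cong refl) (simp add: mult.assoc C_move)
  also have "\<dots> = xs" unfolding xs_def by (intro symmetric_C unital_intros XX)
  finally show ?thesis .
qed

lemma y_y: "y * y = ys"
proof -
  have "y * y = (\<Sum>i\<in>I. \<Sum>j\<in>I. (Y i * Y j) * (C i * C j))"
    unfolding y_def sum_product by (intro sum.cong refl) (simp add: mult.assoc C_move)
  also have "\<dots> = ys" unfolding ys_def by (intro symmetric_C unital_intros YY)
  finally show ?thesis .
qed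

lemma x_y: "x * y = (\<Sum>i\<in>I. \<Sum>j\<in>I. (X i * Y j) * (C i * C j))"
  unfolding x_def y_def sum_product by (intro sum.cong refl) (simp add: mult.assoc C_move)

lemma y_x: "y * x = (\<Sum>i\<in>I. \<Sum>j\<in>I. (Y j * X i) * (C j * C i))"
  unfolding x_def y_def sum_product
  by (subst sum.swap) (intro sum.cong refl, simp add: mult.assoc C_move)

text \<open>Commuting y_j past x_i splits the sum into three: the anticommutators of the Clifford
  generators give \<open>2 E\<close>, the pairing gives \<open>N\<close>, the reflections give
  \<open>2 Z\<close>. By \<open>h_eq\<close> these add up to \<open>2 h\<close>.\<close>

lemma xy_yx: "x * y + y * x = \<kappa> 2 * h"
proof -
  have "x * y + y * x = (\<Sum>i\<in>I. \<Sum>j\<in>I. (X i * Y j) * (C i * C j + C j * C i))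
    + (\<Sum>i\<in>I. \<Sum>j\<in>I. \<kappa> (d i j) * (C j * C i))
    + (\<Sum>i\<in>I. \<Sum>j\<in>I. \<Sum>\<alpha>\<in>Rp. \<kappa> (c \<alpha>) * ((\<kappa> (a \<alpha> j * b \<alpha> i) * S \<alpha>) * (C j * C i)))"
    unfolding x_y y_x YX sum.distrib[symmetric]
    by (intro sum.cong refl) (simp add: distrib_left distrib_right sum_distrib_right \<kappa>_left mult.assoc)
  also have "(\<Sum>i\<in>I. \<Sum>j\<in>I. (X i * Y j) * (C i * C j + C j * C i)) = (\<Sum>i\<in>I. \<Sum>j\<in>I. if i = j then \<kappa> 2 * (X i * Y i) else 0)"
    by (intro sum.cong refl) (auto simp: CC \<kappa>_central[of "X _ * Y _"])
  also have "\<dots> = \<kappa> 2 * E"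
    using fin by (simp add: E_def sum_distrib_left)
  also have "(\<Sum>i\<in>I. \<Sum>j\<in>I. \<kappa> (d i j) * (C j * C i)) = (\<Sum>j\<in>I. \<Sum>i\<in>I. \<kappa> (d i j) * (C j * C i))"
    by (rule sum.swap)
  also have "\<dots> = (\<Sum>j\<in>I. \<Sum>i\<in>I. \<kappa> (if j = i then 1 else 0) * (C j * C i))"
    by (intro sum.cong refl) (simp add: d eq_commute)
  also have "\<dots> = (\<Sum>i\<in>I. \<kappa> 1)"
    by (subst symmetric_C) (auto intro: unital_\<kappa> unital_0 simp: if_distrib)
  also have "\<dots> = \<kappa> N"
    unfolding N_def by (subst \<kappa>_sum[symmetric]) simp
  also have "(\<Sum>i\<in>I. \<Sum>j\<in>I. \<Sum>\<alpha>\<in>Rp. \<kappa> (c \<alpha>) * ((\<kappa> (a \<alpha> j * b \<alpha> i) * S \<alpha>) * (C j * C i)))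
     = (\<Sum>\<alpha>\<in>Rp. \<Sum>j\<in>I. \<Sum>i\<in>I. \<kappa> (c \<alpha>) * ((\<kappa> (a \<alpha> j * b \<alpha> i) * S \<alpha>) * (C j * C i)))"
    by (subst sum.swap, subst sum.swap[of _ I Rp], intro sum.cong refl, rule sum.swap)
  \<comment> \<open>Replacing \<open>b \<alpha> i\<close> by
    \<open>t \<alpha> * a \<alpha> i\<close> makes the coefficient visibly symmetric in the two
    indices, as \<open>symmetric_C\<close> requires.\<close>
  also have "\<dots> = (\<Sum>\<alpha>\<in>Rp. \<kappa> (c \<alpha>) * (\<Sum>j\<in>I. \<Sum>i\<in>I. (\<kappa> (t \<alpha> * a \<alpha> i * a \<alpha> j) * S \<alpha>) * (C j * C i)))"
    unfolding sum_distrib_left by (intro sum.cong refl) (simp add: b ac_simps)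
  also have "\<dots> = (\<Sum>\<alpha>\<in>Rp. \<kappa> (c \<alpha>) * (\<Sum>i\<in>I. \<kappa> (t \<alpha> * a \<alpha> i * a \<alpha> i) * S \<alpha>))"
    by (intro sum.cong refl, subst symmetric_C) (auto intro: unital_\<kappa>_mult simp: ac_simps)
  also have "\<dots> = \<kappa> 2 * Z"
    unfolding Z_def sum_distrib_left[of "\<kappa> 2"]
  proof (intro sum.cong refl)
    fix \<alpha> assume \<alpha>: "\<alpha> \<in> Rp"
    have "(\<Sum>i\<in>I. t \<alpha> * a \<alpha> i * a \<alpha> i) = (\<Sum>i\<in>I. a \<alpha> i * b \<alpha> i)"
      using \<alpha> by (intro sum.cong) (simp_all add: b)
    then show "\<kappa> (c \<alpha>) * (\<Sum>i\<in>I. \<kappa> (t \<alpha> * a \<alpha> i * a \<alpha> i) * S \<alpha>) = \<kappa> 2 * (\<kappa> (c \<alpha>) * S \<alpha>)"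
      using \<alpha> by (simp add: sum_\<kappa>_mult ab \<kappa>_left mult.commute)
  qed
  finally show ?thesis
    by (simp add: h_eq distrib_left \<kappa>_mult[symmetric])
qed

lemma h_C: assumes "i \<in> I" shows "h * C i = C i * h"
proof -
  have "E * C i = C i * E" "Z * C i = C i * Z"
    using assms by (simp_all add: E_def Z_def sum_distrib_left sum_distrib_right mult.assoc C_move \<kappa>_out[of "C i"] C_comm)
  then show ?thesis by (simp add: h_eq distrib_left distrib_right \<kappa>_central[of "C i"])
qed

lemma h_x: "h * x = x * h + x"
  unfolding x_def sum_distrib_left sum_distrib_right sum.distrib[symmetric]
  by (intro sum.cong refl) (simp add: mult.assoc[symmetric] h_X distrib_right, simp add: mult.assoc h_C)

lemma h_y: "h * y = y * h - y"
  unfolding y_def sum_distrib_left sum_distrib_right sum_subtractf[symmetric]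
  by (intro sum.cong refl) (simp add: mult.assoc[symmetric] h_Y left_diff_distrib, simp add: mult.assoc h_C)

text \<open>Clifford generators square to one, so the diagonal of the double sum for
  \<open>x * y\<close> is \<open>E\<close>. Off the diagonal they anticommute, and the summands at
  (i, j) and (j, i) combine to \<open>M i j\<close>.\<close>

lemma D_eq: "D = x * y - E"
proof -
  let ?f = "\<lambda>i j. X i * Y j * (C i * C j)"
  let ?P = "{(i, j). i \<in> I \<and> j \<in> I \<and> i < j}" and ?Q = "{(i, j). i \<in> I \<and> j \<in> I \<and> j < i}" and ?d = "(\<lambda>i. (i, i)) ` I"
  have fin2: "finite ?P" "finite ?Q" "finite ?d"
    using finite_subset[of ?P "I \<times> I"] finite_subset[of ?Q "I \<times> I"] fin by auto
  have anti: "C j * C i = - (C i * C j)" if "i \<in> I" "j \<in> I" "i < j" for i j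
    using CC[of j i] that by (auto simp: eq_neg_iff_add_eq_0)
  have sq: "u * (C i * C i) = u" if "i \<in> I" "unital u" for i u
  proof (rule double_cancel)
    show "u * (C i * C i) + u * (C i * C i) = u + u"
      using CC[of i i] that by (simp add: distrib_left[symmetric] \<kappa>_central[of u] double_unital)
  qed (use that in \<open>auto intro: unital_mult\<close>)
  have "x * y = (\<Sum>(i, j)\<in>I \<times> I. ?f i j)"
    by (simp add: x_y sum.cartesian_product)
  also have "I \<times> I = (?P \<union> ?Q) \<union> ?d" by auto
  also have "(\<Sum>(i, j)\<in>(?P \<union> ?Q) \<union> ?d. ?f i j) = (\<Sum>(i, j)\<in>?P. ?f i j) + (\<Sum>(i, j)\<in>?Q. ?f i j) + (\<Sum>(i, j)\<in>?d. ?f i j)"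
    using fin2 by (subst sum.union_disjoint; (subst sum.union_disjoint)?) auto
  also have "(\<Sum>(i, j)\<in>?d. ?f i j) = (\<Sum>i\<in>I. X i * Y i)"
    by (subst sum.reindex) (auto simp: inj_on_def sq unital_intros intro!: sum.cong)
  also have "(\<Sum>(i, j)\<in>?Q. ?f i j) = (\<Sum>(i, j)\<in>?P. ?f j i)"
    by (rule sum.reindex_bij_witness[of _ prod.swap prod.swap]) auto
  also have "(\<Sum>(i, j)\<in>?P. ?f i j) + (\<Sum>(i, j)\<in>?P. ?f j i) = D"
    unfolding D_def sum.distrib[symmetric]
    by (intro sum.cong refl) (auto simp: M_def anti left_diff_distrib)
  finally show ?thesis by (simp add: E_def)
qed

text \<open>Since \<open>y x = 2 h - x y\<close>, the square of \<open>u = x y\<close> is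
  \<open>x (2 h - x y) y\<close>; moving \<open>h\<close> to the left past \<open>x\<close> costs
  one \<open>x\<close>, whence \<open>u u = 2 h u - 2 u - xs ys\<close>. As \<open>x\<close> has
  degree 1 and \<open>y\<close> degree -1, \<open>u\<close> commutes with \<open>h\<close>. In the
  square of \<open>u - h + 1\<close> all terms with \<open>u\<close> then cancel and (h - 1)^2 - xs
  ys remains.\<close>

lemma dirac_square: "(D - \<phi>) * (D - \<phi>) = omega + \<kappa> 1"
proof -
  define u where "u = x * y"
  have D0: "D - \<phi> = u - h + \<kappa> 1" by (simp add: D_eq h_\<phi> u_def)
  have u: "unital u" by (simp add: u_def unital_mult unital_x)
  have hu: "h * u = u * h"
  proof -
    have "h * u = (x * h + x) * y" by (simp add: u_def mult.assoc[symmetric] h_x)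
    also have "\<dots> = x * (h * y) + x * y" by (simp only: distrib_right mult.assoc)
    finally show ?thesis by (simp add: h_y u_def right_diff_distrib mult.assoc)
  qed
  have "u * u = x * (\<kappa> 2 * h - x * y) * y"
    using xy_yx by (simp add: u_def mult.assoc flip: xy_yx)
  also have "\<dots> = \<kappa> 2 * (x * h * y) - x * x * (y * y)"
    by (simp add: left_diff_distrib right_diff_distrib mult.assoc \<kappa>_out[of x])
  also have "x * h = h * x - x" by (simp add: h_x)
  finally have uu: "u * u = \<kappa> 2 * (h * u) - \<kappa> 2 * u - xs * ys"
    by (simp add: left_diff_distrib right_diff_distrib mult.assoc x_x y_y u_def)
  show ?thesis
    unfolding D0 omega_eq
    using u unital_h
    by (simp add: distrib_left distrib_right left_diff_distrib right_diff_distrib uu hu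
        \<kappa>_central[of u 1] \<kappa>_central[of h 1] \<kappa>_1 unital_mult unital_\<kappa> double_unital algebra_simps)
qed

end

section \<open>The product of all rings on a type\<close>

text \<open>
  Algebras are records with a carrier, whereas the computations above take place in a type of class \<^class>\<open>ring\<close>.
  The two are connected by embedding a record \<open>R\<close> as one factor of the product of all rings on the same type;
  \<open>at_ring R\<close> is additive, multiplicative and injective, but sends one to an idempotent only.
\<close>

typedef ('a, 'm) ring_product =
  "{f :: ('a, 'm) ring_scheme \<Rightarrow> 'a. \<forall>R. if ring R then f R \<in> carrier R else f R = undefined}"
  morphisms component Abs_ring_product
  by (rule exI[of _ "\<lambda>R. if ring R then \<zero>\<^bsub>R\<^esub> else undefined"])
    (auto simp: ring.ring_simprules(2))

definition tuple :: "(('a, 'm) ring_scheme \<Rightarrow> 'a) \<Rightarrow> ('a, 'm) ring_product" where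
  "tuple f = Abs_ring_product (\<lambda>R. if ring R then f R else undefined)"

lemma component_tuple: "(\<And>R. ring R \<Longrightarrow> f R \<in> carrier R) \<Longrightarrow> ring R \<Longrightarrow> component (tuple f) R = f R"
  unfolding tuple_def by (subst Abs_ring_product_inverse) auto

lemma component_closed: "ring R \<Longrightarrow> component p R \<in> carrier R"
  using component[of p] by (simp split: if_splits)

lemma ring_product_eqI: "(\<And>R. ring R \<Longrightarrow> component p R = component q R) \<Longrightarrow> p = q"
proof -
  assume *: "\<And>R. ring R \<Longrightarrow> component p R = component q R"
  have "component p = component q"
  proof
    fix R show "component p R = component q R"
      using * component[of p] component[of q] by (cases "ring R") auto
  qed
  then show ?thesis by (simp add: component_inject)
qed

instantiation ring_product :: (type, type) ring
begin

definition "0 = tuple (\<lambda>R. \<zero>\<^bsub>R\<^esub>)"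
definition "p + q = tuple (\<lambda>R. component p R \<oplus>\<^bsub>R\<^esub> component q R)"
definition "p * q = tuple (\<lambda>R. component p R \<otimes>\<^bsub>R\<^esub> component q R)"
definition "- p = tuple (\<lambda>R. \<ominus>\<^bsub>R\<^esub> component p R)"
definition "p - q = tuple (\<lambda>R. component p R \<ominus>\<^bsub>R\<^esub> component q R)"

lemma component_simps:
  assumes "ring R"
  shows "component 0 R = \<zero>\<^bsub>R\<^esub>"
    and "component (p + q) R = component p R \<oplus>\<^bsub>R\<^esub> component q R"
    and "component (p * q) R = component p R \<otimes>\<^bsub>R\<^esub> component q R"
    and "component (- p) R = \<ominus>\<^bsub>R\<^esub> component p R"
    and "component (p - q) R = component p R \<ominus>\<^bsub>R\<^esub> component q R"
  unfolding zero_ring_product_def plus_ring_product_def times_ring_product_def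
    uminus_ring_product_def minus_ring_product_def
  by (subst component_tuple; use assms in \<open>simp add: ring.ring_simprules component_closed\<close>)+

instance
  by standard
    (rule ring_product_eqI, simp add: component_simps component_closed ring.ring_simprules)+

end

definition at_ring :: "('a, 'm) ring_scheme \<Rightarrow> 'a \<Rightarrow> ('a, 'm) ring_product" where
  "at_ring R a = tuple (\<lambda>R'. if R' = R then a else \<zero>\<^bsub>R'\<^esub>)"

context ring
begin

lemma component_at_ring:
  "a \<in> carrier R \<Longrightarrow> ring R' \<Longrightarrow> component (at_ring R a) R' = (if R' = R then a else \<zero>\<^bsub>R'\<^esub>)"
  unfolding at_ring_def by (rule component_tuple) (auto simp: ring.ring_simprules)

lemma at_ring_inj: "a \<in> carrier R \<Longrightarrow> b \<in> carrier R \<Longrightarrow> at_ring R a = at_ring R b \<Longrightarrow> a = b"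
  using component_at_ring[OF _ ring_axioms] by metis

lemma at_ring_zero [simp]: "at_ring R \<zero> = 0"
  by (rule ring_product_eqI) (auto simp: component_at_ring component_simps)

lemma at_ring_add: "a \<in> carrier R \<Longrightarrow> b \<in> carrier R \<Longrightarrow> at_ring R (a \<oplus> b) = at_ring R a + at_ring R b"
  by (rule ring_product_eqI) (auto simp: component_at_ring component_simps ring.ring_simprules)

lemma at_ring_mult: "a \<in> carrier R \<Longrightarrow> b \<in> carrier R \<Longrightarrow> at_ring R (a \<otimes> b) = at_ring R a * at_ring R b"
  by (rule ring_product_eqI) (auto simp: component_at_ring component_simps ring.ring_simprules)

lemma at_ring_minus: "a \<in> carrier R \<Longrightarrow> b \<in> carrier R \<Longrightarrow> at_ring R (a \<ominus> b) = at_ring R a - at_ring R b"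
  by (rule ring_product_eqI) (auto simp: component_at_ring component_simps ring.ring_simprules)

lemma at_ring_finsum: "f \<in> A \<rightarrow> carrier R \<Longrightarrow> at_ring R (finsum R f A) = (\<Sum>i\<in>A. at_ring R (f i))"
  by (induction A rule: infinite_finite_induct) (auto simp: at_ring_add Pi_def)

end

section \<open>Complex algebras and their scalars in the product ring\<close>

locale complex_algebra = ring A for A :: "(complex, 'a, 'm) module_scheme" (structure) +
  assumes smult_closed [simp, intro]: "a \<in> carrier A \<Longrightarrow> z \<odot> a \<in> carrier A"
    and smult_add_left: "a \<in> carrier A \<Longrightarrow> (z + w) \<odot> a = z \<odot> a \<oplus> w \<odot> a"
    and smult_smult: "a \<in> carrier A \<Longrightarrow> z \<odot> (w \<odot> a) = (z * w) \<odot> a"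
    and smult_one: "a \<in> carrier A \<Longrightarrow> 1 \<odot> a = a"
    and smult_mult_left: "a \<in> carrier A \<Longrightarrow> b \<in> carrier A \<Longrightarrow> (z \<odot> a) \<otimes> b = z \<odot> (a \<otimes> b)"
    and smult_mult_right: "a \<in> carrier A \<Longrightarrow> b \<in> carrier A \<Longrightarrow> a \<otimes> (z \<odot> b) = z \<odot> (a \<otimes> b)"
begin

definition scalar :: "complex \<Rightarrow> ('a, (complex, 'a, 'm) module_ext) ring_product" where
  "scalar z = at_ring A (z \<odot> \<one>)"

lemma at_ring_smult: "a \<in> carrier A \<Longrightarrow> at_ring A (z \<odot> a) = scalar z * at_ring A a"
  unfolding scalar_def by (subst at_ring_mult[symmetric]) (auto simp: smult_mult_left)

text \<open>Centrality is claimed against all elements of the product ring, not only those coming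
  from \<open>A\<close>: in the other factors \<open>scalar z\<close> is zero, and in the factor of
  \<open>A\<close> a multiple of one commutes with everything.\<close>

sublocale scalars: central_scalars scalar
proof
  fix z w t
  show "scalar (z + w) = scalar z + scalar w"
    by (simp add: scalar_def smult_add_left at_ring_add)
  show "scalar (z * w) = scalar z * scalar w"
    by (simp add: scalar_def at_ring_mult[symmetric] smult_mult_left smult_smult)
  show "t * scalar z = scalar z * t"
    by (rule ring_product_eqI)
      (auto simp: scalar_def component_simps component_at_ring component_closed ring.ring_simprules
        smult_mult_left smult_mult_right)
qed

lemma smult_zero_left: "a \<in> carrier A \<Longrightarrow> 0 \<odot> a = \<zero>"
  by (intro at_ring_inj) (auto simp: at_ring_smult scalars.\<kappa>_0)

lemma at_ring_one: "at_ring A \<one> = scalar 1"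
  by (simp add: scalar_def smult_one)

end

section \<open>Finitely supported functions and monoid algebras\<close>

lemma poly_mapping_induct_on [consumes 1, case_names zero add]:
  fixes f :: "'k \<Rightarrow>\<^sub>0 'z::comm_monoid_add"
  assumes "Poly_Mapping.keys f \<subseteq> A" "P 0"
    and "\<And>k z f. k \<in> A \<Longrightarrow> Poly_Mapping.keys f \<subseteq> A \<Longrightarrow> P f \<Longrightarrow> P (Poly_Mapping.single k z + f)"
  shows "P f"
proof -
  have "P (\<Sum>k\<in>B. Poly_Mapping.single k (g k)) \<and> Poly_Mapping.keys (\<Sum>k\<in>B. Poly_Mapping.single k (g k)) \<subseteq> A"
    if "finite B" "B \<subseteq> A" for B and g :: "'k \<Rightarrow> 'z"
    using that
  proof induction
    case (insert k B)
    then show ?case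
      using assms(3)[of k "\<Sum>k\<in>B. Poly_Mapping.single k (g k)" "g k"]
        keys_add[of "Poly_Mapping.single k (g k)" "\<Sum>k\<in>B. Poly_Mapping.single k (g k)"]
      by (auto split: if_splits)
  qed (simp add: assms(2))
  moreover have "(\<Sum>k\<in>Poly_Mapping.keys f. Poly_Mapping.single k (Poly_Mapping.lookup f k)) = f"
    by (rule poly_mapping_eqI) (auto simp: lookup_sum lookup_single when_def in_keys_iff sum.delta)
  ultimately show ?thesis using assms(1) by (metis finite_keys)
qed

text \<open>If every \<open>F k\<close> is additive, as in \<open>pm_extend_add\<close>, this is the
  additive map with the value \<open>F k z\<close> on
  \<open>Poly_Mapping.single k z\<close>.\<close>

definition pm_extend :: "('k \<Rightarrow> 'z::zero \<Rightarrow> 'b::comm_monoid_add) \<Rightarrow> ('k \<Rightarrow>\<^sub>0 'z) \<Rightarrow> 'b" where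
  "pm_extend F f = (\<Sum>k\<in>Poly_Mapping.keys f. F k (Poly_Mapping.lookup f k))"

lemma pm_extend_superset:
  assumes "\<And>k. F k 0 = 0" "finite A" "Poly_Mapping.keys f \<subseteq> A"
  shows "pm_extend F f = (\<Sum>k\<in>A. F k (Poly_Mapping.lookup f k))"
  unfolding pm_extend_def using assms
  by (intro sum.mono_neutral_left) (auto simp: in_keys_iff)

lemma pm_extend_0 [simp]: "pm_extend F 0 = 0"
  by (simp add: pm_extend_def)

lemma pm_extend_single: "(\<And>k. F k 0 = 0) \<Longrightarrow> pm_extend F (Poly_Mapping.single k z) = F k z"
  by (simp add: pm_extend_def)

lemma pm_extend_add:
  assumes "\<And>k. F k 0 = 0" "\<And>k z w. F k (z + w) = F k z + F k w"
  shows "pm_extend F (f + h) = pm_extend F f + pm_extend F h"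
proof -
  let ?A = "Poly_Mapping.keys f \<union> Poly_Mapping.keys h"
  have "Poly_Mapping.keys (f + h) \<subseteq> ?A" by (rule keys_add)
  then show ?thesis
    using assms by (simp add: pm_extend_superset[of F ?A] lookup_add sum.distrib)
qed

lemma pm_extend_add_fun: "pm_extend (\<lambda>k z. F k z + G k z) f = pm_extend F f + pm_extend G f"
  by (simp add: pm_extend_def sum.distrib)

lemma lookup_scale: "Poly_Mapping.lookup (Poly_Mapping.map ((*) (z::complex)) f) k = z * Poly_Mapping.lookup f k"
  by (simp add: Poly_Mapping.map.rep_eq when_def)

lemma scale_single: "Poly_Mapping.map ((*) (z::complex)) (Poly_Mapping.single k w) = Poly_Mapping.single k (z * w)"
  by (rule poly_mapping_eqI) (simp add: lookup_scale lookup_single when_def)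

lemma scale_add: "Poly_Mapping.map ((*) (z::complex)) (f + h) = Poly_Mapping.map ((*) z) f + Poly_Mapping.map ((*) z) h"
  by (rule poly_mapping_eqI) (simp add: lookup_scale lookup_add distrib_left)

lemma scale_zero [simp]: "Poly_Mapping.map ((*) (z::complex)) 0 = 0"
  by (rule poly_mapping_eqI) (simp add: lookup_scale)

lemma keys_scale: "Poly_Mapping.keys (Poly_Mapping.map ((*) (z::complex)) f) \<subseteq> Poly_Mapping.keys f"
  by (auto simp: in_keys_iff lookup_scale)

lemma monoid_alg_simps:
  "carrier (monoid_alg G) = {f. Poly_Mapping.keys f \<subseteq> carrier G}"
  "one (monoid_alg G) = Poly_Mapping.single \<one>\<^bsub>G\<^esub> 1"
  "zero (monoid_alg G) = 0" "add (monoid_alg G) = (+)"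
  "smult (monoid_alg G) z = Poly_Mapping.map ((*) z)"
  by (simp_all add: monoid_alg_def)

text \<open>Writing the convolution as two nested extensions makes distributivity on either side a
  consequence of the additivity of \<open>pm_extend\<close>.\<close>

lemma monoid_alg_mult:
  "f \<otimes>\<^bsub>monoid_alg G\<^esub> h = pm_extend (\<lambda>a z. pm_extend (\<lambda>b w. Poly_Mapping.single (a \<otimes>\<^bsub>G\<^esub> b) (z * w)) h) f"
  by (simp add: monoid_alg_def pm_extend_def)

lemma monoid_alg_mult_single:
  "Poly_Mapping.single a z \<otimes>\<^bsub>monoid_alg G\<^esub> Poly_Mapping.single b w = Poly_Mapping.single (a \<otimes>\<^bsub>G\<^esub> b) (z * w)"
  by (simp add: monoid_alg_mult pm_extend_single pm_extend_def)

lemma monoid_alg_mult_zero [simp]: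
  "0 \<otimes>\<^bsub>monoid_alg G\<^esub> f = 0" "f \<otimes>\<^bsub>monoid_alg G\<^esub> 0 = 0"
  by (simp_all add: monoid_alg_mult) (simp add: pm_extend_def)

lemma monoid_alg_l_distr:
  "(f + g) \<otimes>\<^bsub>monoid_alg G\<^esub> h = f \<otimes>\<^bsub>monoid_alg G\<^esub> h + g \<otimes>\<^bsub>monoid_alg G\<^esub> h"
  unfolding monoid_alg_mult
  by (rule pm_extend_add) (simp_all add: pm_extend_def distrib_right single_add sum.distrib)

lemma monoid_alg_r_distr:
  "h \<otimes>\<^bsub>monoid_alg G\<^esub> (f + g) = h \<otimes>\<^bsub>monoid_alg G\<^esub> f + h \<otimes>\<^bsub>monoid_alg G\<^esub> g"
  unfolding monoid_alg_mult
  by (subst pm_extend_add) (simp_all add: distrib_left single_add pm_extend_add_fun)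

context Group.monoid
begin

lemma monoid_alg_closed:
  "f \<in> carrier (monoid_alg G) \<Longrightarrow> h \<in> carrier (monoid_alg G) \<Longrightarrow> f \<otimes>\<^bsub>monoid_alg G\<^esub> h \<in> carrier (monoid_alg G)"
  unfolding monoid_alg_simps monoid_alg_mult pm_extend_def
  by (auto dest!: subsetD[OF keys_sum] split: if_splits intro!: m_closed)

lemma monoid_alg_induct [consumes 1, case_names zero add]:
  assumes "f \<in> carrier (monoid_alg G)" "P 0"
    and "\<And>k z f. k \<in> carrier G \<Longrightarrow> f \<in> carrier (monoid_alg G) \<Longrightarrow> P f \<Longrightarrow> P (Poly_Mapping.single k z + f)"
  shows "P f"
proof (rule poly_mapping_induct_on[where f = f and A = "carrier G"])
  show "Poly_Mapping.keys f \<subseteq> carrier G" using assms(1) by (simp add: monoid_alg_simps)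
qed (use assms(2,3) in \<open>auto simp: monoid_alg_simps\<close>)

text \<open>Multiplication is additive in each argument, so three nested inductions reduce the claim
  to monomials, where it is associativity in the monoid.\<close>

lemma monoid_alg_assoc:
  assumes "f \<in> carrier (monoid_alg G)" "g \<in> carrier (monoid_alg G)" "h \<in> carrier (monoid_alg G)"
  shows "f \<otimes>\<^bsub>monoid_alg G\<^esub> g \<otimes>\<^bsub>monoid_alg G\<^esub> h = f \<otimes>\<^bsub>monoid_alg G\<^esub> (g \<otimes>\<^bsub>monoid_alg G\<^esub> h)"
  using assms(1)
proof (induction f rule: monoid_alg_induct)
  case (add k z f)
  have "Poly_Mapping.single k z \<otimes>\<^bsub>monoid_alg G\<^esub> g \<otimes>\<^bsub>monoid_alg G\<^esub> h
      = Poly_Mapping.single k z \<otimes>\<^bsub>monoid_alg G\<^esub> (g \<otimes>\<^bsub>monoid_alg G\<^esub> h)"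
    using assms(2)
  proof (induction g rule: monoid_alg_induct)
    case (add l w g)
    have "Poly_Mapping.single k z \<otimes>\<^bsub>monoid_alg G\<^esub> Poly_Mapping.single l w \<otimes>\<^bsub>monoid_alg G\<^esub> h
      = Poly_Mapping.single k z \<otimes>\<^bsub>monoid_alg G\<^esub> (Poly_Mapping.single l w \<otimes>\<^bsub>monoid_alg G\<^esub> h)"
      using assms(3)
    proof (induction h rule: monoid_alg_induct)
      case (add m v h)
      with \<open>k \<in> carrier G\<close> \<open>l \<in> carrier G\<close> show ?case
        by (simp add: monoid_alg_r_distr monoid_alg_mult_single m_assoc mult.assoc)
    qed simp
    with add show ?case by (simp add: monoid_alg_l_distr monoid_alg_r_distr)
  qed simp
  with add show ?case by (simp add: monoid_alg_l_distr)
qed simp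

lemma complex_algebra_monoid_alg: "complex_algebra (monoid_alg G)"
proof (intro complex_algebra.intro complex_algebra_axioms.intro ringI abelian_groupI monoidI)
  fix f assume f: "f \<in> carrier (monoid_alg G)"
  show "\<one>\<^bsub>monoid_alg G\<^esub> \<otimes>\<^bsub>monoid_alg G\<^esub> f = f"
    using f by (induction f rule: monoid_alg_induct)
      (auto simp: monoid_alg_simps(2) monoid_alg_r_distr monoid_alg_mult_single)
  show "f \<otimes>\<^bsub>monoid_alg G\<^esub> \<one>\<^bsub>monoid_alg G\<^esub> = f"
    using f by (induction f rule: monoid_alg_induct)
      (auto simp: monoid_alg_simps(2) monoid_alg_l_distr monoid_alg_mult_single)
  show "\<exists>h\<in>carrier (monoid_alg G). h \<oplus>\<^bsub>monoid_alg G\<^esub> f = \<zero>\<^bsub>monoid_alg G\<^esub>"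
    using f by (intro bexI[of _ "- f"]) (auto simp: monoid_alg_simps)
  fix z w
  show "z \<odot>\<^bsub>monoid_alg G\<^esub> f \<in> carrier (monoid_alg G)"
    using f keys_scale[of z f] by (auto simp: monoid_alg_simps)
  show "(z + w) \<odot>\<^bsub>monoid_alg G\<^esub> f = z \<odot>\<^bsub>monoid_alg G\<^esub> f \<oplus>\<^bsub>monoid_alg G\<^esub> w \<odot>\<^bsub>monoid_alg G\<^esub> f"
    "z \<odot>\<^bsub>monoid_alg G\<^esub> (w \<odot>\<^bsub>monoid_alg G\<^esub> f) = (z * w) \<odot>\<^bsub>monoid_alg G\<^esub> f"
    "1 \<odot>\<^bsub>monoid_alg G\<^esub> f = f"
    by (auto intro!: poly_mapping_eqI simp: monoid_alg_simps lookup_scale lookup_add algebra_simps)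
  fix h
  have *: "(z \<odot>\<^bsub>monoid_alg G\<^esub> f) \<otimes>\<^bsub>monoid_alg G\<^esub> h = z \<odot>\<^bsub>monoid_alg G\<^esub> (f \<otimes>\<^bsub>monoid_alg G\<^esub> h)
    \<and> f \<otimes>\<^bsub>monoid_alg G\<^esub> (z \<odot>\<^bsub>monoid_alg G\<^esub> h) = z \<odot>\<^bsub>monoid_alg G\<^esub> (f \<otimes>\<^bsub>monoid_alg G\<^esub> h)"
    if h: "h \<in> carrier (monoid_alg G)"
    using f
  proof (induction f rule: monoid_alg_induct)
    case (add k w f)
    have "(z \<odot>\<^bsub>monoid_alg G\<^esub> Poly_Mapping.single k w) \<otimes>\<^bsub>monoid_alg G\<^esub> h = z \<odot>\<^bsub>monoid_alg G\<^esub> (Poly_Mapping.single k w \<otimes>\<^bsub>monoid_alg G\<^esub> h)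
      \<and> Poly_Mapping.single k w \<otimes>\<^bsub>monoid_alg G\<^esub> (z \<odot>\<^bsub>monoid_alg G\<^esub> h) = z \<odot>\<^bsub>monoid_alg G\<^esub> (Poly_Mapping.single k w \<otimes>\<^bsub>monoid_alg G\<^esub> h)"
      using h by (induction h rule: monoid_alg_induct)
        (auto simp: monoid_alg_simps(5) monoid_alg_r_distr monoid_alg_mult_single scale_add scale_single mult.assoc mult.left_commute)
    with add show ?case
      by (auto simp: monoid_alg_simps(5) monoid_alg_l_distr scale_add)
  qed (auto simp: monoid_alg_simps(5))
  then show "h \<in> carrier (monoid_alg G) \<Longrightarrow> (z \<odot>\<^bsub>monoid_alg G\<^esub> f) \<otimes>\<^bsub>monoid_alg G\<^esub> h = z \<odot>\<^bsub>monoid_alg G\<^esub> (f \<otimes>\<^bsub>monoid_alg G\<^esub> h)"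
    "h \<in> carrier (monoid_alg G) \<Longrightarrow> f \<otimes>\<^bsub>monoid_alg G\<^esub> (z \<odot>\<^bsub>monoid_alg G\<^esub> h) = z \<odot>\<^bsub>monoid_alg G\<^esub> (f \<otimes>\<^bsub>monoid_alg G\<^esub> h)"
    by auto
  assume h: "h \<in> carrier (monoid_alg G)"
  then show "f \<otimes>\<^bsub>monoid_alg G\<^esub> h \<in> carrier (monoid_alg G)" using f by (rule monoid_alg_closed[rotated])
  show "f \<oplus>\<^bsub>monoid_alg G\<^esub> h \<in> carrier (monoid_alg G)"
    using f h keys_add[of f h] by (auto simp: monoid_alg_simps)
  fix g assume g: "g \<in> carrier (monoid_alg G)"
  show "f \<otimes>\<^bsub>monoid_alg G\<^esub> h \<otimes>\<^bsub>monoid_alg G\<^esub> g = f \<otimes>\<^bsub>monoid_alg G\<^esub> (h \<otimes>\<^bsub>monoid_alg G\<^esub> g)"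
    using f h g by (rule monoid_alg_assoc)
qed (simp_all add: monoid_alg_simps monoid_alg_l_distr monoid_alg_r_distr ac_simps)

end

section \<open>Presented algebras and tensor products\<close>

lemma monoid_alg_l_diff:
  "(f - g) \<otimes>\<^bsub>monoid_alg G\<^esub> h = f \<otimes>\<^bsub>monoid_alg G\<^esub> h - g \<otimes>\<^bsub>monoid_alg G\<^esub> h"
  by (metis monoid_alg_l_distr add_diff_cancel_right' diff_add_cancel)

lemma monoid_alg_r_diff:
  "h \<otimes>\<^bsub>monoid_alg G\<^esub> (f - g) = h \<otimes>\<^bsub>monoid_alg G\<^esub> f - h \<otimes>\<^bsub>monoid_alg G\<^esub> g"
  by (metis monoid_alg_r_distr add_diff_cancel_right' diff_add_cancel)

lemma diff_in_monoid_alg: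
  "f \<in> carrier (monoid_alg G) \<Longrightarrow> g \<in> carrier (monoid_alg G) \<Longrightarrow> f - g \<in> carrier (monoid_alg G)"
  using keys_diff[of f g] by (auto simp: monoid_alg_simps)

lemma add_in_monoid_alg:
  "f \<in> carrier (monoid_alg G) \<Longrightarrow> g \<in> carrier (monoid_alg G) \<Longrightarrow> f + g \<in> carrier (monoid_alg G)"
  using keys_add[of f g] by (auto simp: monoid_alg_simps)

lemma single_in_monoid_alg: "k \<in> carrier G \<Longrightarrow> Poly_Mapping.single k z \<in> carrier (monoid_alg G)"
  by (auto simp: monoid_alg_simps)

lemma sum_in_monoid_alg:
  "(\<And>i. i \<in> A \<Longrightarrow> f i \<in> carrier (monoid_alg G)) \<Longrightarrow> sum f A \<in> carrier (monoid_alg G)"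
proof (induction A rule: infinite_finite_induct)
  case (insert i A)
  then show ?case by (auto intro: add_in_monoid_alg)
qed (auto simp: monoid_alg_simps)

lemmas monoid_alg_intros = diff_in_monoid_alg add_in_monoid_alg single_in_monoid_alg sum_in_monoid_alg

lemma ring_quot_alg:
  assumes "ring (A Quot I)" shows "ring (quot_alg A I)"
proof -
  interpret Q: ring "A Quot I" by fact
  show ?thesis
    unfolding quot_alg_def
    by (intro ringI abelian_groupI monoidI)
      (auto simp: Q.ring_simprules intro: Q.l_neg Q.a_inv_closed)
qed

locale presentation = Group.monoid G for G :: "('g, 'm) monoid_scheme" (structure) +
  fixes S :: "('g \<Rightarrow>\<^sub>0 complex) set"
  assumes rels: "S \<subseteq> carrier (monoid_alg G)"
begin

abbreviation "MA \<equiv> monoid_alg G"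
abbreviation "relI \<equiv> Idl\<^bsub>MA\<^esub> S"
abbreviation "Q \<equiv> presented_alg G S"

definition cls :: "('g \<Rightarrow>\<^sub>0 complex) \<Rightarrow> ('g \<Rightarrow>\<^sub>0 complex) set" where
  "cls f = relI +>\<^bsub>MA\<^esub> f"

sublocale MA: complex_algebra MA
  by (rule complex_algebra_monoid_alg)

sublocale relI: ideal relI MA
  by (rule MA.genideal_ideal[OF rels])

lemma Q_simps:
  "carrier Q = carrier (MA Quot relI)" "mult Q = mult (MA Quot relI)" "one Q = one (MA Quot relI)"
  "zero Q = zero (MA Quot relI)" "add Q = add (MA Quot relI)"
  by (simp_all add: presented_alg_def quot_alg_def)

sublocale Q: ring Q
  unfolding presented_alg_def by (intro ring_quot_alg relI.quotient_is_ring)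

lemma carrier_Q: "carrier Q = cls ` carrier MA"
  by (auto simp: Q_simps FactRing_def A_RCOSETS_defs cls_def a_r_coset_def[symmetric])

lemma cls_closed [simp, intro]: "f \<in> carrier MA \<Longrightarrow> cls f \<in> carrier Q"
  by (simp add: carrier_Q)

lemma cls_add: "f \<in> carrier MA \<Longrightarrow> g \<in> carrier MA \<Longrightarrow> cls (f + g) = cls f \<oplus>\<^bsub>Q\<^esub> cls g"
  using ring_hom_add[OF relI.rcos_ring_hom] by (simp add: cls_def Q_simps monoid_alg_simps(4))

lemma cls_mult: "f \<in> carrier MA \<Longrightarrow> g \<in> carrier MA \<Longrightarrow> cls (f \<otimes>\<^bsub>MA\<^esub> g) = cls f \<otimes>\<^bsub>Q\<^esub> cls g"
  using ring_hom_mult[OF relI.rcos_ring_hom] by (simp add: cls_def Q_simps)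

lemma cls_one: "cls (Poly_Mapping.single \<one> 1) = \<one>\<^bsub>Q\<^esub>"
  using ring_hom_one[OF relI.rcos_ring_hom] by (simp add: cls_def Q_simps monoid_alg_simps(2))

lemma cls_zero_iff: "f \<in> carrier MA \<Longrightarrow> cls f = \<zero>\<^bsub>Q\<^esub> \<longleftrightarrow> f \<in> relI"
  unfolding cls_def Q_simps FactRing_def using relI.a_rcos_self relI.a_rcos_const by auto

lemma cls_0: "cls 0 = \<zero>\<^bsub>Q\<^esub>"
  using cls_zero_iff[of 0] relI.additive_subgroup_axioms additive_subgroup.zero_closed[of relI MA]
  by (auto simp: monoid_alg_simps)

lemma cls_diff: "f \<in> carrier MA \<Longrightarrow> g \<in> carrier MA \<Longrightarrow> cls (f - g) = cls f \<ominus>\<^bsub>Q\<^esub> cls g"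
proof -
  assume fg: "f \<in> carrier MA" "g \<in> carrier MA"
  then have "cls f = cls (f - g) \<oplus>\<^bsub>Q\<^esub> cls g"
    by (subst cls_add[symmetric]) (auto intro: monoid_alg_intros)
  with fg show ?thesis
    by (simp add: Q.minus_eq Q.a_assoc Q.r_neg monoid_alg_intros)
qed

lemma cls_eq_iff: "f \<in> carrier MA \<Longrightarrow> g \<in> carrier MA \<Longrightarrow> cls f = cls g \<longleftrightarrow> f - g \<in> relI"
  using cls_zero_iff[of "f - g"] by (auto simp: cls_diff diff_in_monoid_alg)

lemma rel_eq: "f - g \<in> S \<Longrightarrow> f \<in> carrier MA \<Longrightarrow> g \<in> carrier MA \<Longrightarrow> cls f = cls g"
  using MA.genideal_self[OF rels] by (auto simp: cls_eq_iff)

text \<open>\<open>quot_alg\<close> scales a coset by uniting the cosets of all its scaled members.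
  Scaling is multiplication by a multiple of one, hence respects the ideal, and the union consists
  of a single coset.\<close>

lemma cls_smult: assumes f: "f \<in> carrier MA" shows "cls (Poly_Mapping.map ((*) z) f) = z \<odot>\<^bsub>Q\<^esub> cls f"
proof -
  have scale: "Poly_Mapping.map ((*) z) g = Poly_Mapping.single \<one> z \<otimes>\<^bsub>MA\<^esub> g" if "g \<in> carrier MA" for g
    using MA.smult_mult_left[OF MA.one_closed that, of z] MA.l_one[OF that]
    by (simp add: monoid_alg_simps(2,5) scale_single)
  have cl: "cls (Poly_Mapping.map ((*) z) g) = cls (Poly_Mapping.map ((*) z) f)" if "g \<in> cls f" for g
  proof -
    have "g \<in> carrier MA"
      using subsetD[OF MA.a_r_coset_subset_G[OF relI.a_subset f], of g] that by (simp only: cls_def)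
    moreover from this have "cls g = cls f"
      using that f unfolding cls_def by (intro relI.a_repr_independence'[symmetric])
    ultimately show ?thesis
      using f by (simp add: scale cls_mult single_in_monoid_alg)
  qed
  have ne: "f \<in> cls f"
    using f by (simp add: cls_def relI.a_rcos_self)
  have "z \<odot>\<^bsub>Q\<^esub> cls f = (\<Union>g\<in>cls f. cls (Poly_Mapping.map ((*) z) g))"
    by (simp add: presented_alg_def quot_alg_def cls_def monoid_alg_simps)
  also have "\<dots> = (\<Union>g\<in>cls f. cls (Poly_Mapping.map ((*) z) f))"
    by (intro SUP_cong refl cl)
  finally show ?thesis using ne by auto
qed

lemma Q_cases:
  assumes "a \<in> carrier Q" obtains f where "f \<in> carrier MA" "a = cls f"
  using assms by (auto simp: carrier_Q)

lemma scale_in_MA: "f \<in> carrier MA \<Longrightarrow> Poly_Mapping.map ((*) z) f \<in> carrier MA"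
  using MA.smult_closed[of f z] by (simp add: monoid_alg_simps)

sublocale Q: complex_algebra Q
proof unfold_locales
  fix a z w assume "a \<in> carrier Q"
  then obtain f where f: "f \<in> carrier MA" "a = cls f" by (rule Q_cases)
  show "z \<odot>\<^bsub>Q\<^esub> a \<in> carrier Q"
    using f by (simp add: cls_smult[symmetric] scale_in_MA)
  show "(z + w) \<odot>\<^bsub>Q\<^esub> a = z \<odot>\<^bsub>Q\<^esub> a \<oplus>\<^bsub>Q\<^esub> w \<odot>\<^bsub>Q\<^esub> a"
    using f MA.smult_add_left[of f z w]
    by (simp add: cls_smult[symmetric] cls_add[symmetric] scale_in_MA monoid_alg_simps(4,5))
  show "z \<odot>\<^bsub>Q\<^esub> (w \<odot>\<^bsub>Q\<^esub> a) = (z * w) \<odot>\<^bsub>Q\<^esub> a"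
    using f MA.smult_smult[of f z w]
    by (simp add: cls_smult[symmetric] scale_in_MA monoid_alg_simps(4,5))
  show "1 \<odot>\<^bsub>Q\<^esub> a = a"
    using f MA.smult_one[of f]
    by (simp add: cls_smult[symmetric] scale_in_MA monoid_alg_simps(4,5))
  fix b assume "b \<in> carrier Q"
  then obtain g where g: "g \<in> carrier MA" "b = cls g" by (rule Q_cases)
  show "(z \<odot>\<^bsub>Q\<^esub> a) \<otimes>\<^bsub>Q\<^esub> b = z \<odot>\<^bsub>Q\<^esub> (a \<otimes>\<^bsub>Q\<^esub> b)"
    using f g MA.smult_mult_left[of f g z]
    by (simp add: cls_smult[symmetric] cls_mult[symmetric] scale_in_MA monoid_alg_simps(4,5))
  show "a \<otimes>\<^bsub>Q\<^esub> (z \<odot>\<^bsub>Q\<^esub> b) = z \<odot>\<^bsub>Q\<^esub> (a \<otimes>\<^bsub>Q\<^esub> b)"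
    using f g MA.smult_mult_right[of f g z]
    by (simp add: cls_smult[symmetric] cls_mult[symmetric] scale_in_MA monoid_alg_simps(4,5))
qed

lemma cls_single: "k \<in> carrier G \<Longrightarrow> cls (Poly_Mapping.single k z) = z \<odot>\<^bsub>Q\<^esub> presented_cls G S k"
  by (simp add: presented_cls_def cls_def[symmetric] cls_smult[symmetric] scale_single single_in_monoid_alg)

lemma presented_cls_closed [simp, intro]: "k \<in> carrier G \<Longrightarrow> presented_cls G S k \<in> carrier Q"
  by (simp add: presented_cls_def cls_def[symmetric] single_in_monoid_alg)

lemma presented_cls_mult:
  "k \<in> carrier G \<Longrightarrow> l \<in> carrier G \<Longrightarrow> presented_cls G S (k \<otimes> l) = presented_cls G S k \<otimes>\<^bsub>Q\<^esub> presented_cls G S l"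
  by (simp add: presented_cls_def cls_def[symmetric] cls_mult[symmetric] monoid_alg_mult_single single_in_monoid_alg)

lemma presented_cls_one: "presented_cls G S \<one> = \<one>\<^bsub>Q\<^esub>"
  by (simp add: presented_cls_def cls_def[symmetric] cls_one)

lemma cls_sum:
  "(\<And>i. i \<in> A \<Longrightarrow> f i \<in> carrier MA) \<Longrightarrow> cls (sum f A) = (\<Oplus>\<^bsub>Q\<^esub>i\<in>A. cls (f i))"
proof (induction A rule: infinite_finite_induct)
  case (insert i A)
  then show ?case by (simp add: cls_add sum_in_monoid_alg Pi_def)
qed (simp_all add: cls_0)

text \<open>
  The projection is induced by a linear projection of the space of all finitely supported functions
  onto the preimage of \<open>P\<close>; it respects classes because that preimage contains the ideal of relations.
\<close>

lemma projection_onto_subspace: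
  assumes P: "P \<subseteq> carrier Q" "\<zero>\<^bsub>Q\<^esub> \<in> P" "\<And>a b. a \<in> P \<Longrightarrow> b \<in> P \<Longrightarrow> a \<oplus>\<^bsub>Q\<^esub> b \<in> P"
    "\<And>z a. a \<in> P \<Longrightarrow> z \<odot>\<^bsub>Q\<^esub> a \<in> P"
  obtains p where "\<And>a. a \<in> carrier Q \<Longrightarrow> p a \<in> P" "\<And>a. a \<in> P \<Longrightarrow> p a = a"
    "\<And>a b. a \<in> carrier Q \<Longrightarrow> b \<in> carrier Q \<Longrightarrow> p (a \<oplus>\<^bsub>Q\<^esub> b) = p a \<oplus>\<^bsub>Q\<^esub> p b"
    "\<And>z a. a \<in> carrier Q \<Longrightarrow> p (z \<odot>\<^bsub>Q\<^esub> a) = z \<odot>\<^bsub>Q\<^esub> p a"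
proof -
  let ?sc = "\<lambda>z::complex. \<lambda>f::'g \<Rightarrow>\<^sub>0 complex. Poly_Mapping.map ((*) z) f"
  interpret vector_space ?sc
    by unfold_locales (auto intro!: poly_mapping_eqI simp: lookup_scale lookup_add algebra_simps)
  interpret vector_space_pair ?sc ?sc ..
  define W where "W = {f \<in> carrier MA. cls f \<in> P}"
  have "subspace W"
    using P by (auto simp: subspace_def W_def cls_add cls_smult scale_in_MA cls_0 add_in_monoid_alg)
      (auto simp: monoid_alg_simps)
  \<comment> \<open>A linear left inverse of the identity on \<open>W\<close> with values in
    \<open>W\<close> is a projection onto \<open>W\<close>.\<close>
  moreover have "Vector_Spaces.linear ?sc ?sc (\<lambda>f. f)"
    by (rule linear_ident)
  ultimately obtain g where g: "range g \<subseteq> W" "Vector_Spaces.linear ?sc ?sc g" "\<And>f. f \<in> W \<Longrightarrow> g f = f"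
    using linear_exists_left_inverse_on[of "\<lambda>f. f" W] by (auto simp: inj_on_def)
  interpret g: Vector_Spaces.linear ?sc ?sc g by fact
  have gW: "g f \<in> carrier MA" "cls (g f) \<in> P" for f
    using g(1) by (auto simp: W_def)
  define p where "p a = cls (g (SOME f. f \<in> carrier MA \<and> cls f = a))" for a
  have p: "p (cls f) = cls (g f)" if f: "f \<in> carrier MA" for f
  proof -
    define f' where "f' = (SOME f'. f' \<in> carrier MA \<and> cls f' = cls f)"
    have f': "f' \<in> carrier MA" "cls f' = cls f"
      using someI[of "\<lambda>f'. f' \<in> carrier MA \<and> cls f' = cls f" f] f by (auto simp: f'_def)
    have "cls (f' - f) = \<zero>\<^bsub>Q\<^esub>"
      using f f' by (simp add: cls_diff)
    with P(2) f f' have "f' - f \<in> W" by (simp add: W_def diff_in_monoid_alg)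
    then have "g f' - g f = f' - f"
      using g(3) by (simp add: g.diff[symmetric])
    then have "cls (g f' - g f) = \<zero>\<^bsub>Q\<^esub>" using \<open>cls (f' - f) = _\<close> by simp
    then have "cls (g f') = cls (g f)"
      using gW by (simp add: cls_diff)
    then show ?thesis by (simp add: p_def f'_def)
  qed
  show thesis
  proof (rule that[of p])
    fix a assume "a \<in> carrier Q"
    then show "p a \<in> P" by (auto elim!: Q_cases simp: p gW)
  next
    fix a assume a: "a \<in> P"
    with P(1) obtain f where f: "f \<in> carrier MA" "a = cls f" by (auto elim: Q_cases)
    with a show "p a = a" using g(3)[of f] by (simp add: p W_def)
  next
    fix a b assume "a \<in> carrier Q" "b \<in> carrier Q"
    then show "p (a \<oplus>\<^bsub>Q\<^esub> b) = p a \<oplus>\<^bsub>Q\<^esub> p b"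
      by (auto elim!: Q_cases simp: cls_add[symmetric] p gW g.add add_in_monoid_alg)
  next
    fix z a assume "a \<in> carrier Q"
    then show "p (z \<odot>\<^bsub>Q\<^esub> a) = z \<odot>\<^bsub>Q\<^esub> p a"
      by (auto elim!: Q_cases simp: cls_smult[symmetric] p gW g.scale scale_in_MA)
  qed
qed

end

section \<open>Tensor products of algebras\<close>

locale tensor_product = A: complex_algebra A + B: complex_algebra B
  for A :: "(complex, 'a, 'm) module_scheme" and B :: "(complex, 'b, 'k) module_scheme"
begin

sublocale presentation "A \<times>\<times> B" "tensor_rels A B"
proof (intro presentation.intro presentation_axioms.intro DirProd_monoid A.monoid_axioms B.monoid_axioms)
  show "tensor_rels A B \<subseteq> carrier (monoid_alg (A \<times>\<times> B))"
    unfolding tensor_rels_def by (auto intro!: monoid_alg_intros)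
qed

abbreviation "T \<equiv> tensor_alg A B"
abbreviation "tns \<equiv> tensor_elt A B"

lemma tensor_alg_eq: "T = Q"
  by (simp add: tensor_alg_def)

sublocale T: complex_algebra T
  unfolding tensor_alg_eq by (rule Q.complex_algebra_axioms)

lemma tensor_elt_cls: "tns a b = cls (Poly_Mapping.single (a, b) 1)"
  by (simp add: tensor_elt_def presented_cls_def cls_def)

lemma tensor_closed [simp, intro]: "a \<in> carrier A \<Longrightarrow> b \<in> carrier B \<Longrightarrow> tns a b \<in> carrier T"
  by (auto simp: tensor_elt_def tensor_alg_eq)

lemma tensor_mult:
  "a \<in> carrier A \<Longrightarrow> b \<in> carrier B \<Longrightarrow> a' \<in> carrier A \<Longrightarrow> b' \<in> carrier B \<Longrightarrow>
    tns a b \<otimes>\<^bsub>T\<^esub> tns a' b' = tns (a \<otimes>\<^bsub>A\<^esub> a') (b \<otimes>\<^bsub>B\<^esub> b')"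
  by (simp add: tensor_elt_def tensor_alg_eq presented_cls_mult[symmetric])

lemma tensor_one: "tns \<one>\<^bsub>A\<^esub> \<one>\<^bsub>B\<^esub> = \<one>\<^bsub>T\<^esub>"
  using presented_cls_one by (simp add: tensor_elt_def tensor_alg_eq)

lemma tensor_add_left:
  assumes "a \<in> carrier A" "a' \<in> carrier A" "b \<in> carrier B"
  shows "tns (a \<oplus>\<^bsub>A\<^esub> a') b = tns a b \<oplus>\<^bsub>T\<^esub> tns a' b"
proof -
  have "cls (Poly_Mapping.single (a \<oplus>\<^bsub>A\<^esub> a', b) 1)
     = cls (Poly_Mapping.single (a, b) 1 + Poly_Mapping.single (a', b) 1)"
    using assms by (intro rel_eq monoid_alg_intros) (auto simp: tensor_rels_def diff_diff_eq intro!: exI)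
  with assms show ?thesis
    by (simp add: tensor_elt_cls cls_add single_in_monoid_alg tensor_alg_eq)
qed

lemma tensor_add_right:
  assumes "a \<in> carrier A" "b \<in> carrier B" "b' \<in> carrier B"
  shows "tns a (b \<oplus>\<^bsub>B\<^esub> b') = tns a b \<oplus>\<^bsub>T\<^esub> tns a b'"
proof -
  have "cls (Poly_Mapping.single (a, b \<oplus>\<^bsub>B\<^esub> b') 1)
     = cls (Poly_Mapping.single (a, b) 1 + Poly_Mapping.single (a, b') 1)"
    using assms by (intro rel_eq monoid_alg_intros) (auto simp: tensor_rels_def diff_diff_eq intro!: exI)
  with assms show ?thesis
    by (simp add: tensor_elt_cls cls_add single_in_monoid_alg tensor_alg_eq)
qed

lemma tensor_smult_left:
  assumes "a \<in> carrier A" "b \<in> carrier B"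
  shows "tns (z \<odot>\<^bsub>A\<^esub> a) b = z \<odot>\<^bsub>T\<^esub> tns a b"
proof -
  have "cls (Poly_Mapping.single (z \<odot>\<^bsub>A\<^esub> a, b) 1) = cls (Poly_Mapping.single (a, b) z)"
    using assms by (intro rel_eq monoid_alg_intros) (auto simp: tensor_rels_def intro!: exI)
  with assms show ?thesis
    by (simp add: tensor_elt_cls cls_smult[symmetric] single_in_monoid_alg tensor_alg_eq scale_single)
qed

lemma tensor_smult_right:
  assumes "a \<in> carrier A" "b \<in> carrier B"
  shows "tns a (z \<odot>\<^bsub>B\<^esub> b) = z \<odot>\<^bsub>T\<^esub> tns a b"
proof -
  have "cls (Poly_Mapping.single (a, z \<odot>\<^bsub>B\<^esub> b) 1) = cls (Poly_Mapping.single (a, b) z)"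
    using assms by (intro rel_eq monoid_alg_intros) (auto simp: tensor_rels_def intro!: exI)
  with assms show ?thesis
    by (simp add: tensor_elt_cls cls_smult[symmetric] single_in_monoid_alg tensor_alg_eq scale_single)
qed

end

section \<open>Injectivity of the tensored inclusion of a subalgebra\<close>

locale tensor_subalgebra = A: complex_algebra A + B: complex_algebra B + K: complex_algebra "A\<lparr>carrier := P\<rparr>"
  for A :: "(complex, 'a, 'm) module_scheme" and B :: "(complex, 'b, 'k) module_scheme" and P +
  fixes p
  assumes sub: "P \<subseteq> carrier A"
    and p: "\<And>a. a \<in> carrier A \<Longrightarrow> p a \<in> P" "\<And>a. a \<in> P \<Longrightarrow> p a = a"
    "\<And>a b. a \<in> carrier A \<Longrightarrow> b \<in> carrier A \<Longrightarrow> p (a \<oplus>\<^bsub>A\<^esub> b) = p a \<oplus>\<^bsub>A\<^esub> p b"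
    "\<And>z a. a \<in> carrier A \<Longrightarrow> p (z \<odot>\<^bsub>A\<^esub> a) = z \<odot>\<^bsub>A\<^esub> p a"
begin

abbreviation "K \<equiv> A\<lparr>carrier := P\<rparr>"

sublocale AB: tensor_product A B ..
sublocale KB: tensor_product K B ..

text \<open>Shrinking the carrier leaves the multiplication of the record unchanged, so
  representatives are multiplied in the same way over \<open>A\<close> and over the
  subalgebra.\<close>

lemma MA_mult_eq: "mult KB.MA = mult AB.MA"
  by (simp add: monoid_alg_def DirProd_def)

lemma MA_sub: "f \<in> carrier KB.MA \<Longrightarrow> f \<in> carrier AB.MA"
  using sub by (auto simp: monoid_alg_simps)

text \<open>The retraction \<open>p\<close> tensored with the identity, on formal combinations of
  pairs. Its values are taken in the ring attached to the tensor product over the subalgebra. Like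
  \<open>p\<close>, it is in general only additive.\<close>

definition F where
  "F = pm_extend (\<lambda>k z. KB.T.scalar z * at_ring KB.T (KB.tns (p (fst k)) (snd k)))"

lemma F_add: "F (f + g) = F f + F g"
  unfolding F_def by (rule pm_extend_add) (simp_all add: KB.T.scalars.\<kappa>_add distrib_right)

lemma F_0: "F 0 = 0"
  by (simp add: F_def)

lemma F_diff: "F (f - g) = F f - F g"
  using F_add[of "f - g" g] by (simp add: algebra_simps)

lemma F_single: "F (Poly_Mapping.single (a, b) z) = KB.T.scalar z * at_ring KB.T (KB.tns (p a) b)"
  unfolding F_def by (subst pm_extend_single) auto

text \<open>On pairs with first entry in \<open>P\<close> the retraction does nothing. Together with
  \<open>F_ideal\<close> this lets \<open>F\<close> recover the class over the subalgebra from the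
  class over \<open>A\<close>.\<close>

lemma F_cls: "f \<in> carrier KB.MA \<Longrightarrow> F f = at_ring KB.T (KB.cls f)"
proof (induction f rule: KB.monoid_alg_induct)
  case zero
  then show ?case by (simp add: F_0 KB.cls_0 KB.tensor_alg_eq[symmetric])
next
  case (add k z f)
  then show ?case
    using KB.presented_cls_closed[of k] KB.cls_closed[of f]
    by (cases k) (auto simp: F_add F_single p KB.cls_add single_in_monoid_alg KB.cls_single
      KB.T.at_ring_add KB.T.at_ring_smult tensor_elt_def simp flip: KB.tensor_alg_eq)
qed

text \<open>A bilinearity relation multiplied by pairs on both sides is again such a relation,
  between the multiplied entries. Hence linearity of \<open>p\<close> is enough to annihilate
  it.\<close>

lemma F_rel:
  assumes "r \<in> tensor_rels A B" "k \<in> carrier (A \<times>\<times> B)" "l \<in> carrier (A \<times>\<times> B)"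
  shows "F (Poly_Mapping.single k z \<otimes>\<^bsub>AB.MA\<^esub> r \<otimes>\<^bsub>AB.MA\<^esub> Poly_Mapping.single l w) = 0"
proof -
  obtain k1 k2 l1 l2 where kl: "k = (k1, k2)" "l = (l1, l2)" by (metis surj_pair)
  with assms have car: "k1 \<in> carrier A" "l1 \<in> carrier A" "k2 \<in> carrier B" "l2 \<in> carrier B" by auto
  have pK: "p a \<in> carrier K" if "a \<in> carrier A" for a using p(1)[OF that] by simp
  have add: "KB.tns (p a \<oplus>\<^bsub>A\<^esub> p a') b = KB.tns (p a) b \<oplus>\<^bsub>KB.T\<^esub> KB.tns (p a') b"
    if "a \<in> carrier A" "a' \<in> carrier A" "b \<in> carrier B" for a a' b
    using KB.tensor_add_left[of "p a" "p a'" b] that p(1) by simp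
  have smult: "KB.tns (z \<odot>\<^bsub>A\<^esub> p a) b = z \<odot>\<^bsub>KB.T\<^esub> KB.tns (p a) b"
    if "a \<in> carrier A" "b \<in> carrier B" for z a b
    using KB.tensor_smult_left[of "p a" b z] that p(1) by simp
  show ?thesis
    using assms(1) car pK unfolding kl tensor_rels_def
    by (auto simp: monoid_alg_l_diff monoid_alg_r_diff monoid_alg_mult_single F_diff F_single
        A.l_distr A.r_distr B.l_distr B.r_distr p(3,4) add smult
        A.smult_mult_left A.smult_mult_right B.smult_mult_left B.smult_mult_right
        KB.tensor_add_right KB.tensor_smult_right
        KB.T.at_ring_add KB.T.at_ring_smult distrib_left KB.T.scalars.\<kappa>_left ac_simps)
qed

lemma F_ideal: assumes "f \<in> AB.relI" shows "F f = 0"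
proof -
  \<comment> \<open>The largest two-sided ideal on which \<open>F\<close> vanishes. It contains the
    relations by \<open>F_rel\<close>, hence the ideal they generate; putting one for
    \<open>u\<close> and \<open>v\<close> then gives the claim.\<close>
  define J where "J = {f \<in> carrier AB.MA. \<forall>u\<in>carrier AB.MA. \<forall>v\<in>carrier AB.MA. F (u \<otimes>\<^bsub>AB.MA\<^esub> f \<otimes>\<^bsub>AB.MA\<^esub> v) = 0}"
  have "ideal J AB.MA"
  proof (rule idealI[OF AB.MA.ring_axioms])
    show "subgroup J (add_monoid AB.MA)"
    proof (rule AB.MA.add.subgroupI)
      show "J \<noteq> {}"
        by (auto simp: J_def F_0 monoid_alg_simps(1) intro!: exI[of _ 0])
      fix f assume f: "f \<in> J"
      have inv: "\<ominus>\<^bsub>AB.MA\<^esub> f = 0 - f"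
        using f by (intro AB.MA.minus_equality) (auto simp: J_def monoid_alg_simps)
      have "0 - f \<in> carrier AB.MA"
        using f by (auto simp: J_def monoid_alg_simps)
      then show "\<ominus>\<^bsub>AB.MA\<^esub> f \<in> J"
        using f unfolding inv by (simp only: J_def mem_Collect_eq F_diff F_0 monoid_alg_r_diff monoid_alg_l_diff) (simp add: F_0)
      fix g assume "g \<in> J"
      with f show "f \<oplus>\<^bsub>AB.MA\<^esub> g \<in> J"
        by (auto simp: J_def monoid_alg_simps(4) F_add monoid_alg_r_distr monoid_alg_l_distr intro!: add_in_monoid_alg)
    qed (auto simp: J_def)
    fix f x assume f: "f \<in> J" and x: "x \<in> carrier AB.MA"
    have "u \<otimes>\<^bsub>AB.MA\<^esub> (x \<otimes>\<^bsub>AB.MA\<^esub> f) \<otimes>\<^bsub>AB.MA\<^esub> v = (u \<otimes>\<^bsub>AB.MA\<^esub> x) \<otimes>\<^bsub>AB.MA\<^esub> f \<otimes>\<^bsub>AB.MA\<^esub> v"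
      "u \<otimes>\<^bsub>AB.MA\<^esub> (f \<otimes>\<^bsub>AB.MA\<^esub> x) \<otimes>\<^bsub>AB.MA\<^esub> v = u \<otimes>\<^bsub>AB.MA\<^esub> f \<otimes>\<^bsub>AB.MA\<^esub> (x \<otimes>\<^bsub>AB.MA\<^esub> v)"
      if "u \<in> carrier AB.MA" "v \<in> carrier AB.MA" for u v
      using that f x by (auto simp: J_def AB.MA.m_assoc)
    with f x show "x \<otimes>\<^bsub>AB.MA\<^esub> f \<in> J" "f \<otimes>\<^bsub>AB.MA\<^esub> x \<in> J"
      by (simp_all add: J_def)
  qed
  moreover have "tensor_rels A B \<subseteq> J"
  proof
    fix r assume r: "r \<in> tensor_rels A B"
    have "F (u \<otimes>\<^bsub>AB.MA\<^esub> r \<otimes>\<^bsub>AB.MA\<^esub> v) = 0" if u: "u \<in> carrier AB.MA" and v: "v \<in> carrier AB.MA" for u v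
      using u
    proof (induction u rule: AB.monoid_alg_induct)
      case (add k z u)
      have "F (Poly_Mapping.single k z \<otimes>\<^bsub>AB.MA\<^esub> r \<otimes>\<^bsub>AB.MA\<^esub> v) = 0"
        using v by (induction v rule: AB.monoid_alg_induct)
          (use r add in \<open>auto simp: monoid_alg_r_distr F_add F_0 F_rel\<close>)
      with add show ?case by (simp add: monoid_alg_l_distr F_add)
    qed (simp add: F_0)
    with r AB.rels show "r \<in> J" by (auto simp: J_def)
  qed
  ultimately have "AB.relI \<subseteq> J" by (rule AB.MA.genideal_minimal)
  with assms have "f \<in> J" by auto
  then have "F (\<one>\<^bsub>AB.MA\<^esub> \<otimes>\<^bsub>AB.MA\<^esub> f \<otimes>\<^bsub>AB.MA\<^esub> \<one>\<^bsub>AB.MA\<^esub>) = 0"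
    unfolding J_def using AB.MA.one_closed by blast
  moreover have "f \<in> carrier AB.MA" using \<open>f \<in> J\<close> by (simp add: J_def)
  ultimately show ?thesis by simp
qed

text \<open>The graph of the map between tensor products induced by the inclusion of
  \<open>P\<close>, with \<open>u\<close> over \<open>A\<close> and \<open>v\<close> over the
  subalgebra. As a relation given by common representatives it requires no choices.\<close>

definition same :: "('a \<times> 'b \<Rightarrow>\<^sub>0 complex) set \<Rightarrow> ('a \<times> 'b \<Rightarrow>\<^sub>0 complex) set \<Rightarrow> bool" where
  "same u v \<longleftrightarrow> (\<exists>f\<in>carrier KB.MA. u = AB.cls f \<and> v = KB.cls f)"

text \<open>Two representatives over \<open>P\<close> of one class over \<open>A\<close> differ by
  an element of the ideal over \<open>A\<close>. \<open>F\<close> kills it, while on these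
  representatives \<open>F\<close> is the class over the subalgebra. This is the injectivity that
  brings identities down to the subalgebra.\<close>

lemma same_inj: assumes "same u v" "same u v'" shows "v = v'"
proof -
  obtain f g where f: "f \<in> carrier KB.MA" "u = AB.cls f" "v = KB.cls f"
    and g: "g \<in> carrier KB.MA" "u = AB.cls g" "v' = KB.cls g"
    using assms by (auto simp: same_def)
  then have "f - g \<in> AB.relI" by (simp add: MA_sub flip: AB.cls_eq_iff)
  then have "F (f - g) = 0" by (rule F_ideal)
  then have "at_ring KB.T v = at_ring KB.T v'"
    using f g by (simp add: F_diff F_cls)
  then show ?thesis
    using f g by (intro KB.T.at_ring_inj) (auto simp: KB.tensor_alg_eq)
qed

lemma same_closed: "same u v \<Longrightarrow> u \<in> carrier AB.T \<and> v \<in> carrier KB.T"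
  by (auto simp: same_def AB.tensor_alg_eq KB.tensor_alg_eq MA_sub)

lemma same_tensor: "a \<in> P \<Longrightarrow> b \<in> carrier B \<Longrightarrow> same (AB.tns a b) (KB.tns a b)"
  unfolding same_def AB.tensor_elt_cls KB.tensor_elt_cls
  by (intro bexI[of _ "Poly_Mapping.single (a, b) 1"]) (auto intro: monoid_alg_intros)

lemma same_add:
  assumes "same u v" "same u' v'" shows "same (u \<oplus>\<^bsub>AB.T\<^esub> u') (v \<oplus>\<^bsub>KB.T\<^esub> v')"
proof -
  obtain f g where f: "f \<in> carrier KB.MA" "u = AB.cls f" "v = KB.cls f"
    and g: "g \<in> carrier KB.MA" "u' = AB.cls g" "v' = KB.cls g" using assms by (auto simp: same_def)
  have "u \<oplus>\<^bsub>AB.T\<^esub> u' = AB.cls (f + g)" "v \<oplus>\<^bsub>KB.T\<^esub> v' = KB.cls (f + g)"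
    using f g by (simp_all add: AB.cls_add KB.cls_add MA_sub AB.tensor_alg_eq KB.tensor_alg_eq )
  moreover have "f + g \<in> carrier KB.MA" using f g by (simp add: add_in_monoid_alg)
  ultimately show ?thesis unfolding same_def by blast
qed

lemma same_minus:
  assumes "same u v" "same u' v'" shows "same (u \<ominus>\<^bsub>AB.T\<^esub> u') (v \<ominus>\<^bsub>KB.T\<^esub> v')"
proof -
  obtain f g where f: "f \<in> carrier KB.MA" "u = AB.cls f" "v = KB.cls f"
    and g: "g \<in> carrier KB.MA" "u' = AB.cls g" "v' = KB.cls g" using assms by (auto simp: same_def)
  have "u \<ominus>\<^bsub>AB.T\<^esub> u' = AB.cls (f - g)" "v \<ominus>\<^bsub>KB.T\<^esub> v' = KB.cls (f - g)"
    using f g by (simp_all add: AB.cls_diff KB.cls_diff MA_sub AB.tensor_alg_eq KB.tensor_alg_eq )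
  moreover have "f - g \<in> carrier KB.MA" using f g by (simp add: diff_in_monoid_alg)
  ultimately show ?thesis unfolding same_def by blast
qed

lemma same_mult:
  assumes "same u v" "same u' v'" shows "same (u \<otimes>\<^bsub>AB.T\<^esub> u') (v \<otimes>\<^bsub>KB.T\<^esub> v')"
proof -
  obtain f g where f: "f \<in> carrier KB.MA" "u = AB.cls f" "v = KB.cls f"
    and g: "g \<in> carrier KB.MA" "u' = AB.cls g" "v' = KB.cls g" using assms by (auto simp: same_def)
  have "u \<otimes>\<^bsub>AB.T\<^esub> u' = AB.cls (f \<otimes>\<^bsub>KB.MA\<^esub> g)" "v \<otimes>\<^bsub>KB.T\<^esub> v' = KB.cls (f \<otimes>\<^bsub>KB.MA\<^esub> g)"
    using f g AB.cls_mult[of f g] KB.cls_mult[of f g] by (simp_all add: MA_sub AB.tensor_alg_eq KB.tensor_alg_eq MA_mult_eq)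
  moreover have "f \<otimes>\<^bsub>KB.MA\<^esub> g \<in> carrier KB.MA" using f g by (simp add: KB.monoid_alg_closed)
  ultimately show ?thesis unfolding same_def by blast
qed

lemma same_finsum:
  "(\<And>i. i \<in> A' \<Longrightarrow> same (f i) (g i)) \<Longrightarrow> same (finsum AB.T f A') (finsum KB.T g A')"
proof (induction A' rule: infinite_finite_induct)
  case (insert i A')
  then show ?case
    using same_closed by (subst AB.T.finsum_insert; (subst KB.T.finsum_insert)?) (auto intro!: same_add)
qed (auto simp: same_def KB.cls_0 AB.cls_0 AB.tensor_alg_eq KB.tensor_alg_eq intro!: bexI[of _ 0], auto simp: monoid_alg_simps)

end

section \<open>The Clifford algebra and the rational Cherednik algebra\<close>

lemma (in complex_algebra) generated_subalg:
  assumes "S \<subseteq> carrier A"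
  shows "complex_algebra (generated_subalg A S)" "carrier (generated_subalg A S) \<subseteq> carrier A"
    "subring (carrier (generated_subalg A S)) A" "S \<subseteq> carrier (generated_subalg A S)"
    "a \<in> carrier (generated_subalg A S) \<Longrightarrow> z \<odot> a \<in> carrier (generated_subalg A S)"
proof -
  define P where "P = carrier (generated_subalg A S)"
  \<comment> \<open>The whole carrier is a member, so the intersection is over a nonempty family and
    stays inside \<open>A\<close>.\<close>
  have "carrier A \<in> {B. subring B A \<and> (\<forall>z. \<forall>b\<in>B. z \<odot> b \<in> B) \<and> S \<subseteq> B}"
    using assms carrier_is_subring by auto
  then show P: "subring (carrier (generated_subalg A S)) A"
    unfolding generated_subalg_def by (auto intro!: subring_Inter)
  then show sub: "carrier (generated_subalg A S) \<subseteq> carrier A" by (rule subringE)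
  show "S \<subseteq> carrier (generated_subalg A S)" by (auto simp: generated_subalg_def)
  show sm: "z \<odot> a \<in> carrier (generated_subalg A S)" if "a \<in> carrier (generated_subalg A S)" for z a
    using that by (auto simp: generated_subalg_def)
  have eq: "generated_subalg A S = A\<lparr>carrier := P\<rparr>" by (simp add: P_def generated_subalg_def)
  show "complex_algebra (generated_subalg A S)"
    using sub sm unfolding eq
    by (intro complex_algebra.intro complex_algebra_axioms.intro subring_is_ring)
      (use P in \<open>auto simp: P_def[symmetric] smult_add_left smult_smult smult_one intro!: smult_mult_left smult_mult_right dest: subsetD\<close>)
qed

text \<open>The unit goes to the idempotent \<open>\<kappa> 1\<close>. Two such maps occur:
  \<open>at_ring\<close> of the Cherednik algebra itself, and a -> a \<otimes> 1 into its tensor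
  product with the Clifford algebra. Working with a general one verifies the Dunkl relations once
  for both.\<close>

locale algebra_to_ring = A: complex_algebra A + central_scalars \<kappa>
  for A :: "(complex, 'a, 'm) module_scheme" (structure) and \<kappa> :: "complex \<Rightarrow> 't::ring" +
  fixes j :: "'a \<Rightarrow> 't"
  assumes j_add: "a \<in> carrier A \<Longrightarrow> b \<in> carrier A \<Longrightarrow> j (a \<oplus> b) = j a + j b"
    and j_mult: "a \<in> carrier A \<Longrightarrow> b \<in> carrier A \<Longrightarrow> j (a \<otimes> b) = j a * j b"
    and j_smult: "a \<in> carrier A \<Longrightarrow> j (z \<odot> a) = \<kappa> z * j a"
    and j_one: "j \<one> = \<kappa> 1"
begin

lemma j_zero: "j \<zero> = 0"
  using j_add[of \<zero> \<zero>] by simp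

lemma j_minus: "a \<in> carrier A \<Longrightarrow> b \<in> carrier A \<Longrightarrow> j (a \<ominus> b) = j a - j b"
proof -
  assume ab: "a \<in> carrier A" "b \<in> carrier A"
  then have "j a = j ((a \<ominus> b) \<oplus> b)" by (simp add: A.minus_eq A.a_assoc A.l_neg)
  with ab show ?thesis by (simp add: j_add)
qed

lemma j_finsum: "f \<in> B \<rightarrow> carrier A \<Longrightarrow> j (finsum A f B) = (\<Sum>i\<in>B. j (f i))"
  by (induction B rule: infinite_finite_induct) (auto simp: j_add j_zero Pi_def)

lemma unital_j: "a \<in> carrier A \<Longrightarrow> unital (j a)"
  using j_smult[of a 1] by (simp add: unital_def A.smult_one)

end

lemma (in complex_algebra) algebra_to_ring_at_ring: "algebra_to_ring A scalar (at_ring A)"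
  by unfold_locales (simp_all add: at_ring_add at_ring_mult at_ring_smult at_ring_one)

lemma (in tensor_product) algebra_to_ring_tensor:
  "algebra_to_ring A T.scalar (\<lambda>a. at_ring T (tns a \<one>\<^bsub>B\<^esub>))"
  by unfold_locales (simp_all add: T.at_ring_add[symmetric] T.at_ring_mult[symmetric]
      T.at_ring_smult[symmetric] T.at_ring_one[symmetric] tensor_add_left tensor_mult tensor_smult_left tensor_one)

section \<open>Generators and relations of the Clifford algebra\<close>

lemma monoid_words: "Group.monoid (words X)"
  by (rule monoidI) (auto simp: words_def)

lemma presentation_clifford: "presentation (words {1..n}) (clifford_rels n)"
  by (intro presentation.intro presentation_axioms.intro monoid_words)
    (auto simp: clifford_rels_def words_def intro!: monoid_alg_intros)

context
  fixes n :: nat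
begin

interpretation presentation "words {1..n}" "clifford_rels n"
  by (rule presentation_clifford)

lemma complex_algebra_clifford: "complex_algebra (clifford n)"
  unfolding clifford_def by (rule Q.complex_algebra_axioms)

lemma clifford_gen_closed: "i \<in> {1..n} \<Longrightarrow> clifford_gen n i \<in> carrier (clifford n)"
  unfolding clifford_def clifford_gen_def by (rule presented_cls_closed) (simp add: words_def)

lemma clifford_anticommute:
  assumes "i \<in> {1..n}" "j \<in> {1..n}"
  shows "clifford_gen n i \<otimes>\<^bsub>clifford n\<^esub> clifford_gen n j \<oplus>\<^bsub>clifford n\<^esub> clifford_gen n j \<otimes>\<^bsub>clifford n\<^esub> clifford_gen n i
    = (if i = j then 2 else 0) \<odot>\<^bsub>clifford n\<^esub> \<one>\<^bsub>clifford n\<^esub>"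
proof -
  have car: "[k] \<in> carrier (words {1..n})" if "k \<in> {1..n}" for k using that by (simp add: words_def)
  have car2: "[i, j] \<in> carrier (words {1..n})" "[j, i] \<in> carrier (words {1..n})" "[] \<in> carrier (words {1..n})"
    using assms by (simp_all add: words_def)
  have "cls (Poly_Mapping.single [i, j] 1 + Poly_Mapping.single [j, i] 1)
    = cls (Poly_Mapping.single [] (if i = j then 2 else 0))"
  proof (rule rel_eq)
    show "Poly_Mapping.single [i, j] 1 + Poly_Mapping.single [j, i] 1
        - Poly_Mapping.single [] (if i = j then 2 else 0) \<in> clifford_rels n"
      using assms unfolding clifford_rels_def by blast
  qed (intro monoid_alg_intros car2)+
  then have "presented_cls (words {1..n}) (clifford_rels n) [i, j] \<oplus>\<^bsub>Q\<^esub> presented_cls (words {1..n}) (clifford_rels n) [j, i]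
    = (if i = j then 2 else 0) \<odot>\<^bsub>Q\<^esub> presented_cls (words {1..n}) (clifford_rels n) []"
    using car2 by (simp add: cls_add cls_single single_in_monoid_alg Q.smult_one del: One_nat_def)
  moreover have "presented_cls (words {1..n}) (clifford_rels n) [k, l]
      = clifford_gen n k \<otimes>\<^bsub>Q\<^esub> clifford_gen n l" if "k \<in> {1..n}" "l \<in> {1..n}" for k l
    using presented_cls_mult[OF car car, OF that] by (simp add: clifford_gen_def words_def)
  moreover have "presented_cls (words {1..n}) (clifford_rels n) [] = \<one>\<^bsub>Q\<^esub>"
    using presented_cls_one by (simp add: words_def)
  ultimately show ?thesis using assms by (simp add: clifford_def)
qed

end

section \<open>Roots, coroots and reflections\<close>

lemma riesz_inner: "riesz \<alpha> \<bullet> v = blinfun_apply \<alpha> v"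
proof -
  have "blinfun_apply \<alpha> v = blinfun_apply \<alpha> (\<Sum>b\<in>Basis. (v \<bullet> b) *\<^sub>R b)"
    by (simp add: euclidean_representation)
  also have "\<dots> = (\<Sum>b\<in>Basis. (v \<bullet> b) * blinfun_apply \<alpha> b)"
    by (simp only: blinfun.sum_right blinfun.scaleR_right real_scaleR_def)
  finally show ?thesis by (simp add: riesz_def inner_commute[of _ v] inner_sum_right mult.commute)
qed

lemma riesz_nonzero: "\<alpha> \<noteq> 0 \<Longrightarrow> riesz \<alpha> \<noteq> 0"
  using riesz_inner[of \<alpha>] by (auto intro!: blinfun_eqI)

lemma root_coroot: "\<alpha> \<noteq> 0 \<Longrightarrow> blinfun_apply \<alpha> (coroot \<alpha>) = 2"
  using riesz_nonzero[of \<alpha>] by (simp add: coroot_def blinfun.scaleR_right riesz_inner[symmetric])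

lemma linear_reflection: "linear (reflection \<alpha>)"
  by (intro linearI) (auto simp: reflection_def blinfun.add_right blinfun.scaleR_right algebra_simps)

lemma reflection_involution: "\<alpha> \<noteq> 0 \<Longrightarrow> reflection \<alpha> (reflection \<alpha> v) = v"
  by (simp add: reflection_def blinfun.diff_right blinfun.scaleR_right root_coroot algebra_simps)

lemma bij_reflection: "\<alpha> \<noteq> 0 \<Longrightarrow> bij (reflection \<alpha>)"
  by (rule involuntory_imp_bij) (rule reflection_involution)

lemma inv_reflection: "\<alpha> \<noteq> 0 \<Longrightarrow> inv_into UNIV (reflection \<alpha>) = reflection \<alpha>"
  by (rule inv_equality) (simp_all add: reflection_involution)

text \<open>\<open>Blinfun\<close> is specified on bounded linear functions only, so the inverse of
  \<open>w\<close> is first shown to be linear; boundedness is then automatic in finite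
  dimension.\<close>

lemma act_dual_apply:
  assumes "linear w" "bij w"
  shows "blinfun_apply (act_dual w f) v = blinfun_apply f (inv_into UNIV w v)"
proof -
  have "linear (inv_into UNIV w)" 
  proof (intro linearI)
    have inv: "inv_into UNIV w (w v) = v" "w (inv_into UNIV w v) = v" for v
      using \<open>bij w\<close> by (simp_all add: bij_is_inj surj_f_inv_f bij_is_surj)
    fix u v and r :: real
    show "inv_into UNIV w (u + v) = inv_into UNIV w u + inv_into UNIV w v"
      using inv(1)[of "inv_into UNIV w u + inv_into UNIV w v"] by (simp add: linear_add[OF \<open>linear w\<close>] inv(2))
    show "inv_into UNIV w (r *\<^sub>R v) = r *\<^sub>R inv_into UNIV w v"
      using inv(1)[of "r *\<^sub>R inv_into UNIV w v"] by (simp add: linear_scale[OF \<open>linear w\<close>] inv(2))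
  qed
  then have "bounded_linear (\<lambda>v. blinfun_apply f (inv_into UNIV w v))"
    by (intro bounded_linear_compose[OF blinfun.bounded_linear_right] linear_conv_bounded_linear[THEN iffD1])
  then show ?thesis by (simp add: act_dual_def bounded_linear_Blinfun_apply)
qed

text \<open>A reflection is its own inverse. The sum with a negated scalar is the shape in which
  \<open>ch_x_add\<close> and \<open>ch_x_scale\<close> apply.\<close>

lemma act_dual_reflection:
  assumes "\<alpha> \<noteq> 0"
  shows "act_dual (reflection \<alpha>) f = f + (- blinfun_apply f (coroot \<alpha>)) *\<^sub>R \<alpha>"
  using assms by (intro blinfun_eqI)
    (simp add: act_dual_apply linear_reflection bij_reflection inv_reflection reflection_def
      blinfun.add_left blinfun.diff_left blinfun.scaleR_left blinfun.diff_right blinfun.scaleR_right)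

lemma act_dual_comp:
  assumes "linear w" "bij w" "linear w'" "bij w'"
  shows "act_dual (w \<circ> w') f = act_dual w (act_dual w' f)"
  using assms
  by (intro blinfun_eqI) (simp add: act_dual_apply linear_compose bij_comp o_inv_distrib)

lemma act_dual_zero: "linear w \<Longrightarrow> bij w \<Longrightarrow> act_dual w 0 = 0"
  by (intro blinfun_eqI) (simp add: act_dual_apply)

section \<open>Generators and relations of the rational Cherednik algebra\<close>

locale cherednik_data =
  fixes R Rp :: "'e::euclidean_space dual set" and c :: "'e dual \<Rightarrow> complex"
  assumes root_system: "root_system R" and Rp: "Rp \<subseteq> R"
begin

lemma finite_Rp: "finite Rp"
  using root_system Rp finite_subset by (auto simp: root_system_def)

lemma root_nonzero: "\<alpha> \<in> R \<Longrightarrow> \<alpha> \<noteq> 0"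
  using root_system by (auto simp: root_system_def)

lemma reflection_group_linear_bij: "w \<in> reflection_group R \<Longrightarrow> linear w \<and> bij w"
proof (induction rule: reflection_group.induct)
  case id
  then show ?case using linear_id bij_id by blast
next
  case (step \<alpha> w)
  then show ?case
    using linear_compose[OF _ linear_reflection] bij_comp[OF _ bij_reflection] root_nonzero by blast
qed

lemma reflection_group_comp:
  "w \<in> reflection_group R \<Longrightarrow> w' \<in> reflection_group R \<Longrightarrow> w \<circ> w' \<in> reflection_group R"
  by (induction rule: reflection_group.induct) (auto simp: comp_assoc intro: reflection_group.intros)

lemma reflection_in_group: "\<alpha> \<in> R \<Longrightarrow> reflection \<alpha> \<in> reflection_group R"
  using reflection_group.step[OF _ reflection_group.id, of \<alpha>] by simp

lemma hh_act_comp: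
  "w \<in> reflection_group R \<Longrightarrow> w' \<in> reflection_group R \<Longrightarrow> hh_act (w \<circ> w') v = hh_act w (hh_act w' v)"
  by (simp add: hh_act_def act_dual_comp reflection_group_linear_bij map_prod_def split_beta)

lemma hh_act_id: "hh_act id v = v" for v :: "'e hh"
proof -
  have "act_dual id f = f" for f :: "'e dual"
    by (intro blinfun_eqI) (simp add: act_dual_apply linear_id)
  then show ?thesis by (simp add: hh_act_def map_prod_def split_beta)
qed

abbreviation "SM \<equiv> smash_monoid R"
abbreviation "SR \<equiv> smash_rels \<union> cherednik_rels Rp c"

text \<open>Associativity comes down to \<open>hh_act\<close> being an action of the reflection
  group on the letters.\<close>

lemma monoid_SM: "Group.monoid SM"
  by (rule monoidI)
    (auto simp: smash_monoid_def reflection_group.id reflection_group_comp comp_assoc hh_act_comp hh_act_id map_idI)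

sublocale presentation SM SR
proof (intro presentation.intro presentation_axioms.intro monoid_SM)
  have "(u, id) \<in> carrier SM" "\<alpha> \<in> Rp \<Longrightarrow> (u, reflection \<alpha>) \<in> carrier SM" for u \<alpha>
    using Rp by (auto simp: smash_monoid_def reflection_group.id reflection_in_group)
  then show "SR \<subseteq> carrier (monoid_alg SM)"
    by (auto simp: smash_rels_def cherednik_rels_def intro!: monoid_alg_intros)
qed

abbreviation "HH \<equiv> cherednik R Rp c"

lemma HH_eq: "HH = Q"
  by (simp add: cherednik_def)

sublocale HH: complex_algebra HH
  unfolding HH_eq by (rule Q.complex_algebra_axioms)

lemma ch_cls_eq: "ch_cls R Rp c g = cls (Poly_Mapping.single g 1)"
  by (simp add: ch_cls_def presented_cls_def cls_def)

lemma in_SM: "(u, w) \<in> carrier SM \<longleftrightarrow> w \<in> reflection_group R"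
  by (simp add: smash_monoid_def)

lemma ch_cls_closed [simp]: "w \<in> reflection_group R \<Longrightarrow> ch_cls R Rp c (u, w) \<in> carrier HH"
  by (simp add: ch_cls_eq HH_eq single_in_monoid_alg in_SM)

lemma ch_closed [simp]:
  "ch_x R Rp c f \<in> carrier HH" "ch_y R Rp c v \<in> carrier HH"
  "w \<in> reflection_group R \<Longrightarrow> ch_w R Rp c w \<in> carrier HH"
  by (simp_all add: ch_x_def ch_y_def ch_w_def reflection_group.id)

lemma ch_cls_mult:
  "w \<in> reflection_group R \<Longrightarrow> w' \<in> reflection_group R \<Longrightarrow>
   ch_cls R Rp c (u, w) \<otimes>\<^bsub>HH\<^esub> ch_cls R Rp c (u', w') = ch_cls R Rp c (u @ map (hh_act w) u', w \<circ> w')"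
  using presented_cls_mult[of "(u, w)" "(u', w')"]
  by (simp add: in_SM ch_cls_def HH_eq) (simp add: smash_monoid_def)

lemma ch_letter_add: "ch_cls R Rp c ([v + v'], id) = ch_cls R Rp c ([v], id) \<oplus>\<^bsub>HH\<^esub> ch_cls R Rp c ([v'], id)"
proof -
  have "cls (Poly_Mapping.single ([v + v'], id) 1)
      = cls (Poly_Mapping.single ([v], id) 1 + Poly_Mapping.single ([v'], id) 1)"
  proof (rule rel_eq)
    show "Poly_Mapping.single ([v + v'], id) 1 - (Poly_Mapping.single ([v], id) 1 + Poly_Mapping.single ([v'], id) 1) \<in> SR"
      unfolding smash_rels_def diff_diff_eq[symmetric] by blast
  qed (auto simp: in_SM reflection_group.id intro!: monoid_alg_intros)
  then show ?thesis
    by (simp add: ch_cls_eq HH_eq cls_add single_in_monoid_alg in_SM reflection_group.id)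
qed

lemma ch_letter_scale: "ch_cls R Rp c ([hh_scale z v], id) = z \<odot>\<^bsub>HH\<^esub> ch_cls R Rp c ([v], id)"
proof -
  have "cls (Poly_Mapping.single ([hh_scale z v], id) 1) = cls (Poly_Mapping.single ([v], id) z)"
  proof (rule rel_eq)
    show "Poly_Mapping.single ([hh_scale z v], id) 1 - Poly_Mapping.single ([v], id) z \<in> SR"
      unfolding smash_rels_def by blast
  qed (auto simp: in_SM reflection_group.id intro!: monoid_alg_intros)
  also have "\<dots> = z \<odot>\<^bsub>HH\<^esub> ch_cls R Rp c ([v], id)"
    by (simp add: cls_single in_SM reflection_group.id ch_cls_def HH_eq)
  finally show ?thesis by (simp only: ch_cls_eq)
qed

lemma ch_x_add: "ch_x R Rp c (f + g) = ch_x R Rp c f \<oplus>\<^bsub>HH\<^esub> ch_x R Rp c g"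
  using ch_letter_add[of "((f, 0), 0)" "((g, 0), 0)"] by (simp add: ch_x_def)

lemma ch_y_add: "ch_y R Rp c (u + v) = ch_y R Rp c u \<oplus>\<^bsub>HH\<^esub> ch_y R Rp c v"
  using ch_letter_add[of "(0, (u, 0))" "(0, (v, 0))"] by (simp add: ch_y_def)

lemma ch_x_scale: "ch_x R Rp c (t *\<^sub>R f) = of_real t \<odot>\<^bsub>HH\<^esub> ch_x R Rp c f"
  using ch_letter_scale[of "of_real t" "((f, 0), 0)"] by (simp add: ch_x_def hh_scale_def cscale_def zero_prod_def)

lemma ch_y_scale: "ch_y R Rp c (t *\<^sub>R v) = of_real t \<odot>\<^bsub>HH\<^esub> ch_y R Rp c v"
  using ch_letter_scale[of "of_real t" "(0, (v, 0))"] by (simp add: ch_y_def hh_scale_def cscale_def zero_prod_def)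

lemma ch_x_zero: "ch_x R Rp c 0 = \<zero>\<^bsub>HH\<^esub>"
  using ch_x_scale[of 0 0] by (simp add: HH.smult_zero_left)

lemma ch_y_zero: "ch_y R Rp c 0 = \<zero>\<^bsub>HH\<^esub>"
  using ch_y_scale[of 0 0] by (simp add: HH.smult_zero_left)

lemma ch_xx: "ch_x R Rp c f \<otimes>\<^bsub>HH\<^esub> ch_x R Rp c g = ch_x R Rp c g \<otimes>\<^bsub>HH\<^esub> ch_x R Rp c f"
proof -
  have "cls (Poly_Mapping.single ([((f, 0), 0), ((g, 0), 0)], id) 1)
    = cls (Poly_Mapping.single ([((g, 0), 0), ((f, 0), 0)], id) 1)"
    by (intro rel_eq monoid_alg_intros)
      (auto simp: cherednik_rels_def in_SM reflection_group.id intro!: exI)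
  then show ?thesis
    by (simp add: ch_x_def ch_cls_mult reflection_group.id hh_act_id) (simp add: ch_cls_eq)
qed

lemma ch_yy: "ch_y R Rp c u \<otimes>\<^bsub>HH\<^esub> ch_y R Rp c v = ch_y R Rp c v \<otimes>\<^bsub>HH\<^esub> ch_y R Rp c u"
proof -
  have "cls (Poly_Mapping.single ([(0, (u, 0)), (0, (v, 0))], id) 1)
    = cls (Poly_Mapping.single ([(0, (v, 0)), (0, (u, 0))], id) 1)"
    by (intro rel_eq monoid_alg_intros)
      (auto simp: cherednik_rels_def in_SM reflection_group.id intro!: exI)
  then show ?thesis
    by (simp add: ch_y_def ch_cls_mult reflection_group.id hh_act_id) (simp add: ch_cls_eq)
qed

lemma cpair_real: "cpair (f, 0) (v, 0) = of_real (blinfun_apply f v)"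
  by (simp add: cpair_def complex_eq_iff)

lemma ch_one: "ch_cls R Rp c ([], id) = \<one>\<^bsub>HH\<^esub>"
  using presented_cls_one by (simp add: ch_cls_def HH_eq smash_monoid_def)

lemma ch_yx:
  "ch_y R Rp c v \<otimes>\<^bsub>HH\<^esub> ch_x R Rp c f = ch_x R Rp c f \<otimes>\<^bsub>HH\<^esub> ch_y R Rp c v
    \<oplus>\<^bsub>HH\<^esub> (of_real (blinfun_apply f v) \<odot>\<^bsub>HH\<^esub> \<one>\<^bsub>HH\<^esub> \<oplus>\<^bsub>HH\<^esub> (\<Oplus>\<^bsub>HH\<^esub>\<alpha>\<in>Rp.
      (c \<alpha> * of_real (blinfun_apply \<alpha> v) * of_real (blinfun_apply f (coroot \<alpha>))) \<odot>\<^bsub>HH\<^esub> ch_w R Rp c (reflection \<alpha>)))"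
proof -
  have car: "(u, id) \<in> carrier SM" "\<alpha> \<in> Rp \<Longrightarrow> (u, reflection \<alpha>) \<in> carrier SM" for u \<alpha>
    using Rp by (auto simp: in_SM reflection_group.id reflection_in_group)
  let ?g = "\<lambda>\<alpha>. Poly_Mapping.single ([], reflection \<alpha>) (c \<alpha> * cpair (\<alpha>, 0) (v, 0) * cpair (f, 0) (coroot \<alpha>, 0))"
  have "cls (Poly_Mapping.single ([(0, (v, 0)), ((f, 0), 0)], id) 1)
    = cls (Poly_Mapping.single ([((f, 0), 0), (0, (v, 0))], id) 1
         + (Poly_Mapping.single ([], id) (cpair (f, 0) (v, 0)) + (\<Sum>\<alpha>\<in>Rp. ?g \<alpha>)))"
    using car by (intro rel_eq monoid_alg_intros) (auto simp: cherednik_rels_def diff_diff_eq intro!: exI)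
  also have "\<dots> = cls (Poly_Mapping.single ([((f, 0), 0), (0, (v, 0))], id) 1) \<oplus>\<^bsub>HH\<^esub>
      (cls (Poly_Mapping.single ([], id) (cpair (f, 0) (v, 0))) \<oplus>\<^bsub>HH\<^esub> (\<Oplus>\<^bsub>HH\<^esub>\<alpha>\<in>Rp. cls (?g \<alpha>)))"
    unfolding HH_eq using car by (simp add: cls_add cls_sum monoid_alg_intros)
  also have "cls (Poly_Mapping.single ([], id) (cpair (f, 0) (v, 0))) = of_real (blinfun_apply f v) \<odot>\<^bsub>HH\<^esub> \<one>\<^bsub>HH\<^esub>"
    using car by (simp add: cls_single cpair_real HH_eq[symmetric] ch_one[symmetric] ch_cls_def)
  also have "(\<Oplus>\<^bsub>HH\<^esub>\<alpha>\<in>Rp. cls (?g \<alpha>)) = (\<Oplus>\<^bsub>HH\<^esub>\<alpha>\<in>Rp.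
      (c \<alpha> * of_real (blinfun_apply \<alpha> v) * of_real (blinfun_apply f (coroot \<alpha>))) \<odot>\<^bsub>HH\<^esub> ch_w R Rp c (reflection \<alpha>))"
    using car Rp
    by (intro HH.finsum_cong')
      (auto simp: cls_single cpair_real HH_eq[symmetric] ch_w_def ch_cls_def[symmetric] reflection_in_group)
  also have "cls (Poly_Mapping.single ([(0, (v, 0)), ((f, 0), 0)], id) 1) = ch_y R Rp c v \<otimes>\<^bsub>HH\<^esub> ch_x R Rp c f"
    by (simp add: ch_x_def ch_y_def ch_cls_mult reflection_group.id hh_act_id) (simp add: ch_cls_eq)
  also have "cls (Poly_Mapping.single ([((f, 0), 0), (0, (v, 0))], id) 1) = ch_x R Rp c f \<otimes>\<^bsub>HH\<^esub> ch_y R Rp c v"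
    by (simp add: ch_x_def ch_y_def ch_cls_mult reflection_group.id hh_act_id) (simp add: ch_cls_eq)
  finally show ?thesis .
qed

lemma ch_wx:
  assumes "w \<in> reflection_group R"
  shows "ch_w R Rp c w \<otimes>\<^bsub>HH\<^esub> ch_x R Rp c f = ch_x R Rp c (act_dual w f) \<otimes>\<^bsub>HH\<^esub> ch_w R Rp c w"
proof -
  have "hh_act w ((f, 0), 0) = ((act_dual w f, 0), 0)"
    using reflection_group_linear_bij[OF assms] by (auto simp: hh_act_def act_dual_zero linear_0 zero_prod_def)
  with assms show ?thesis by (simp add: ch_w_def ch_x_def ch_cls_mult reflection_group.id)
qed

lemma ch_wy:
  assumes "w \<in> reflection_group R"
  shows "ch_w R Rp c w \<otimes>\<^bsub>HH\<^esub> ch_y R Rp c v = ch_y R Rp c (w v) \<otimes>\<^bsub>HH\<^esub> ch_w R Rp c w"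
proof -
  have "hh_act w (0, (v, 0)) = (0, (w v, 0))"
    using reflection_group_linear_bij[OF assms] by (auto simp: hh_act_def act_dual_zero linear_0 zero_prod_def)
  with assms show ?thesis by (simp add: ch_w_def ch_y_def ch_cls_mult reflection_group.id)
qed

lemma ch_x_sum: "ch_x R Rp c (sum f A) = (\<Oplus>\<^bsub>HH\<^esub>i\<in>A. ch_x R Rp c (f i))"
  by (induction A rule: infinite_finite_induct) (simp_all add: ch_x_zero ch_x_add)

lemma ch_y_sum: "ch_y R Rp c (sum f A) = (\<Oplus>\<^bsub>HH\<^esub>i\<in>A. ch_y R Rp c (f i))"
  by (induction A rule: infinite_finite_induct) (simp_all add: ch_y_zero ch_y_add)

end

section \<open>The Dirac element\<close>

declare One_nat_def [simp del]

locale cherednik_basis = cherednik_data R Rp c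
  for R Rp :: "'e::euclidean_space dual set" and c :: "'e dual \<Rightarrow> complex" +
  fixes y :: "nat \<Rightarrow> 'e" and x :: "nat \<Rightarrow> 'e dual"
  assumes orthonormal: "orthonormal_basis y" and dual: "dual_basis y x"
begin

abbreviation "X i \<equiv> ch_x R Rp c (x i)"
abbreviation "Y i \<equiv> ch_y R Rp c (y i)"

text \<open>Orthonormal vectors are independent, and there are as many of them as the
  dimension.\<close>

lemma span_basis: "span (y ` {1..DIM('e)}) = UNIV"
proof -
  have inner: "y i \<bullet> y j = (if i = j then 1 else 0)" if "i \<in> {1..DIM('e)}" "j \<in> {1..DIM('e)}" for i j
    using orthonormal that by (auto simp: orthonormal_basis_def)
  have inj: "inj_on y {1..DIM('e)}"
  proof (rule inj_onI)
    fix i j assume ij: "i \<in> {1..DIM('e)}" "j \<in> {1..DIM('e)}" "y i = y j"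
    show "i = j" using inner[of i j] inner[of i i] ij by (auto split: if_splits)
  qed
  have "0 \<notin> y ` {1..DIM('e)}"
  proof
    assume "0 \<in> y ` {1..DIM('e)}"
    then obtain i where "i \<in> {1..DIM('e)}" "y i = 0" by auto
    with inner[of i i] show False by simp
  qed
  moreover have "pairwise orthogonal (y ` {1..DIM('e)})"
    unfolding pairwise_def orthogonal_def
  proof (intro ballI impI)
    fix u v assume "u \<in> y ` {1..DIM('e)}" "v \<in> y ` {1..DIM('e)}" "u \<noteq> v"
    then obtain i j where "u = y i" "v = y j" "i \<in> {1..DIM('e)}" "j \<in> {1..DIM('e)}" "i \<noteq> j" by blast
    with inner[of i j] show "u \<bullet> v = 0" by simp
  qed
  ultimately have "independent (y ` {1..DIM('e)})"
    by (intro pairwise_orthogonal_independent)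
  then have "UNIV \<subseteq> span (y ` {1..DIM('e)})"
    using inj by (intro card_ge_dim_independent) (auto simp: card_image)
  then show ?thesis by auto
qed

lemma basis_expansion: "(\<Sum>i\<in>{1..DIM('e)}. blinfun_apply (x i) v *\<^sub>R y i) = v"
proof -
  have lin: "linear (\<lambda>v. \<Sum>i\<in>{1..DIM('e)}. blinfun_apply (x i) v *\<^sub>R y i)"
    by (intro linearI) (simp_all add: blinfun.add_right blinfun.scaleR_right scaleR_add_left sum.distrib scaleR_sum_right)
  have basis: "(\<Sum>i\<in>{1..DIM('e)}. blinfun_apply (x i) v *\<^sub>R y i) = v" if "v \<in> y ` {1..DIM('e)}" for v
  proof -
    from that obtain j where j: "j \<in> {1..DIM('e)}" "v = y j" by auto
    then have "(\<Sum>i\<in>{1..DIM('e)}. blinfun_apply (x i) v *\<^sub>R y i) = (\<Sum>i\<in>{1..DIM('e)}. if i = j then y i else 0)"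
      using dual by (intro sum.cong) (auto simp: dual_basis_def)
    with j show ?thesis by simp
  qed
  show ?thesis
    by (rule linear_eq_on_span[OF lin linear_ident basis, of "y ` {1..DIM('e)}"]) (simp_all only: span_basis UNIV_I)
qed

text \<open>The inner product carries an orthonormal basis to its dual basis. This is what makes
  \<open>coef_b\<close> a multiple of \<open>coef_a\<close>.\<close>

lemma x_eq_inner: "i \<in> {1..DIM('e)} \<Longrightarrow> blinfun_apply (x i) v = v \<bullet> y i"
proof -
  assume i: "i \<in> {1..DIM('e)}"
  have "v \<bullet> y i = (\<Sum>j\<in>{1..DIM('e)}. blinfun_apply (x j) v *\<^sub>R y j) \<bullet> y i"
    by (simp only: basis_expansion)
  also have "\<dots> = (\<Sum>j\<in>{1..DIM('e)}. blinfun_apply (x j) v * (y j \<bullet> y i))"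
    by (simp only: inner_sum_left inner_scaleR_left)
  also have "\<dots> = (\<Sum>j\<in>{1..DIM('e)}. if j = i then blinfun_apply (x j) v else 0)"
    using orthonormal i by (intro sum.cong) (auto simp: orthonormal_basis_def)
  finally show ?thesis using i by simp
qed

lemma dual_basis_expansion: "(\<Sum>i\<in>{1..DIM('e)}. blinfun_apply f (y i) *\<^sub>R x i) = f"
proof (rule blinfun_eqI)
  fix v
  have "blinfun_apply f v = blinfun_apply f (\<Sum>i\<in>{1..DIM('e)}. blinfun_apply (x i) v *\<^sub>R y i)"
    by (simp only: basis_expansion)
  also have "\<dots> = (\<Sum>i\<in>{1..DIM('e)}. blinfun_apply (x i) v * blinfun_apply f (y i))"
    by (simp only: blinfun.sum_right blinfun.scaleR_right real_scaleR_def)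
  finally show "blinfun_apply (\<Sum>i\<in>{1..DIM('e)}. blinfun_apply f (y i) *\<^sub>R x i) v = blinfun_apply f v"
    by (simp add: blinfun.sum_left blinfun.scaleR_left mult.commute)
qed

text \<open>These are the parameters for \<open>dunkl_relations\<close>; \<open>coef_t\<close> is
  the factor between \<open>coroot\<close> and \<open>riesz\<close>.\<close>

definition coef_a :: "'e dual \<Rightarrow> nat \<Rightarrow> complex" where
  "coef_a \<alpha> i = of_real (blinfun_apply \<alpha> (y i))"
definition coef_b :: "'e dual \<Rightarrow> nat \<Rightarrow> complex" where
  "coef_b \<alpha> i = of_real (blinfun_apply (x i) (coroot \<alpha>))"
definition coef_t :: "'e dual \<Rightarrow> complex" where
  "coef_t \<alpha> = of_real (2 / (riesz \<alpha> \<bullet> riesz \<alpha>))"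
definition coef_d :: "nat \<Rightarrow> nat \<Rightarrow> complex" where
  "coef_d i j = of_real (blinfun_apply (x i) (y j))"

abbreviation "D_alg \<equiv> ang_alg R Rp c y x"
abbreviation "M i j \<equiv> ang_M R Rp c y x i j"

lemma M_eq: "M i j = X i \<otimes>\<^bsub>HH\<^esub> Y j \<ominus>\<^bsub>HH\<^esub> X j \<otimes>\<^bsub>HH\<^esub> Y i"
  by (simp add: ang_M_def Let_def)

lemma refl_in: "\<alpha> \<in> Rp \<Longrightarrow> reflection \<alpha> \<in> reflection_group R"
  using Rp by (auto intro: reflection_in_group)

lemma elements_closed [simp]:
  "M i j \<in> carrier HH" "ang_Z R Rp c \<in> carrier HH" "ang_phi R Rp c \<in> carrier HH"
  "sl2_H R Rp c y x \<in> carrier HH" "sl2_X R Rp c x \<in> carrier HH" "sl2_Y R Rp c y \<in> carrier HH"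
  "sl2_casimir R Rp c y x \<in> carrier HH"
proof -
  show Z: "ang_Z R Rp c \<in> carrier HH"
    by (auto simp: ang_Z_def Let_def refl_in intro!: HH.finsum_closed)
  show "M i j \<in> carrier HH" by (simp add: M_eq)
  show "ang_phi R Rp c \<in> carrier HH" using Z by (simp add: ang_phi_def Let_def)
  show H: "sl2_H R Rp c y x \<in> carrier HH" "sl2_X R Rp c x \<in> carrier HH" "sl2_Y R Rp c y \<in> carrier HH"
    by (auto simp: sl2_H_def sl2_X_def sl2_Y_def Let_def intro!: HH.finsum_closed HH.smult_closed)
  then show "sl2_casimir R Rp c y x \<in> carrier HH"
    by (simp add: sl2_casimir_def Let_def)
qed

section \<open>Images of the Cherednik algebra in a ring\<close>

context
  fixes \<kappa> :: "complex \<Rightarrow> 't::ring" and j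
  assumes j: "algebra_to_ring HH \<kappa> j"
begin

interpretation j: algebra_to_ring HH \<kappa> j by (rule j)

text \<open>Zero outside \<open>Rp\<close>, because unitality and commutation with the Clifford
  generators are demanded at every index, whereas the reflection in an arbitrary functional need not
  lie in the group.\<close>

definition refl_image :: "'e dual \<Rightarrow> 't" where
  "refl_image \<alpha> = (if \<alpha> \<in> Rp then j (ch_w R Rp c (reflection \<alpha>)) else 0)"

lemma dunkl_relations_image:
  "dunkl_relations \<kappa> {1..DIM('e)} Rp (\<lambda>i. j (X i)) (\<lambda>i. j (Y i)) refl_image
    (\<lambda>\<alpha>. j (ch_x R Rp c \<alpha>)) (\<lambda>\<alpha>. j (ch_y R Rp c (coroot \<alpha>))) c coef_t coef_a coef_b coef_d"
proof unfold_locales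
  fix i k \<alpha>
  show "finite {1..DIM('e)}" "finite Rp" by (simp_all add: finite_Rp)
  show "j.unital (j (X i))" "j.unital (j (Y i))" "j.unital (refl_image \<alpha>)"
    by (simp_all add: j.unital_j refl_image_def refl_in j.unital_0)
  show "j (X i) * j (X k) = j (X k) * j (X i)" "j (Y i) * j (Y k) = j (Y k) * j (Y i)"
    by (simp_all add: j.j_mult[symmetric] ch_xx[of "x i" "x k"] ch_yy[of "y i" "y k"])
  have "j (Y k) * j (X i) = j (Y k \<otimes>\<^bsub>HH\<^esub> X i)" by (simp add: j.j_mult)
  also have "\<dots> = j (X i) * j (Y k) + \<kappa> (coef_d i k) * \<kappa> 1
      + (\<Sum>\<alpha>\<in>Rp. \<kappa> (c \<alpha> * coef_a \<alpha> k * coef_b \<alpha> i) * j (ch_w R Rp c (reflection \<alpha>)))"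
    unfolding ch_yx
    by (subst j.j_add j.j_finsum j.j_smult j.j_mult | auto simp: refl_in j.j_one coef_a_def coef_b_def coef_d_def j.j_smult add.assoc intro!: HH.finsum_closed)+
  finally show "j (Y k) * j (X i) = j (X i) * j (Y k) + \<kappa> (coef_d i k)
      + (\<Sum>\<alpha>\<in>Rp. \<kappa> (c \<alpha> * coef_a \<alpha> k * coef_b \<alpha> i) * refl_image \<alpha>)"
    by (simp add: j.\<kappa>_mult[symmetric] refl_image_def)
  show "i \<in> {1..DIM('e)} \<Longrightarrow> k \<in> {1..DIM('e)} \<Longrightarrow> coef_d i k = (if i = k then 1 else 0)"
    using dual by (auto simp: dual_basis_def coef_d_def)
  assume \<alpha>: "\<alpha> \<in> Rp"
  then have nz: "\<alpha> \<noteq> 0" using Rp root_nonzero by auto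
  have "refl_image \<alpha> * j (X i) = j (ch_w R Rp c (reflection \<alpha>) \<otimes>\<^bsub>HH\<^esub> X i)"
    using \<alpha> by (simp add: refl_image_def j.j_mult refl_in)
  also have "\<dots> = (j (X i) + \<kappa> (- coef_b \<alpha> i) * j (ch_x R Rp c \<alpha>)) * refl_image \<alpha>"
    using \<alpha> nz
    by (simp add: refl_image_def ch_wx refl_in j.j_mult act_dual_reflection ch_x_add ch_x_scale j.j_add j.j_smult coef_b_def
        del: scaleR_minus_left)
  finally show "refl_image \<alpha> * j (X i) = (j (X i) - \<kappa> (coef_b \<alpha> i) * j (ch_x R Rp c \<alpha>)) * refl_image \<alpha>"
    by (simp add: j.\<kappa>_minus)
  have "refl_image \<alpha> * j (Y i) = j (ch_w R Rp c (reflection \<alpha>) \<otimes>\<^bsub>HH\<^esub> Y i)"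
    using \<alpha> by (simp add: refl_image_def j.j_mult refl_in)
  also have "\<dots> = j (ch_y R Rp c (y i + (- blinfun_apply \<alpha> (y i)) *\<^sub>R coroot \<alpha>)) * refl_image \<alpha>"
    using \<alpha> by (simp add: refl_image_def ch_wy refl_in j.j_mult reflection_def)
  also have "\<dots> = (j (Y i) + \<kappa> (- coef_a \<alpha> i) * j (ch_y R Rp c (coroot \<alpha>))) * refl_image \<alpha>"
    by (simp add: ch_y_add ch_y_scale j.j_add j.j_smult coef_a_def del: scaleR_minus_left)
  finally show "refl_image \<alpha> * j (Y i) = (j (Y i) - \<kappa> (coef_a \<alpha> i) * j (ch_y R Rp c (coroot \<alpha>))) * refl_image \<alpha>"
    by (simp add: j.\<kappa>_minus)
  have "j (ch_x R Rp c \<alpha>) = j (ch_x R Rp c (\<Sum>i\<in>{1..DIM('e)}. blinfun_apply \<alpha> (y i) *\<^sub>R x i))"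
    by (simp only: dual_basis_expansion)
  then show "j (ch_x R Rp c \<alpha>) = (\<Sum>i\<in>{1..DIM('e)}. \<kappa> (coef_a \<alpha> i) * j (X i))"
    by (simp add: ch_x_sum ch_x_scale j.j_finsum j.j_smult coef_a_def)
  have "j (ch_y R Rp c (coroot \<alpha>)) = j (ch_y R Rp c (\<Sum>i\<in>{1..DIM('e)}. blinfun_apply (x i) (coroot \<alpha>) *\<^sub>R y i))"
    by (simp only: basis_expansion)
  then show "j (ch_y R Rp c (coroot \<alpha>)) = (\<Sum>i\<in>{1..DIM('e)}. \<kappa> (coef_b \<alpha> i) * j (Y i))"
    by (simp add: ch_y_sum ch_y_scale j.j_finsum j.j_smult coef_b_def)
  show "coef_b \<alpha> i = coef_t \<alpha> * coef_a \<alpha> i" if "i \<in> {1..DIM('e)}"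
    using that by (simp add: coef_b_def coef_t_def coef_a_def x_eq_inner coroot_def riesz_inner)
  \<comment> \<open>The value of the root on its coroot, with the coroot expanded in the
    basis.\<close>
  have "2 = blinfun_apply \<alpha> (\<Sum>i\<in>{1..DIM('e)}. blinfun_apply (x i) (coroot \<alpha>) *\<^sub>R y i)"
    by (simp only: basis_expansion root_coroot[OF nz])
  also have "\<dots> = (\<Sum>i\<in>{1..DIM('e)}. blinfun_apply \<alpha> (y i) * blinfun_apply (x i) (coroot \<alpha>))"
    by (simp add: blinfun.sum_right blinfun.scaleR_right mult.commute)
  finally have "(\<Sum>i\<in>{1..DIM('e)}. coef_a \<alpha> i * coef_b \<alpha> i) = of_real 2"
    by (simp add: coef_a_def coef_b_def flip: of_real_mult of_real_sum)
  then show "(\<Sum>i\<in>{1..DIM('e)}. coef_a \<alpha> i * coef_b \<alpha> i) = 2" by simp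
qed

interpretation dr: dunkl_relations \<kappa> "{1..DIM('e)}" Rp "\<lambda>i. j (X i)" "\<lambda>i. j (Y i)" refl_image
    "\<lambda>\<alpha>. j (ch_x R Rp c \<alpha>)" "\<lambda>\<alpha>. j (ch_y R Rp c (coroot \<alpha>))" c coef_t coef_a coef_b coef_d
  by (rule dunkl_relations_image)

lemma j_M: "j (M i k) = dr.M i k"
  by (simp add: M_eq dr.M_def j.j_minus j.j_mult)

lemma j_phi: "j (ang_phi R Rp c) = dr.\<phi>"
proof -
  have "j (ang_Z R Rp c) = dr.Z"
    by (simp add: ang_Z_def dr.Z_def Let_def j.j_finsum j.j_smult refl_in refl_image_def)
  then show ?thesis
    by (simp add: ang_phi_def dr.\<phi>_def dr.N_def Let_def j.j_smult j.j_add j.j_one j.\<kappa>_mult[symmetric])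
qed

lemma j_casimir: "j (sl2_casimir R Rp c y x) = dr.omega"
proof -
  have "j (sl2_H R Rp c y x) = dr.h"
    by (simp add: sl2_H_def dr.h_def sum.distrib Let_def j.j_finsum j.j_smult j.j_add j.j_mult)
  moreover have "j (sl2_X R Rp c x) = \<kappa> (-1/2) * dr.xs"
    by (simp add: sl2_X_def dr.xs_def Let_def j.j_finsum j.j_smult j.j_mult)
  moreover have "j (sl2_Y R Rp c y) = \<kappa> (1/2) * dr.ys"
    by (simp add: sl2_Y_def dr.ys_def Let_def j.j_finsum j.j_smult j.j_mult)
  ultimately show ?thesis
    by (simp add: sl2_casimir_def dr.omega_def Let_def j.j_add j.j_mult j.j_smult)
qed

text \<open>For \<open>at_ring\<close> of the Cherednik algebra, which is injective, this pulls back
  to an identity in the algebra.\<close>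

lemma j_casimir_eq:
  "j (sl2_casimir R Rp c y x) = j (ang_phi R Rp c) * j (ang_phi R Rp c) - \<kappa> 1
    - \<kappa> (1/2) * (\<Sum>i\<in>{1..DIM('e)}. \<Sum>k\<in>{1..DIM('e)}. j (M i k) * j (M i k))"
  unfolding j_casimir j_phi j_M by (rule dr.omega_MM)

text \<open>The \<open>C i\<close> are left abstract; they become the images of 1 \<otimes>
  c_i.\<close>

lemma j_dirac_square:
  assumes "\<And>i k. i \<in> {1..DIM('e)} \<Longrightarrow> C i * j (X k) = j (X k) * C i"
    and "\<And>i k. i \<in> {1..DIM('e)} \<Longrightarrow> C i * j (Y k) = j (Y k) * C i"
    and "\<And>i w. i \<in> {1..DIM('e)} \<Longrightarrow> w \<in> reflection_group R \<Longrightarrow> C i * j (ch_w R Rp c w) = j (ch_w R Rp c w) * C i"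
    and "\<And>i k. i \<in> {1..DIM('e)} \<Longrightarrow> k \<in> {1..DIM('e)} \<Longrightarrow> C i * C k + C k * C i = \<kappa> (if i = k then 2 else 0)"
    and D: "D = (\<Sum>(i, k)\<in>{(i, k). 1 \<le> i \<and> i < k \<and> k \<le> DIM('e)}. j (M i k) * (C i * C k)) - j (ang_phi R Rp c)"
  shows "D * D = j (sl2_casimir R Rp c y x) + \<kappa> 1"
proof -
  interpret dc: dunkl_clifford \<kappa> "{1..DIM('e)}" Rp "\<lambda>i. j (X i)" "\<lambda>i. j (Y i)" refl_image
    "\<lambda>\<alpha>. j (ch_x R Rp c \<alpha>)" "\<lambda>\<alpha>. j (ch_y R Rp c (coroot \<alpha>))" c coef_t coef_a coef_b coef_d C
    by unfold_locales (use assms(1-4) in \<open>auto simp: refl_image_def refl_in\<close>)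
  have "{(i, k). 1 \<le> i \<and> i < k \<and> k \<le> DIM('e)} = {(i, k). i \<in> {1..DIM('e)} \<and> k \<in> {1..DIM('e)} \<and> i < k}" by auto
  then have "D = dc.D - dr.\<phi>" by (simp only: D dc.D_def j_M j_phi)
  then show ?thesis by (simp only: dc.dirac_square j_casimir)
qed

end

section \<open>Membership in the angular momentum algebra\<close>

lemma D_alg:
  shows "complex_algebra D_alg" "carrier D_alg \<subseteq> carrier HH" "subring (carrier D_alg) HH"
    "a \<in> carrier D_alg \<Longrightarrow> z \<odot>\<^bsub>HH\<^esub> a \<in> carrier D_alg"
    "w \<in> reflection_group R \<Longrightarrow> ch_w R Rp c w \<in> carrier D_alg"
    "1 \<le> i \<Longrightarrow> i < k \<Longrightarrow> k \<le> DIM('e) \<Longrightarrow> M i k \<in> carrier D_alg"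
proof -
  have sub: "ch_w R Rp c ` reflection_group R \<union> {M i k | i k. 1 \<le> i \<and> i < k \<and> k \<le> DIM('e)} \<subseteq> carrier HH"
    by auto
  note * = HH.generated_subalg[OF sub, folded ang_alg_def]
  show "complex_algebra D_alg" "carrier D_alg \<subseteq> carrier HH" "subring (carrier D_alg) HH"
    "a \<in> carrier D_alg \<Longrightarrow> z \<odot>\<^bsub>HH\<^esub> a \<in> carrier D_alg"
    by (rule *, assumption?)+
  show "w \<in> reflection_group R \<Longrightarrow> ch_w R Rp c w \<in> carrier D_alg"
    "1 \<le> i \<Longrightarrow> i < k \<Longrightarrow> k \<le> DIM('e) \<Longrightarrow> M i k \<in> carrier D_alg"
    using *(4) by blast+
qed

lemma D_alg_eq: "D_alg = HH\<lparr>carrier := carrier D_alg\<rparr>"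
  by (simp add: ang_alg_def generated_subalg_def)

lemmas D_alg_closed = subringE(2-)[OF D_alg(3)]

lemma D_alg_minus: "a \<in> carrier D_alg \<Longrightarrow> b \<in> carrier D_alg \<Longrightarrow> a \<ominus>\<^bsub>HH\<^esub> b \<in> carrier D_alg"
  using D_alg_closed by (simp add: HH.minus_eq)

lemma D_alg_finsum: "(\<And>i. i \<in> B \<Longrightarrow> f i \<in> carrier D_alg) \<Longrightarrow> finsum HH f B \<in> carrier D_alg"
proof (induction B rule: infinite_finite_induct)
  case (insert i B)
  then show ?case
    using D_alg(2) D_alg_closed by (subst HH.finsum_insert) auto
qed (use D_alg_closed in auto)

text \<open>The generators have i < k, but the double sum for the Casimir element runs over all
  pairs; the others are covered by antisymmetry and the vanishing of the diagonal.\<close>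

lemma M_in: "i \<in> {1..DIM('e)} \<Longrightarrow> k \<in> {1..DIM('e)} \<Longrightarrow> M i k \<in> carrier D_alg"
proof -
  assume ik: "i \<in> {1..DIM('e)}" "k \<in> {1..DIM('e)}"
  consider "i < k" | "i = k" | "k < i" by linarith
  then show ?thesis
  proof cases
    case 1
    then show ?thesis using ik by (auto intro: D_alg)
  next
    case 2
    then show ?thesis using D_alg_closed by (simp add: M_eq HH.minus_eq HH.r_neg)
  next
    case 3
    have "M i k = \<zero>\<^bsub>HH\<^esub> \<ominus>\<^bsub>HH\<^esub> M k i"
      by (rule HH.at_ring_inj) (simp_all add: M_eq HH.at_ring_minus)
    then show ?thesis using 3 ik D_alg_closed by (auto intro!: D_alg_minus D_alg)
  qed
qed

lemma phi_in: "ang_phi R Rp c \<in> carrier D_alg"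
proof -
  have "ang_Z R Rp c \<in> carrier D_alg"
    by (auto simp: ang_Z_def Let_def refl_in intro!: D_alg_finsum D_alg)
  then show ?thesis
    using D_alg_closed D_alg(4) by (simp add: ang_phi_def Let_def)
qed

text \<open>The formula of \<open>omega_MM\<close>, pulled back along the injective
  \<open>at_ring\<close>, expresses the Casimir element by elements already known to lie in the
  subalgebra.\<close>

lemma casimir_in: "sl2_casimir R Rp c y x \<in> carrier D_alg"
proof -
  have "sl2_casimir R Rp c y x = ang_phi R Rp c \<otimes>\<^bsub>HH\<^esub> ang_phi R Rp c \<ominus>\<^bsub>HH\<^esub> \<one>\<^bsub>HH\<^esub>
    \<ominus>\<^bsub>HH\<^esub> (1/2) \<odot>\<^bsub>HH\<^esub> (\<Oplus>\<^bsub>HH\<^esub>i\<in>{1..DIM('e)}. \<Oplus>\<^bsub>HH\<^esub>k\<in>{1..DIM('e)}. M i k \<otimes>\<^bsub>HH\<^esub> M i k)"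
    by (rule HH.at_ring_inj)
      (simp_all add: j_casimir_eq[OF HH.algebra_to_ring_at_ring] HH.at_ring_minus HH.at_ring_mult HH.at_ring_one
        HH.at_ring_smult HH.at_ring_finsum Pi_def)
  also have "\<dots> \<in> carrier D_alg"
    by (intro D_alg_minus D_alg(4) D_alg_finsum D_alg_closed phi_in M_in)
  finally show ?thesis .
qed

section \<open>Descent of the identity to the subalgebra\<close>

abbreviation "AC \<equiv> ang_cliff R Rp c y x"

lemma tensor_subalgebra_D_alg:
  obtains p where "tensor_subalgebra HH (clifford DIM('e)) (carrier D_alg) p"
proof (rule projection_onto_subspace[of "carrier D_alg", folded HH_eq])
  show "carrier D_alg \<subseteq> carrier HH" by (rule D_alg)
  show "\<zero>\<^bsub>HH\<^esub> \<in> carrier D_alg"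
    "\<And>a b. a \<in> carrier D_alg \<Longrightarrow> b \<in> carrier D_alg \<Longrightarrow> a \<oplus>\<^bsub>HH\<^esub> b \<in> carrier D_alg"
    by (rule D_alg_closed; assumption?)+
  show "z \<odot>\<^bsub>HH\<^esub> a \<in> carrier D_alg" if "a \<in> carrier D_alg" for z a
    using that by (rule D_alg)
next
  fix p
  assume p: "\<And>a. a \<in> carrier HH \<Longrightarrow> p a \<in> carrier D_alg" "\<And>a. a \<in> carrier D_alg \<Longrightarrow> p a = a"
    "\<And>a b. a \<in> carrier HH \<Longrightarrow> b \<in> carrier HH \<Longrightarrow> p (a \<oplus>\<^bsub>HH\<^esub> b) = p a \<oplus>\<^bsub>HH\<^esub> p b"
    "\<And>z a. a \<in> carrier HH \<Longrightarrow> p (z \<odot>\<^bsub>HH\<^esub> a) = z \<odot>\<^bsub>HH\<^esub> p a"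
  have "complex_algebra (HH\<lparr>carrier := carrier D_alg\<rparr>)"
    using D_alg(1) D_alg_eq by metis
  then have "tensor_subalgebra HH (clifford DIM('e)) (carrier D_alg) p"
    by (intro tensor_subalgebra.intro tensor_subalgebra_axioms.intro HH.complex_algebra_axioms
        complex_algebra_clifford D_alg(2) p)
  then show thesis by (rule that)
qed

lemma dirac0_squared:
  "dirac0 R Rp c y x \<in> carrier AC \<and>
   dirac0 R Rp c y x [^]\<^bsub>AC\<^esub> (2::nat)
     = ang_embed R Rp c y x (sl2_casimir R Rp c y x \<oplus>\<^bsub>HH\<^esub> \<one>\<^bsub>HH\<^esub>)"
proof -
  interpret CL: complex_algebra "clifford DIM('e)" by (rule complex_algebra_clifford)
  obtain p where "tensor_subalgebra HH (clifford DIM('e)) (carrier D_alg) p"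
    by (rule tensor_subalgebra_D_alg)
  then interpret ts: tensor_subalgebra HH "clifford DIM('e)" "carrier D_alg" p .
  let ?g = "clifford_gen DIM('e)"
  let ?P = "{(i, k). 1 \<le> i \<and> i < k \<and> k \<le> DIM('e)}"
  have K: "ts.K = D_alg" by (rule D_alg_eq[symmetric])
  have KT: "ts.KB.T = AC" by (simp only: K ang_cliff_def)
  have tns: "ts.KB.tns = ang_tensor R Rp c y x" by (simp only: K ang_tensor_def)
  \<comment> \<open>The expression defining \<open>dirac0\<close>, with its tensors read over the
    whole Cherednik algebra.\<close>
  define U where "U = finsum ts.AB.T (\<lambda>(i, k). ts.AB.tns (M i k) (?g i \<otimes>\<^bsub>clifford DIM('e)\<^esub> ?g k)) ?P
      \<ominus>\<^bsub>ts.AB.T\<^esub> ts.AB.tns (ang_phi R Rp c) \<one>\<^bsub>clifford DIM('e)\<^esub>"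
  have gc: "?g i \<in> carrier (clifford DIM('e))" if "i \<in> {1..DIM('e)}" for i by (rule clifford_gen_closed[OF that])
  have same: "ts.same U (dirac0 R Rp c y x)"
    unfolding U_def dirac0_def dirac_def ang_embed_def KT[symmetric] tns[symmetric]
    by (intro ts.same_minus ts.same_finsum ts.same_tensor phi_in CL.one_closed)
      (auto intro!: ts.same_tensor M_in CL.m_closed gc)
  let ?at = "at_ring ts.AB.T"
  let ?j = "\<lambda>a. ?at (ts.AB.tns a \<one>\<^bsub>clifford DIM('e)\<^esub>)"
  have j: "algebra_to_ring HH ts.AB.T.scalar ?j" by (rule ts.AB.algebra_to_ring_tensor)
  define C where "C i = ?at (ts.AB.tns \<one>\<^bsub>HH\<^esub> (?g i))" for i
  have Uc: "U \<in> carrier ts.AB.T" using ts.same_closed[OF same] by simp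
  \<comment> \<open>The tensor product is ungraded, so elements of the two factors commute without
    signs.\<close>
  have comm: "C i * ?j a = ?j a * C i" if "i \<in> {1..DIM('e)}" "a \<in> carrier HH" for i a
    using that gc by (simp add: C_def ts.AB.T.at_ring_mult[symmetric] ts.AB.tensor_mult)
  have "?at U * ?at U = ?j (sl2_casimir R Rp c y x) + ts.AB.T.scalar 1"
  proof (rule j_dirac_square[OF j, where C = C])
    fix i k assume ik: "i \<in> {1..DIM('e)}" "k \<in> {1..DIM('e)}"
    have "C i * C k + C k * C i = ?at (ts.AB.tns \<one>\<^bsub>HH\<^esub> (?g i \<otimes>\<^bsub>clifford DIM('e)\<^esub> ?g k \<oplus>\<^bsub>clifford DIM('e)\<^esub> ?g k \<otimes>\<^bsub>clifford DIM('e)\<^esub> ?g i))"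
      using gc[OF ik(1)] gc[OF ik(2)]
      by (simp add: C_def ts.AB.T.at_ring_mult[symmetric] ts.AB.T.at_ring_add[symmetric] ts.AB.tensor_mult ts.AB.tensor_add_right)
    also have "\<dots> = ts.AB.T.scalar (if i = k then 2 else 0) * ts.AB.T.scalar 1"
      unfolding clifford_anticommute[OF ik]
      by (simp only: ts.AB.tensor_smult_right HH.one_closed CL.one_closed ts.AB.tensor_one ts.AB.T.at_ring_smult
          ts.AB.T.one_closed ts.AB.T.at_ring_one)
    finally show "C i * C k + C k * C i = ts.AB.T.scalar (if i = k then 2 else 0)"
      by (simp only: ts.AB.T.scalars.\<kappa>_mult[symmetric] mult_1_right)
  next
    have "?j a * (C i * C k) = ?at (ts.AB.tns a (?g i \<otimes>\<^bsub>clifford DIM('e)\<^esub> ?g k))"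
      if "a \<in> carrier HH" "i \<in> {1..DIM('e)}" "k \<in> {1..DIM('e)}" for a i k
      using that gc[OF that(2)] gc[OF that(3)]
      by (simp add: C_def ts.AB.T.at_ring_mult[symmetric] ts.AB.tensor_mult)
    moreover have "(\<lambda>(i, k). ts.AB.tns (M i k) (?g i \<otimes>\<^bsub>clifford DIM('e)\<^esub> ?g k)) \<in> ?P \<rightarrow> carrier ts.AB.T"
      by (auto intro!: ts.AB.tensor_closed CL.m_closed gc)
    moreover have "ts.AB.tns (ang_phi R Rp c) \<one>\<^bsub>clifford DIM('e)\<^esub> \<in> carrier ts.AB.T"
      by simp
    ultimately show "?at U = (\<Sum>(i, k)\<in>?P. ?j (M i k) * (C i * C k)) - ?j (ang_phi R Rp c)"
      unfolding U_def
      by (subst ts.AB.T.at_ring_minus; (subst ts.AB.T.at_ring_finsum)?)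
        (auto intro!: sum.cong ts.AB.T.finsum_closed)
  qed (rule comm; simp)+
  then have "?at (U \<otimes>\<^bsub>ts.AB.T\<^esub> U) = ?at (ts.AB.tns (sl2_casimir R Rp c y x \<oplus>\<^bsub>HH\<^esub> \<one>\<^bsub>HH\<^esub>) \<one>\<^bsub>clifford DIM('e)\<^esub>)"
    using Uc by (simp add: ts.AB.T.at_ring_mult ts.AB.tensor_add_left ts.AB.T.at_ring_add ts.AB.tensor_one ts.AB.T.at_ring_one)
  then have "U \<otimes>\<^bsub>ts.AB.T\<^esub> U = ts.AB.tns (sl2_casimir R Rp c y x \<oplus>\<^bsub>HH\<^esub> \<one>\<^bsub>HH\<^esub>) \<one>\<^bsub>clifford DIM('e)\<^esub>"
    using Uc by (intro ts.AB.T.at_ring_inj) auto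
  \<comment> \<open>Both sides of the identity have counterparts over the subalgebra, the right one
    by \<open>casimir_in\<close>; \<open>same_inj\<close> identifies these counterparts.\<close>
  moreover have "ts.same (U \<otimes>\<^bsub>ts.AB.T\<^esub> U) (dirac0 R Rp c y x \<otimes>\<^bsub>ts.KB.T\<^esub> dirac0 R Rp c y x)"
    by (intro ts.same_mult same)
  moreover have "ts.same (ts.AB.tns (sl2_casimir R Rp c y x \<oplus>\<^bsub>HH\<^esub> \<one>\<^bsub>HH\<^esub>) \<one>\<^bsub>clifford DIM('e)\<^esub>)
      (ts.KB.tns (sl2_casimir R Rp c y x \<oplus>\<^bsub>HH\<^esub> \<one>\<^bsub>HH\<^esub>) \<one>\<^bsub>clifford DIM('e)\<^esub>)"
    by (intro ts.same_tensor D_alg_closed casimir_in CL.one_closed)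
  ultimately have "dirac0 R Rp c y x \<otimes>\<^bsub>ts.KB.T\<^esub> dirac0 R Rp c y x
      = ts.KB.tns (sl2_casimir R Rp c y x \<oplus>\<^bsub>HH\<^esub> \<one>\<^bsub>HH\<^esub>) \<one>\<^bsub>clifford DIM('e)\<^esub>"
    by (metis ts.same_inj)
  moreover have "dirac0 R Rp c y x \<in> carrier ts.KB.T" using ts.same_closed[OF same] by simp
  moreover from this have "dirac0 R Rp c y x [^]\<^bsub>ts.KB.T\<^esub> (2::nat) = dirac0 R Rp c y x \<otimes>\<^bsub>ts.KB.T\<^esub> dirac0 R Rp c y x"
    by (simp add: numeral_2_eq_2)
  ultimately show ?thesis by (simp only: KT tns ang_embed_def)
qed

end

text \<open>\<open>ang_embed\<close> can be applied to any coset, but the tensor relations concern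
  elements of the subalgebra only; membership of the Casimir element is therefore part of the claim.
  A Casimir element is understood up to an additive constant, and the one with this square root is
  the quadratic Casimir element plus one.\<close>

theorem corollary3p6:
  fixes R Rp :: "'e::euclidean_space dual set"
    and c :: "'e dual \<Rightarrow> complex"
    and y :: "nat \<Rightarrow> 'e"
    and x :: "nat \<Rightarrow> 'e dual"
  assumes "root_system R"
    and "positive_system R Rp"
    and "invariant_parameter R Rp c"
    and "orthonormal_basis y"
    and "dual_basis y x"
  shows "dirac0 R Rp c y x \<in> carrier (ang_cliff R Rp c y x)
    \<and> sl2_casimir R Rp c y x \<in> carrier (ang_alg R Rp c y x)
    \<and> dirac0 R Rp c y x [^]\<^bsub>ang_cliff R Rp c y x\<^esub> (2::nat)
        = ang_embed R Rp c y x
            (sl2_casimir R Rp c y x \<oplus>\<^bsub>cherednik R Rp c\<^esub> \<one>\<^bsub>cherednik R Rp c\<^esub>)"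
proof -
  interpret cherednik_basis R Rp c y x
    using assms by unfold_locales (auto simp: positive_system_def)
  show ?thesis using dirac0_squared casimir_in by blast
qed

end
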